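(* Let $\phi_{ABCD}$ be a massless spin-2 field on the Minkowski spacetime with F-gauge components $\phi_0,\dots,\phi_4$ admitting the expansion given in the context and satisfying the regularity condition $E^\ast_{p,m}=I^\ast_{p,m}=0$. For each integer $n\ge1$ there is a numerical factor $Q^+(n)$, depending only on $n$, such that the spin-2 Newman–Penrose constants at $\mathscr I^+$ are given by $$G_m^{n-1}=Q^+(n)\,C_{n+2,n+1,m},\qquad |m|\le n+1,$$ where $C_{n+2,n+1,m}$ is determined by the initial data $a_{0,n+2;n+1,m}(0)$ and $a_{4,n+2;n+1,m}(0)$ as specified in the context.
   Context: Geometry. $(\mathcal M,g)$ is the conformal extension of Minkowski space with coordinates $\tau\in[-1,1]$, $\rho\ge0$ and points of $\mathbb S^2$, with $g=d\tau^2-\rho^{-2}(1-\tau^2)d\rho^2+2\rho^{-1}\tau\,d\tau\,d\rho-\sigma=\Theta^2\tilde\eta$, where $\Theta=\rho(1-\tau^2)$, $\sigma$ is the unit round metric and $\tilde\eta=d\tilde t^2-d\tilde\rho^2-\tilde\rho^2\sigma$ is the Minkowski metric, with $\tilde t=\tau/(\rho(1-\tau^2))$, $\tilde\rho=1/(\rho(1-\tau^2))$. $\mathscr I^\pm=\{\tau=\pm1\}$. The F-frame is $e_{00'}=\tfrac{\sqrt2}{2}((1-\tau)\partial_\tau+\rho\partial_\rho)$, $e_{11'}=\tfrac{\sqrt2}{2}((1+\tau)\partial_\tau-\rho\partial_\rho)$, $e_{01'}=\tfrac{\sqrt2}{2}\partial_+$, $e_{10'}=\tfrac{\sqrt2}{2}\partial_-$,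 with $\partial_+=\overline{\partial_-}$ a complex null frame on $\mathbb S^2$, $\sigma^{-1}=\tfrac12(\partial_+\otimes\partial_-+\partial_-\otimes\partial_+)$. Harmonics. $Y_{s;\ell,m}$ are the $L^2(\mathbb S^2)$-orthonormal spin-weighted spherical harmonics, with $\eth Y_{s;\ell,m}=\sqrt{(\ell-s)(\ell+s+1)}\,Y_{s+1;\ell,m}$, $\bar\eth Y_{s;\ell,m}=-\sqrt{(\ell+s)(\ell-s+1)}\,Y_{s-1;\ell,m}$. Field. The massless spin-2 equation $\nabla_{A'}{}^{A}\phi_{ABCD}=0$ on $(\mathcal M,g)$, for the components $\phi_0,\dots,\phi_4$ (spin weights $2,1,0,-1,-2$) in the spin dyad adapted to the F-frame, reads $(1+\tau)\partial_\tau\phi_0-\rho\partial_\rho\phi_0+\eth\phi_1=-2\phi_0$, $\partial_\tau\phi_1+\tfrac12\bar\eth\phi_0+\tfrac12\eth\phi_2=-\phi_1$, $\partial_\tau\phi_2+\tfrac12\bar\eth\phi_1+\tfrac12\eth\phi_3=0$, $\partial_\tau\phi_3+\tfrac12\bar\eth\phi_2+\tfrac12\eth\phi_4=\phi_3$, $(1-\tau)\partial_\tau\phi_4+\rho\partial_\rho\phi_4+\bar\eth\phi_3=2\phi_4$, together with $\tau\partial_\tau\phi_k-\rho\partial_\rho\phi_k+\tfrac12\eth\phi_{k+1}-\tfrac12\bar\eth\phi_{k-1}=0$ for $k=1,2,3$. The fields are smooth in $(\tau,\rho)$ and have expansions near $\rho=0$ $$\phi_n=\sum_{p\ge|2-n|}\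 \sum_{\ell=|2-n|}^{p}\ \sum_{m=-\ell}^{\ell}\frac1{p!}\,a_{n,p;\ell,m}(\tau)\,Y_{2-n;\ell,m}\,\rho^p,\qquad n=0,\dots,4,$$ convergent together with all termwise derivatives, locally uniformly for $|\tau|\le1$, $0\le\rho<\rho_0$. Regularity condition. For $\ell=p$ one has $a_{0,p;p,m}=(\tfrac{1-\tau}{2})^{p+2}(\tfrac{1+\tau}{2})^{p-2}\big(E_{p,m}+E^\ast_{p,m}\int_0^\tau\frac{ds}{(1+s)^{p-1}(1-s)^{p+3}}\big)$ and $a_{4,p;p,m}=(\tfrac{1+\tau}{2})^{p+2}(\tfrac{1-\tau}{2})^{p-2}\big(I_{p,m}+I^\ast_{p,m}\int_0^\tau\frac{ds}{(1-s)^{p-1}(1+s)^{p+3}}\big)$ with constants $E,E^\ast,I,I^\ast$; the condition is $E^\ast_{p,m}=I^\ast_{p,m}=0$ for all $p\ge2$, $|m|\le p$. Constants $C$. For $2\le\ell<p$ put $Q^1_{p,\ell}(\tau)=(\tfrac{1-\tau}{2})^{p+2}P_{\ell-2}^{(p+2,-p+2)}(\tau)$, $Q^3_{p,\ell}(\tau)=(\tfrac{1+\tau}{2})^{p-2}P_{\ell+2}^{(-p-2,p-2)}(\tau)$, where $P_k^{(\alpha,\beta)}(x)=\sum_{s=0}^k\binom{k+\alpha}{k-s}\binom{k+\beta}{s}\left(\tfrac{x-1}{2}\right)^s\left(\tfrac{x+1}{2}\right)^{k-s}$ are Jacobi polynomials (generalized binomial coefficients), and $$X_{p,\ell}(\tau)=\begin{pmatrix}Q^1_{p,\ell}(\tau)&(-1)^{\ell}Q^3_{p,\ell}(\tau)\\(-1)^{\ell}Q^3_{p,\ell}(-\tau)&Q^1_{p,\ell}(-\tau)\end{pmatrix}.$$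 Then $(C_{p,\ell,m},D_{p,\ell,m})^{T}:=X_{p,\ell}(0)^{-1}(a_{0,p;\ell,m}(0),a_{4,p;\ell,m}(0))^{T}$. NP constants at $\mathscr I^+$. Let $\phi_0'=\frac{16}{\rho^2(1+\tau)^4}\phi_4$ and $\tilde\phi_0=\tilde\rho^{-5}\phi_0'$ (the component of the physical spin-2 field in the dyad associated with the NP frame at $\mathscr I^+$). At fixed retarded time $\tilde u=\tilde t-\tilde\rho=-1/(\rho(1+\tau))$ and fixed angles, as $\tilde\rho\to\infty$, $\tilde\phi_0=\sum_{k=0}^N\tilde\phi_0^k\,\tilde\rho^{-5-k}+o(\tilde\rho^{-5-N})$ for every $N$, with $\tilde\phi_0^k$ independent of $\tilde\rho$. For $n\ge0$, $|m|\le n+2$, $G^n_m=\int_{\mathcal C}\overline{Y_{-2;n+2,m}}\,\tilde\phi_0^{n+1}\,dS$, where $\mathcal C\cong\mathbb S^2$ is a cut $\{\tau=1,\rho=\rho_\star\}$ of $\mathscr I^+$ with $0<\rho_\star<\rho_0$ ($\tilde u=-1/(2\rho_\star)$), and $dS$ is the area element of $\sigma$; the value is independent of the cut. ($Y_{-2;\ell,m}$ relative to the F-frame is the spin-weight $2$ harmonic relative to the NP frame, whose complex leg is $e'_{01'}=e_{10'}$.) *)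

theory Defs
  imports "HOL-Analysis.Analysis" "HOL-Library.Landau_Symbols"
begin

section \<open>Smoothness up to the boundary\<close>

text \<open>
  All sets used below are products of (open, closed or half-open) intervals with nonempty
  interior.  The derivatives are taken within the set, hence are one-sided at boundary points that
  belong to it; they are unique, and all of them are required to be jointly continuous on the set.
\<close>

primrec Ck_on :: "nat \<Rightarrow> 'a::euclidean_space set \<Rightarrow> ('a \<Rightarrow> complex) \<Rightarrow> bool" where
  "Ck_on 0 S f \<longleftrightarrow> continuous_on S f"
| "Ck_on (Suc k) S f \<longleftrightarrow> continuous_on S f \<and>
     (\<forall>b\<in>Basis. \<exists>f'.
        (\<forall>x\<in>S. ((\<lambda>t. f (x + t *\<^sub>R b)) has_vector_derivative f' x) (at 0 within {t. x + t *\<^sub>R b \<in> S})) \<and>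
        Ck_on k S f')"

definition smooth_on :: "'a::euclidean_space set \<Rightarrow> ('a \<Rightarrow> complex) \<Rightarrow> bool" where
  "smooth_on S f \<longleftrightarrow> (\<forall>k. Ck_on k S f)"


section \<open>Spin-weighted functions on the sphere\<close>

text \<open>
  Spin-weighted functions are represented by their components in the polar chart
  \<open>(\<theta>, \<phi>) \<in> (0, \<pi>) \<times> \<real>\<close> (with \<open>2\<pi>\<close>-periodicity in \<open>\<phi>\<close>), with respect to the polar null frame
  proportional to \<open>\<partial>\<^sub>\<theta> \<plusminus> (i / sin \<theta>) \<partial>\<^sub>\<phi>\<close>.  The poles form a null set and carry no data.
\<close>

type_synonym sphere_fun = "real \<Rightarrow> real \<Rightarrow> complex"

definition chart :: "(real \<times> real) set" where
  "chart = {0<..<pi} \<times> UNIV"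

definition d_theta :: "sphere_fun \<Rightarrow> sphere_fun" where
  "d_theta f \<theta> \<phi> = vector_derivative (\<lambda>x. f x \<phi>) (at \<theta>)"

definition d_phi :: "sphere_fun \<Rightarrow> sphere_fun" where
  "d_phi f \<theta> \<phi> = vector_derivative (\<lambda>x. f \<theta> x) (at \<phi>)"

text \<open>
  For spin weight \<open>s\<close> this is the usual
  \<open>\<eth>f = - (sin \<theta>)\<^sup>s (\<partial>\<^sub>\<theta> + (i / sin \<theta>) \<partial>\<^sub>\<phi>) ((sin \<theta>)\<^sup>-\<^sup>s f)\<close>, written out, and its conjugate
  counterpart.
\<close>

definition eth :: "int \<Rightarrow> sphere_fun \<Rightarrow> sphere_fun" where
  "eth s f \<theta> \<phi> = - (d_theta f \<theta> \<phi> + \<i> / of_real (sin \<theta>) * d_phi f \<theta> \<phi>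
                     - of_int s * of_real (cot \<theta>) * f \<theta> \<phi>)"

definition ethbar :: "int \<Rightarrow> sphere_fun \<Rightarrow> sphere_fun" where
  "ethbar s f \<theta> \<phi> = - (d_theta f \<theta> \<phi> - \<i> / of_real (sin \<theta>) * d_phi f \<theta> \<phi>
                        + of_int s * of_real (cot \<theta>) * f \<theta> \<phi>)"

text \<open>Words in \<open>\<eth>\<close> (\<^const>\<open>True\<close>) and its conjugate (\<^const>\<open>False\<close>), applied from left to right
  to a function of spin weight \<open>s\<close>.\<close>

fun eth_word :: "bool list \<Rightarrow> int \<Rightarrow> sphere_fun \<Rightarrow> sphere_fun" where
  "eth_word [] s f = f"
| "eth_word (True # w) s f = eth_word w (s + 1) (eth s f)"
| "eth_word (False # w) s f = eth_word w (s - 1) (ethbar s f)"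

definition sphere_integral :: "sphere_fun \<Rightarrow> complex" where
  "sphere_integral f =
     (LINT x : {0<..<pi} \<times> {0..<2 * pi} | lborel. sin (fst x) *\<^sub>R f (fst x) (snd x))"

text \<open>
  \<open>Y s l m\<close>, for \<open>\<bar>s\<bar> \<le> l\<close> and \<open>\<bar>m\<bar> \<le> l\<close>, is the system of \<open>L\<^sup>2\<close>-orthonormal spin-weighted
  spherical harmonics.  The conditions determine it up to a constant phase for each \<open>(l, m)\<close>; no
  phase convention is fixed.  At the ends \<open>s = \<plusminus>l\<close> of the ladder the square root vanishes, so the
  value of \<open>Y\<close> outside the range is irrelevant.
\<close>

definition spin_weighted_harmonics :: "(int \<Rightarrow> nat \<Rightarrow> int \<Rightarrow> sphere_fun) \<Rightarrow> bool" where
  "spin_weighted_harmonics Y \<longleftrightarrow>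
     (\<forall>s l m. \<bar>s\<bar> \<le> int l \<and> \<bar>m\<bar> \<le> int l \<longrightarrow>
        smooth_on chart (\<lambda>(\<theta>, \<phi>). Y s l m \<theta> \<phi>) \<and>
        (\<forall>(\<theta>, \<phi>)\<in>chart.
           Y s l m \<theta> \<phi> = cis (of_int m * \<phi>) * Y s l m \<theta> 0 \<and>
           eth s (Y s l m) \<theta> \<phi>
             = of_real (sqrt (of_int ((int l - s) * (int l + s + 1)))) * Y (s + 1) l m \<theta> \<phi> \<and>
           ethbar s (Y s l m) \<theta> \<phi>
             = - of_real (sqrt (of_int ((int l + s) * (int l - s + 1)))) * Y (s - 1) l m \<theta> \<phi>)) \<and>
     (\<forall>s l l' m m'. \<bar>s\<bar> \<le> int l \<and> \<bar>m\<bar> \<le> int l \<and> \<bar>s\<bar> \<le> int l' \<and> \<bar>m'\<bar> \<le> int l' \<longrightarrow>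
        sphere_integral (\<lambda>\<theta> \<phi>. cnj (Y s l m \<theta> \<phi>) * Y s l' m' \<theta> \<phi>)
          = (if l = l' \<and> m = m' then 1 else 0))"


section \<open>Massless spin-2 fields in the F-gauge\<close>

text \<open>\<open>\<Phi> n \<tau> \<rho> \<theta> \<phi>\<close> is the component \<open>\<phi>\<^sub>n\<close>, \<open>n = 0, \<dots>, 4\<close>, of spin weight \<open>2 - n\<close>.\<close>

type_synonym spin2_field = "nat \<Rightarrow> real \<Rightarrow> real \<Rightarrow> sphere_fun"

definition d_tau :: "(real \<Rightarrow> real \<Rightarrow> sphere_fun) \<Rightarrow> real \<Rightarrow> real \<Rightarrow> sphere_fun" where
  "d_tau f \<tau> \<rho> \<theta> \<phi> = vector_derivative (\<lambda>t. f t \<rho> \<theta> \<phi>) (at \<tau> within {-1..1})"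

definition d_rho :: "(real \<Rightarrow> real \<Rightarrow> sphere_fun) \<Rightarrow> real \<Rightarrow> real \<Rightarrow> sphere_fun" where
  "d_rho f \<tau> \<rho> \<theta> \<phi> = vector_derivative (\<lambda>r. f \<tau> r \<theta> \<phi>) (at \<rho> within {0..})"

definition spin2_field_regular :: "spin2_field \<Rightarrow> bool" where
  "spin2_field_regular \<Phi> \<longleftrightarrow>
     (\<forall>n\<le>4. \<forall>(\<theta>, \<phi>)\<in>chart.
        smooth_on ({-1..1} \<times> {0..}) (\<lambda>(\<tau>, \<rho>). \<Phi> n \<tau> \<rho> \<theta> \<phi>) \<and>
        (\<forall>\<tau>\<in>{-1..1}. \<forall>\<rho>\<ge>0.
           (\<lambda>(x, y). \<Phi> n \<tau> \<rho> x y) differentiable at (\<theta>, \<phi>) \<and>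
           \<Phi> n \<tau> \<rho> \<theta> (\<phi> + 2 * pi) = \<Phi> n \<tau> \<rho> \<theta> \<phi>))"

text \<open>The components of \<open>\<nabla>\<^sub>A\<^sub>'\<^sup>A \<phi>\<^sub>A\<^sub>B\<^sub>C\<^sub>D = 0\<close> in the spin dyad adapted to the F-frame.\<close>

definition spin2_equations :: "spin2_field \<Rightarrow> bool" where
  "spin2_equations \<Phi> \<longleftrightarrow>
     (\<forall>\<tau>\<in>{-1..1}. \<forall>\<rho>\<ge>0. \<forall>(\<theta>, \<phi>)\<in>chart.
        of_real (1 + \<tau>) * d_tau (\<Phi> 0) \<tau> \<rho> \<theta> \<phi> - of_real \<rho> * d_rho (\<Phi> 0) \<tau> \<rho> \<theta> \<phi>
          + eth 1 (\<Phi> 1 \<tau> \<rho>) \<theta> \<phi> = - 2 * \<Phi> 0 \<tau> \<rho> \<theta> \<phi> \<and>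
        d_tau (\<Phi> 1) \<tau> \<rho> \<theta> \<phi> + 1/2 * ethbar 2 (\<Phi> 0 \<tau> \<rho>) \<theta> \<phi> + 1/2 * eth 0 (\<Phi> 2 \<tau> \<rho>) \<theta> \<phi>
          = - \<Phi> 1 \<tau> \<rho> \<theta> \<phi> \<and>
        d_tau (\<Phi> 2) \<tau> \<rho> \<theta> \<phi> + 1/2 * ethbar 1 (\<Phi> 1 \<tau> \<rho>) \<theta> \<phi> + 1/2 * eth (-1) (\<Phi> 3 \<tau> \<rho>) \<theta> \<phi>
          = 0 \<and>
        d_tau (\<Phi> 3) \<tau> \<rho> \<theta> \<phi> + 1/2 * ethbar 0 (\<Phi> 2 \<tau> \<rho>) \<theta> \<phi> + 1/2 * eth (-2) (\<Phi> 4 \<tau> \<rho>) \<theta> \<phi>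
          = \<Phi> 3 \<tau> \<rho> \<theta> \<phi> \<and>
        of_real (1 - \<tau>) * d_tau (\<Phi> 4) \<tau> \<rho> \<theta> \<phi> + of_real \<rho> * d_rho (\<Phi> 4) \<tau> \<rho> \<theta> \<phi>
          + ethbar (-1) (\<Phi> 3 \<tau> \<rho>) \<theta> \<phi> = 2 * \<Phi> 4 \<tau> \<rho> \<theta> \<phi> \<and>
        (\<forall>k\<in>{1, 2, 3}.
           of_real \<tau> * d_tau (\<Phi> k) \<tau> \<rho> \<theta> \<phi> - of_real \<rho> * d_rho (\<Phi> k) \<tau> \<rho> \<theta> \<phi>
             + 1/2 * eth (2 - int (k + 1)) (\<Phi> (k + 1) \<tau> \<rho>) \<theta> \<phi>
             - 1/2 * ethbar (2 - int (k - 1)) (\<Phi> (k - 1) \<tau> \<rho>) \<theta> \<phi> = 0))"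


section \<open>Expansions near spatial infinity\<close>

type_synonym coeffs = "nat \<Rightarrow> nat \<Rightarrow> nat \<Rightarrow> int \<Rightarrow> real \<Rightarrow> complex"

definition min_ell :: "nat \<Rightarrow> nat" where
  "min_ell n = nat \<bar>2 - int n\<bar>"

definition deriv_tau :: "(real \<Rightarrow> complex) \<Rightarrow> real \<Rightarrow> complex" where
  "deriv_tau f \<tau> = vector_derivative f (at \<tau> within {-1..1})"

text \<open>
  The derivative \<open>\<partial>\<^sub>\<tau>\<^sup>i \<partial>\<^sub>\<rho>\<^sup>j\<close>, followed by the word \<open>w\<close> in \<open>\<eth>\<close> and its conjugate, of the
  order-\<open>p\<close> term of the expansion of \<open>\<phi>\<^sub>n\<close>.  Each summand is a product of a function of \<open>\<tau>\<close>, a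
  function of \<open>\<rho>\<close> and a function of the angles, so the operators act on one factor each.
  For \<open>i = j = 0\<close> and \<open>w = []\<close> this is the term itself.
\<close>

definition term_deriv ::
  "(int \<Rightarrow> nat \<Rightarrow> int \<Rightarrow> sphere_fun) \<Rightarrow> coeffs \<Rightarrow> nat \<Rightarrow> nat \<Rightarrow> bool list \<Rightarrow> nat \<Rightarrow> nat
    \<Rightarrow> real \<Rightarrow> real \<Rightarrow> sphere_fun" where
  "term_deriv Y a i j w n p \<tau> \<rho> \<theta> \<phi> =
     (\<Sum>l = min_ell n..p. \<Sum>m = - int l..int l.
        1 / fact p * (deriv_tau ^^ i) (a n p l m) \<tau>
          * eth_word w (2 - int n) (Y (2 - int n) l m) \<theta> \<phi>
          * of_real ((deriv ^^ j) (\<lambda>r. r ^ p) \<rho>))"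

text \<open>
  Local uniformity in \<open>\<bar>\<tau>\<bar> \<le> 1\<close>, \<open>0 \<le> \<rho> < \<rho>\<^sub>0\<close> is uniformity on \<open>[-1, 1] \<times> [0, r]\<close> for all
  \<open>r < \<rho>\<^sub>0\<close>; since the sphere is compact, it is uniform in the angles.
\<close>

definition expansion_domain :: "real \<Rightarrow> (real \<times> real \<times> real \<times> real) set" where
  "expansion_domain r = {-1..1} \<times> {0..r} \<times> chart"

definition has_expansion ::
  "(int \<Rightarrow> nat \<Rightarrow> int \<Rightarrow> sphere_fun) \<Rightarrow> real \<Rightarrow> coeffs \<Rightarrow> spin2_field \<Rightarrow> bool" where
  "has_expansion Y \<rho>0 a \<Phi> \<longleftrightarrow>
     (\<forall>n\<le>4. \<forall>p l m. min_ell n \<le> l \<and> l \<le> p \<and> \<bar>m\<bar> \<le> int l \<longrightarrow> smooth_on {-1..1} (a n p l m)) \<and>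
     (\<forall>n\<le>4. \<forall>r. 0 \<le> r \<and> r < \<rho>0 \<longrightarrow>
        uniform_limit (expansion_domain r)
          (\<lambda>N (\<tau>, \<rho>, \<theta>, \<phi>). \<Sum>p = min_ell n..N. term_deriv Y a 0 0 [] n p \<tau> \<rho> \<theta> \<phi>)
          (\<lambda>(\<tau>, \<rho>, \<theta>, \<phi>). \<Phi> n \<tau> \<rho> \<theta> \<phi>) sequentially \<and>
        (\<forall>i j w. uniformly_convergent_on (expansion_domain r)
          (\<lambda>N (\<tau>, \<rho>, \<theta>, \<phi>). \<Sum>p = min_ell n..N. term_deriv Y a i j w n p \<tau> \<rho> \<theta> \<phi>)))"

text \<open>
  The integrals run over an oriented interval, and diverge at \<open>\<tau> = \<plusminus>1\<close>, so the representation is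
  stated in the open interval.
\<close>

definition top_mode_0 :: "nat \<Rightarrow> complex \<Rightarrow> complex \<Rightarrow> (real \<Rightarrow> complex) \<Rightarrow> bool" where
  "top_mode_0 p E Es f \<longleftrightarrow>
     (\<forall>\<tau>\<in>{-1<..<1}. f \<tau> =
        of_real (((1 - \<tau>) / 2) ^ (p + 2) * ((1 + \<tau>) / 2) ^ (p - 2)) *
        (E + Es * of_real (LBINT s=0..\<tau>. 1 / ((1 + s) ^ (p - 1) * (1 - s) ^ (p + 3)))))"

definition top_mode_4 :: "nat \<Rightarrow> complex \<Rightarrow> complex \<Rightarrow> (real \<Rightarrow> complex) \<Rightarrow> bool" where
  "top_mode_4 p I Is f \<longleftrightarrow>
     (\<forall>\<tau>\<in>{-1<..<1}. f \<tau> =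
        of_real (((1 + \<tau>) / 2) ^ (p + 2) * ((1 - \<tau>) / 2) ^ (p - 2)) *
        (I + Is * of_real (LBINT s=0..\<tau>. 1 / ((1 - s) ^ (p - 1) * (1 + s) ^ (p + 3)))))"

definition regularity_condition :: "coeffs \<Rightarrow> bool" where
  "regularity_condition a \<longleftrightarrow>
     (\<forall>p\<ge>2. \<forall>m. \<bar>m\<bar> \<le> int p \<longrightarrow>
        (\<exists>E Es I Is. top_mode_0 p E Es (a 0 p p m) \<and> top_mode_4 p I Is (a 4 p p m) \<and>
           Es = 0 \<and> Is = 0))"


section \<open>The constants determined by the initial data\<close>

definition jacobi_P :: "nat \<Rightarrow> real \<Rightarrow> real \<Rightarrow> real \<Rightarrow> real" where
  "jacobi_P k \<alpha> \<beta> x =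
     (\<Sum>s\<le>k. ((of_nat k + \<alpha>) gchoose (k - s)) * ((of_nat k + \<beta>) gchoose s)
              * ((x - 1) / 2) ^ s * ((x + 1) / 2) ^ (k - s))"

definition Q1 :: "nat \<Rightarrow> nat \<Rightarrow> real \<Rightarrow> real" where
  "Q1 p l \<tau> = ((1 - \<tau>) / 2) ^ (p + 2) * jacobi_P (l - 2) (real p + 2) (- real p + 2) \<tau>"

definition Q3 :: "nat \<Rightarrow> nat \<Rightarrow> real \<Rightarrow> real" where
  "Q3 p l \<tau> = ((1 + \<tau>) / 2) ^ (p - 2) * jacobi_P (l + 2) (- real p - 2) (real p - 2) \<tau>"

definition X_matrix :: "nat \<Rightarrow> nat \<Rightarrow> real \<Rightarrow> complex^2^2" where
  "X_matrix p l \<tau> =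
     vector [vector [of_real (Q1 p l \<tau>), of_real ((-1) ^ l * Q3 p l \<tau>)],
             vector [of_real ((-1) ^ l * Q3 p l (- \<tau>)), of_real (Q1 p l (- \<tau>))]]"

definition CD_constants :: "coeffs \<Rightarrow> nat \<Rightarrow> nat \<Rightarrow> int \<Rightarrow> complex^2" where
  "CD_constants a p l m = matrix_inv (X_matrix p l 0) *v vector [a 0 p l m 0, a 4 p l m 0]"

definition C_constant :: "coeffs \<Rightarrow> nat \<Rightarrow> nat \<Rightarrow> int \<Rightarrow> complex" where
  "C_constant a p l m = CD_constants a p l m $ 1"


section \<open>Newman--Penrose constants at future null infinity\<close>

definition phys_t :: "real \<Rightarrow> real \<Rightarrow> real" where
  "phys_t \<tau> \<rho> = \<tau> / (\<rho> * (1 - \<tau>\<^sup>2))"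

definition phys_r :: "real \<Rightarrow> real \<Rightarrow> real" where
  "phys_r \<tau> \<rho> = 1 / (\<rho> * (1 - \<tau>\<^sup>2))"

text \<open>The inverse of \<open>(\<tau>, \<rho>) \<mapsto> (phys_t \<tau> \<rho>, phys_r \<tau> \<rho>)\<close>.\<close>

definition tau_of :: "real \<Rightarrow> real \<Rightarrow> real" where
  "tau_of t r = t / r"

definition rho_of :: "real \<Rightarrow> real \<Rightarrow> real" where
  "rho_of t r = r / (r\<^sup>2 - t\<^sup>2)"

lemma tau_rho_of_phys:
  assumes "-1 < \<tau>" "\<tau> < 1" "0 < \<rho>"
  shows "tau_of (phys_t \<tau> \<rho>) (phys_r \<tau> \<rho>) = \<tau>" "rho_of (phys_t \<tau> \<rho>) (phys_r \<tau> \<rho>) = \<rho>"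
proof -
  define d where "d = \<rho> * (1 - \<tau>\<^sup>2)"
  have "\<tau>\<^sup>2 < 1" using assms by (simp add: abs_square_less_1 abs_if)
  then have d: "d > 0" "1 - \<tau>\<^sup>2 > 0" using assms by (simp_all add: d_def)
  then show "tau_of (phys_t \<tau> \<rho>) (phys_r \<tau> \<rho>) = \<tau>"
    unfolding tau_of_def phys_t_def phys_r_def d_def [symmetric] by simp
  have "(1 / d)\<^sup>2 - (\<tau> / d)\<^sup>2 = (1 - \<tau>\<^sup>2) / d\<^sup>2"
    by (simp add: power_divide diff_divide_distrib)
  then have "rho_of (phys_t \<tau> \<rho>) (phys_r \<tau> \<rho>) = (1 / d) / ((1 - \<tau>\<^sup>2) / d\<^sup>2)"
    unfolding rho_of_def phys_t_def phys_r_def d_def [symmetric] by simp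
  also have "\<dots> = d / (1 - \<tau>\<^sup>2)" using d by (simp add: power2_eq_square)
  also have "\<dots> = \<rho>" using d by (simp add: d_def)
  finally show "rho_of (phys_t \<tau> \<rho>) (phys_r \<tau> \<rho>) = \<rho>" .
qed

text \<open>The component \<open>\<phi>\<^sub>0'\<close> in the dyad associated with the NP frame at future null infinity is a
  multiple of \<open>\<phi>\<^sub>4\<close>: the complex leg of that frame is the conjugate of that of the F-frame.  This is
  also why functions of spin weight \<open>-2\<close> in the F-frame appear in the NP constants.\<close>

definition phi0' :: "spin2_field \<Rightarrow> real \<Rightarrow> real \<Rightarrow> sphere_fun" where
  "phi0' \<Phi> \<tau> \<rho> \<theta> \<phi> = of_real (16 / (\<rho>\<^sup>2 * (1 + \<tau>) ^ 4)) * \<Phi> 4 \<tau> \<rho> \<theta> \<phi>"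

definition phi0_phys :: "spin2_field \<Rightarrow> real \<Rightarrow> real \<Rightarrow> sphere_fun" where
  "phi0_phys \<Phi> u r \<theta> \<phi> =
     of_real (1 / r ^ 5) * phi0' \<Phi> (tau_of (u + r) r) (rho_of (u + r) r) \<theta> \<phi>"

text \<open>Asymptotic expansion along an outgoing ray of retarded time \<open>u\<close>; the coefficients are
  uniquely determined.\<close>

definition outgoing_expansion ::
  "spin2_field \<Rightarrow> real \<Rightarrow> real \<Rightarrow> real \<Rightarrow> (nat \<Rightarrow> complex) \<Rightarrow> bool" where
  "outgoing_expansion \<Phi> u \<theta> \<phi> c \<longleftrightarrow>
     (\<forall>N. (\<lambda>r. phi0_phys \<Phi> u r \<theta> \<phi> - (\<Sum>k\<le>N. c k * of_real (1 / r ^ (5 + k))))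
            \<in> o[at_top](\<lambda>r. of_real (1 / r ^ (5 + N))))"

definition outgoing_coeff :: "spin2_field \<Rightarrow> nat \<Rightarrow> real \<Rightarrow> sphere_fun" where
  "outgoing_coeff \<Phi> k u \<theta> \<phi> = (THE c. outgoing_expansion \<Phi> u \<theta> \<phi> c) k"

text \<open>\<open>G\<^sup>n\<^sub>m\<close> evaluated on the cut \<open>{\<tau> = 1, \<rho> = \<rho>\<^sub>\<star>}\<close>, which has retarded time
  \<open>-1 / (2 \<rho>\<^sub>\<star>)\<close>.\<close>

definition NP_constant ::
  "(int \<Rightarrow> nat \<Rightarrow> int \<Rightarrow> sphere_fun) \<Rightarrow> spin2_field \<Rightarrow> real \<Rightarrow> nat \<Rightarrow> int \<Rightarrow> complex" where
  "NP_constant Y \<Phi> \<rho>s n m =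
     sphere_integral (\<lambda>\<theta> \<phi>. cnj (Y (-2) (n + 2) m \<theta> \<phi>)
                             * outgoing_coeff \<Phi> (n + 1) (- 1 / (2 * \<rho>s)) \<theta> \<phi>)"

end

theory Submission
  imports Defs
begin

text \<open>
  Comparing powers of \<open>\<rho>\<close> and projecting onto the harmonics turns the field equations into ordinary
  differential equations for the \<open>a\<^sub>n\<^sub>,\<^sub>p\<^sub>;\<^sub>l\<^sub>,\<^sub>m\<close>; in particular \<open>b(\<tau>) = a\<^sub>4(\<tau>) (1 + \<tau>)\<^sup>-\<^sup>(\<^sup>p\<^sup>+\<^sup>2\<^sup>)\<close>
  satisfies a Jacobi equation of degree \<open>l - 2\<close>.  On an outgoing ray \<open>\<tau> = 1 + u / r\<close> and
  \<open>\<rho> = - 1 / (u (1 + \<tau>))\<close>, so that \<open>G\<^sup>n\<^sup>-\<^sup>1\<^sub>m\<close> is a combination of the derivatives \<open>b\<^sup>(\<^sup>l\<^sup>-\<^sup>1\<^sup>)(1)\<close> with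
  \<open>l = n + 1\<close> and all \<open>p \<ge> l\<close>.  Differentiating the Jacobi equation \<open>l - 2\<close> times removes its
  zeroth-order term, and at \<open>\<tau> = 1\<close> it becomes \<open>(p - l - 1) b\<^sup>(\<^sup>l\<^sup>-\<^sup>1\<^sup>)(1) = 0\<close>: only \<open>p = l + 1\<close>
  contributes.  In that case \<open>Q\<^sup>1\<close> is a partial sum of the binomial expansion of
  \<open>((1 + \<tau>)/2 + (1 - \<tau>)/2)\<^sup>2\<^sup>l\<^sup>+\<^sup>1\<close> and \<open>(-1)\<^sup>l Q\<^sup>3 = 1 - Q\<^sup>1\<close>, hence \<open>a\<^sub>4 = C + K Q\<^sup>1(- \<tau>)\<close>.  The term in
  \<open>K\<close> contributes a polynomial of degree \<open>l - 2\<close> to \<open>b\<close>, so \<open>b\<^sup>(\<^sup>l\<^sup>-\<^sup>1\<^sup>)(1)\<close> is a multiple of \<open>C\<close>.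
\<close>

section \<open>One-sided derivatives and series\<close>

text \<open>The weight (1 + \<tau>)^-(p+2) comes from the ray itself: there \<rho>^p is (-1/u)^p (1
  + \<tau>)^-p, and the prefactor 16 / (\<rho>^2 (1 + \<tau>)^4) is 16 u^2 / (1 + \<tau>)^2. Since
  \<tau> - 1 = u / r, the coefficient of r^-(5+k) is u^k / k! times the k-th \<tau>-derivative at
  \<tau> = 1, so everything has to be differentiated one-sidedly at an endpoint where the mode
  equations degenerate. Two obstacles shape the proof. Every order p enters every coefficient, so
  the sum over p must be exchanged with arbitrarily many derivatives along the ray and with the
  integral over the sphere. And the equation for a_4 alone leaves two constants, while C is defined
  through the data of a_0 and a_4 together: for p = l + 1 the two are tied by having equal values at
  \<tau> = 1 and at \<tau> = -1. The powers of u cancel at p = n + 2, which makes the factor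
  independent of the cut.\<close>

lemma has_vector_derivative_unique_Icc:
  fixes f :: "real \<Rightarrow> complex"
  assumes "a < b" "x \<in> {a..b}"
    and "(f has_vector_derivative d) (at x within {a..b})"
    and "(f has_vector_derivative d') (at x within {a..b})"
  shows "d = d'"
  using vector_derivative_within_closed_interval[OF assms(1,2,3)]
    vector_derivative_within_closed_interval[OF assms(1,2,4)] by simp

lemma has_vector_derivative_cong_on:
  assumes "(f has_vector_derivative d) (at x within S)" "x \<in> S" "\<And>y. y \<in> S \<Longrightarrow> g y = f y"
  shows "(g has_vector_derivative d) (at x within S)"
  using has_vector_derivative_transform[OF assms(2) _ assms(1)] assms(3) by blast

text \<open>\<open>Ck_on\<close> only asserts that some derivative exists; this lets that witness be
  traded for a named function agreeing with it on the set.\<close>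

lemma Ck_on_cong:
  assumes "\<And>x. x \<in> S \<Longrightarrow> f x = g x" "Ck_on k S f"
  shows "Ck_on k S g"
proof (cases k)
  case 0
  then show ?thesis using assms continuous_on_cong[of S S f g] by simp
next
  case (Suc j)
  have "continuous_on S g"
    using assms Suc continuous_on_cong[of S S f g] by simp
  moreover have "\<exists>f'. (\<forall>x\<in>S. ((\<lambda>t. g (x + t *\<^sub>R b)) has_vector_derivative f' x)
      (at 0 within {t. x + t *\<^sub>R b \<in> S})) \<and> Ck_on j S f'" if b: "b \<in> Basis" for b
  proof -
    obtain f' where f': "\<forall>x\<in>S. ((\<lambda>t. f (x + t *\<^sub>R b)) has_vector_derivative f' x)
      (at 0 within {t. x + t *\<^sub>R b \<in> S})" "Ck_on j S f'"
      using assms(2) b unfolding Suc by auto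
    have "((\<lambda>t. g (x + t *\<^sub>R b)) has_vector_derivative f' x)
      (at 0 within {t. x + t *\<^sub>R b \<in> S})" if "x \<in> S" for x
      by (rule has_vector_derivative_cong_on[OF f'(1)[rule_format, OF that]])
        (use that assms(1) in auto)
    then show ?thesis using f'(2) by blast
  qed
  ultimately show ?thesis by (simp add: Suc)
qed

text \<open>Translation by x turns the increment form used in \<open>Ck_on\<close>, a derivative at
  0, into a derivative at x.\<close>

lemma has_vector_derivative_shift:
  fixes f :: "real \<Rightarrow> complex"
  assumes "((\<lambda>t. f (x + t)) has_vector_derivative d) (at 0 within {t. x + t \<in> S})"
  shows "(f has_vector_derivative d) (at x within S)"
proof -
  have eq: "(\<lambda>y. y - x) ` S = {t. x + t \<in> S}"
    by (force simp: image_iff)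
  have "((\<lambda>t. f (x + t)) has_vector_derivative d) (at (x - x) within (\<lambda>y. y - x) ` S)"
    using assms eq by simp
  from vector_diff_chain_within[of "\<lambda>y. y - x" 1 x S, OF _ this]
  show ?thesis by (simp add: o_def has_vector_derivative_diff_const)
qed

text \<open>The witnesses supplied by \<open>Ck_on\<close> may differ for each k. One-sided
  derivatives on a nondegenerate closed interval are unique, so all of them agree with
  \<open>deriv_tau f\<close> on [-1, 1].\<close>

lemma smooth_on_deriv_tau:
  assumes "smooth_on {-1..1} f"
  shows "\<And>\<tau>. \<tau> \<in> {-1..1} \<Longrightarrow> (f has_vector_derivative deriv_tau f \<tau>) (at \<tau> within {-1..1})"
    and "smooth_on {-1..1} (deriv_tau f)"
proof -
  have *: "Ck_on k {-1..1} (deriv_tau f) \<and>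
      (\<forall>\<tau>\<in>{-1..1}. (f has_vector_derivative deriv_tau f \<tau>) (at \<tau> within {-1..1}))" for k
  proof -
    have "\<forall>b\<in>Basis. \<exists>f'. (\<forall>x\<in>{-1..1}. ((\<lambda>t. f (x + t *\<^sub>R b)) has_vector_derivative f' x)
      (at 0 within {t. x + t *\<^sub>R b \<in> {-1..1}})) \<and> Ck_on k {-1..1} f'"
      using spec[OF assms[unfolded smooth_on_def], of "Suc k", unfolded Ck_on.simps(2)]
      by (rule conjunct2)
    from bspec[OF this, of 1]
    obtain f' where f': "\<forall>x\<in>{-1..1}. ((\<lambda>t. f (x + t)) has_vector_derivative f' x)
      (at 0 within {t. x + t \<in> {-1..1}})" and C: "Ck_on k {-1..1} f'"
      unfolding real_scaleR_def mult_1_right using Basis_real_def by blast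
    have d: "(f has_vector_derivative f' \<tau>) (at \<tau> within {-1..1})" if "\<tau> \<in> {-1..1}" for \<tau>
      by (rule has_vector_derivative_shift) (rule f'[rule_format, OF that])
    have e: "deriv_tau f \<tau> = f' \<tau>" if "\<tau> \<in> {-1..1}" for \<tau>
      unfolding deriv_tau_def
      by (rule vector_derivative_within_closed_interval) (use d that in auto)
    have "Ck_on k {-1..1} (deriv_tau f)" by (rule Ck_on_cong[OF _ C]) (simp add: e)
    then show ?thesis using d e by simp
  qed
  then show "\<And>\<tau>. \<tau> \<in> {-1..1} \<Longrightarrow> (f has_vector_derivative deriv_tau f \<tau>) (at \<tau> within {-1..1})"
    by blast
  show "smooth_on {-1..1} (deriv_tau f)" using * by (simp add: smooth_on_def)
qed

lemma smooth_on_deriv_tau_funpow: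
  assumes "smooth_on {-1..1} f"
  shows "smooth_on {-1..1} ((deriv_tau ^^ i) f)"
  by (induction i) (use assms smooth_on_deriv_tau(2) in auto)

lemma has_vector_derivative_deriv_tau_funpow:
  assumes "smooth_on {-1..1} f" "\<tau> \<in> {-1..1}"
  shows "((deriv_tau ^^ i) f has_vector_derivative (deriv_tau ^^ Suc i) f \<tau>) (at \<tau> within {-1..1})"
  using smooth_on_deriv_tau(1)[OF smooth_on_deriv_tau_funpow[OF assms(1)] assms(2)] by simp

text \<open>The chart is open in both coordinates, so the derivatives within the set that
  \<open>smooth_on\<close> provides are the two-sided ones of \<open>d_theta\<close> and
  \<open>d_phi\<close>.\<close>

lemma chart_partials:
  assumes "smooth_on chart (\<lambda>(\<theta>, \<phi>). f \<theta> \<phi>)" "(\<theta>, \<phi>) \<in> chart"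
  shows "((\<lambda>x. f x \<phi>) has_vector_derivative d_theta f \<theta> \<phi>) (at \<theta>)"
    and "((\<lambda>x. f \<theta> x) has_vector_derivative d_phi f \<theta> \<phi>) (at \<phi>)"
proof -
  let ?F = "\<lambda>(\<theta>, \<phi>). f \<theta> \<phi>"
  have C: "\<forall>b\<in>Basis. \<exists>f'. (\<forall>x\<in>chart. ((\<lambda>t. ?F (x + t *\<^sub>R b)) has_vector_derivative f' x)
      (at 0 within {t. x + t *\<^sub>R b \<in> chart})) \<and> Ck_on 0 chart f'"
    using spec[OF assms(1)[unfolded smooth_on_def], of "Suc 0", unfolded Ck_on.simps(2)]
    by (rule conjunct2)
  have B: "(1, 0) \<in> (Basis :: (real \<times> real) set)" "(0, 1) \<in> (Basis :: (real \<times> real) set)"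
    by (auto simp: Basis_prod_def)
  have th: "\<theta> \<in> {0<..<pi}" using assms(2) by (simp add: chart_def)
  obtain g where "((\<lambda>t. ?F ((\<theta>, \<phi>) + t *\<^sub>R (1, 0))) has_vector_derivative g (\<theta>, \<phi>))
      (at 0 within {t. (\<theta>, \<phi>) + t *\<^sub>R (1, 0) \<in> chart})"
    using bspec[OF C B(1)] assms(2) by blast
  then have "((\<lambda>t. f (\<theta> + t) \<phi>) has_vector_derivative g (\<theta>, \<phi>))
      (at 0 within {t. \<theta> + t \<in> {0<..<pi}})"
    by (simp add: chart_def)
  from has_vector_derivative_shift[OF this]
  have "((\<lambda>x. f x \<phi>) has_vector_derivative g (\<theta>, \<phi>)) (at \<theta>)"
    using th by (simp add: at_within_open[of \<theta> "{0<..<pi}"])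
  then show "((\<lambda>x. f x \<phi>) has_vector_derivative d_theta f \<theta> \<phi>) (at \<theta>)"
    by (simp add: d_theta_def vector_derivative_at)
  obtain h where "((\<lambda>t. ?F ((\<theta>, \<phi>) + t *\<^sub>R (0, 1))) has_vector_derivative h (\<theta>, \<phi>))
      (at 0 within {t. (\<theta>, \<phi>) + t *\<^sub>R (0, 1) \<in> chart})"
    using bspec[OF C B(2)] assms(2) by blast
  then have "((\<lambda>t. f \<theta> (\<phi> + t)) has_vector_derivative h (\<theta>, \<phi>)) (at 0 within {t. \<phi> + t \<in> UNIV})"
    using th by (simp add: chart_def)
  from has_vector_derivative_shift[OF this]
  show "((\<lambda>x. f \<theta> x) has_vector_derivative d_phi f \<theta> \<phi>) (at \<phi>)"
    by (simp add: d_phi_def vector_derivative_at)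
qed

text \<open>A form of \<open>has_derivative_sequence\<close> with the limit \<open>F\<close> given
  in advance: the limit function which that theorem produces coincides with \<open>F\<close> on
  \<open>S\<close> by uniqueness of limits.\<close>

lemma has_vector_derivative_sequence:
  fixes f :: "nat \<Rightarrow> real \<Rightarrow> complex"
  assumes "convex S"
    and der: "\<And>n x. x \<in> S \<Longrightarrow> (f n has_vector_derivative f' n x) (at x within S)"
    and lim: "\<And>x. x \<in> S \<Longrightarrow> (\<lambda>n. f n x) \<longlonglongrightarrow> F x"
    and unif: "uniform_limit S f' G sequentially"
    and x: "x \<in> S"
  shows "(F has_vector_derivative G x) (at x within S)"
proof -
  have "\<exists>g. \<forall>x\<in>S. (\<lambda>n. f n x) \<longlonglongrightarrow> g x \<and> (g has_derivative (\<lambda>h. h *\<^sub>R G x)) (at x within S)"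
  proof (rule has_derivative_sequence[OF assms(1)])
    show "(f n has_derivative (\<lambda>h. h *\<^sub>R f' n x)) (at x within S)" if "x \<in> S" for n x
      using der[OF that] by (simp add: has_vector_derivative_def)
    show "\<forall>\<^sub>F n in sequentially. \<forall>x\<in>S. \<forall>h. norm (h *\<^sub>R f' n x - h *\<^sub>R G x) \<le> e * norm h"
      if "e > 0" for e
    proof -
      have "\<forall>\<^sub>F n in sequentially. \<forall>x\<in>S. dist (f' n x) (G x) < e"
        using unif that by (simp add: uniform_limit_iff)
      then show ?thesis
      proof (rule eventually_mono, intro ballI allI)
        fix n x and h :: real
        assume "\<forall>x\<in>S. dist (f' n x) (G x) < e" "x \<in> S"
        then have "norm (f' n x - G x) \<le> e" by (auto simp: dist_norm less_imp_le)
        moreover have "norm (h *\<^sub>R f' n x - h *\<^sub>R G x) = \<bar>h\<bar> * norm (f' n x - G x)"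
          by (metis norm_scaleR scaleR_diff_right)
        ultimately show "norm (h *\<^sub>R f' n x - h *\<^sub>R G x) \<le> e * norm h"
          by (metis abs_ge_zero mult.commute mult_left_mono real_norm_def)
      qed
    qed
  qed (use x lim in auto)
  then obtain g where g: "\<And>x. x \<in> S \<Longrightarrow> (\<lambda>n. f n x) \<longlonglongrightarrow> g x"
    "\<And>x. x \<in> S \<Longrightarrow> (g has_vector_derivative G x) (at x within S)"
    by (auto simp: has_vector_derivative_def)
  show ?thesis
    by (rule has_vector_derivative_cong_on[OF g(2)[OF x] x])
      (use g(1) lim LIMSEQ_unique in blast)
qed

text \<open>Powers of \<rho> are compared for real \<rho> > 0 only. If c q is the first nonzero
  coefficient, the series divided by x^q vanishes for small x > 0 but tends to c q as x decreases to
  0.\<close>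

lemma powser_zero_on_interval:
  fixes c :: "nat \<Rightarrow> complex"
  assumes "0 < r" and sums: "\<And>x. 0 < x \<Longrightarrow> x < r \<Longrightarrow> (\<lambda>p. c p * of_real x ^ p) sums 0"
  shows "c p = 0"
proof (rule ccontr)
  assume nz: "c p \<noteq> 0"
  define q where "q = (LEAST p. c p \<noteq> 0)"
  have q: "c q \<noteq> 0" using nz unfolding q_def by (rule LeastI)
  have q0: "c i = 0" if "i < q" for i using that not_less_Least unfolding q_def by blast
  define f where "f z = (\<Sum>p. c (p + q) * z ^ p)" for z
  \<comment> \<open>Convergence at the single real point r / 2 gives convergence in the complex disc
    of that radius.\<close>
  have "summable (\<lambda>p. c p * of_real (r / 2) ^ p)" using sums[of "r / 2"] assms(1) by (simp add: sums_iff)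
  then have S: "summable (\<lambda>p. c p * z ^ p)" if "norm z < r / 2" for z
    using powser_inside[of c "of_real (r / 2)" z] that assms(1) by auto
  have S': "summable (\<lambda>p. c (p + q) * z ^ p)" if "norm z < r / 2" for z
  proof (cases "z = 0")
    case False
    have "summable (\<lambda>p. c (p + q) * z ^ (p + q))" using S[OF that] by (rule summable_ignore_initial_segment)
    then have "summable (\<lambda>p. c (p + q) * z ^ (p + q) / z ^ q)" by (rule summable_divide)
    then show ?thesis using False by (simp add: power_add)
  qed (simp add: powser_zero)
  have "(f \<longlongrightarrow> c (0 + q)) (at 0)"
    by (rule powser_limit_0[where s = "r / 2"]) (use assms(1) S' in \<open>auto simp: f_def intro: summable_sums\<close>)
  moreover have "filterlim (\<lambda>x. complex_of_real x) (at 0) (at_right 0)"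
    unfolding filterlim_at
    by (auto intro!: tendsto_eq_intros simp: eventually_at_filter)
  ultimately have lim: "((\<lambda>x. f (of_real x)) \<longlongrightarrow> c q) (at_right 0)"
    by (auto dest: filterlim_compose)
  have "f (of_real x) = 0" if x: "0 < x" "x < r / 2" for x
  proof -
    have "(\<lambda>p. c p * of_real x ^ p) sums 0" using sums x by simp
    then have "(\<lambda>p. c (p + q) * of_real x ^ (p + q)) sums 0"
      using sums_iff_shift[of "\<lambda>p. c p * of_real x ^ p" q 0] q0 by simp
    then have "(\<lambda>p. c (p + q) * of_real x ^ (p + q) / of_real x ^ q) sums (0 / of_real x ^ q)"
      by (rule sums_divide)
    then show ?thesis using x by (simp add: f_def power_add sums_iff)
  qed
  then have "\<forall>\<^sub>F x in at_right 0. f (of_real x) = 0"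
    using assms(1) by (intro eventually_at_rightI[of 0 "r / 2"]) auto
  then have "((\<lambda>x::real. 0) \<longlongrightarrow> c q) (at_right 0)"
    by (rule Lim_transform_eventually[OF lim])
  then show False using q by (simp add: tendsto_const_iff)
qed

section \<open>The mode equations as Jacobi equations\<close>

lemma has_vector_derivative_inverse_power:
  fixes \<tau> :: real
  assumes "-1 < \<tau>"
  shows "((\<lambda>t. complex_of_real (1 / (1 + t) ^ q)) has_vector_derivative
           of_real (- real q / (1 + \<tau>) ^ (q + 1))) (at \<tau> within S)"
proof -
  have "((\<lambda>t. 1 / (1 + t) ^ q) has_real_derivative - real q / (1 + \<tau>) ^ (q + 1)) (at \<tau> within S)"
  proof -
    define y where "y = 1 + \<tau>"
    have y: "y \<noteq> 0" using assms by (simp add: y_def)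
    have "((\<lambda>t. (1 + t) ^ q) has_real_derivative real q * y ^ (q - 1)) (at \<tau> within S)"
      by (auto intro!: derivative_eq_intros simp: y_def)
    from DERIV_inverse'[OF this] y
    have "((\<lambda>t. inverse ((1 + t) ^ q)) has_real_derivative
        - (inverse (y ^ q) * (real q * y ^ (q - 1)) * inverse (y ^ q))) (at \<tau> within S)"
      by (simp add: y_def)
    moreover have "- (inverse (y ^ q) * (real q * y ^ (q - 1)) * inverse (y ^ q)) = - real q / y ^ (q + 1)"
      using y by (cases q) (auto simp: field_simps)
    ultimately show ?thesis by (simp add: y_def inverse_eq_divide)
  qed
  then show ?thesis by (rule has_vector_derivative_of_real)
qed

text \<open>One differentiation adds -2 \<tau> to the first-order coefficient and lowers the last
  one by 6 + 2k, which is exactly (l-2-k)(l+3+k) - (l-3-k)(l+4+k). The left side is constantly zero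
  on the interval, so its one-sided derivative vanishes at \<tau> = 1 too.\<close>

lemma jacobi_ode_iterated:
  fixes D :: "nat \<Rightarrow> real \<Rightarrow> complex"
  assumes t0: "t0 < 1"
    and der: "\<And>k \<tau>. \<tau> \<in> {t0..1} \<Longrightarrow> (D k has_vector_derivative D (Suc k) \<tau>) (at \<tau> within {t0..1})"
    and ode: "\<And>\<tau>. \<tau> \<in> {t0..1} \<Longrightarrow> of_real (1 - \<tau>\<^sup>2) * D 2 \<tau> + of_real (2 * p - 6 * \<tau>) * D 1 \<tau>
                + of_real ((l - 2) * (l + 3)) * D 0 \<tau> = 0"
    and "\<tau> \<in> {t0..1}"
  shows "of_real (1 - \<tau>\<^sup>2) * D (k + 2) \<tau> + of_real (2 * p - (6 + 2 * real k) * \<tau>) * D (k + 1) \<tau>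
           + of_real ((l - 2 - real k) * (l + 3 + real k)) * D k \<tau> = 0"
  using assms(4)
proof (induction k arbitrary: \<tau>)
  case 0
  then show ?case using ode[of \<tau>] by (simp add: numeral_2_eq_2)
next
  case (Suc k)
  let ?L = "\<lambda>\<tau>. of_real (1 - \<tau>\<^sup>2) * D (k + 2) \<tau> + of_real (2 * p - (6 + 2 * real k) * \<tau>) * D (k + 1) \<tau>
           + of_real ((l - 2 - real k) * (l + 3 + real k)) * D k \<tau>"
  let ?d = "of_real (1 - \<tau>\<^sup>2) * D (Suc (k + 2)) \<tau> + of_real (- 2 * \<tau>) * D (k + 2) \<tau>
     + (of_real (2 * p - (6 + 2 * real k) * \<tau>) * D (Suc (k + 1)) \<tau> + of_real (- (6 + 2 * real k)) * D (k + 1) \<tau>)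
     + of_real ((l - 2 - real k) * (l + 3 + real k)) * D (Suc k) \<tau>"
  have 1: "((\<lambda>x. complex_of_real (1 - x\<^sup>2)) has_vector_derivative of_real (- 2 * \<tau>)) (at \<tau> within {t0..1})"
    by (rule has_vector_derivative_of_real) (auto intro!: derivative_eq_intros)
  have 2: "((\<lambda>x. complex_of_real (2 * p - (6 + 2 * real k) * x)) has_vector_derivative
      of_real (- (6 + 2 * real k))) (at \<tau> within {t0..1})"
    by (rule has_vector_derivative_of_real) (auto intro!: derivative_eq_intros)
  have "(?L has_vector_derivative ?d) (at \<tau> within {t0..1})"
    by (intro has_vector_derivative_add has_vector_derivative_mult 1 2 der Suc.prems
        has_vector_derivative_mult_right)
  moreover have "((\<lambda>_. 0) has_vector_derivative 0) (at \<tau> within {t0..1})" by simp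
  then have "(?L has_vector_derivative 0) (at \<tau> within {t0..1})"
    by (rule has_vector_derivative_cong_on[OF _ Suc.prems]) (rule Suc.IH)
  ultimately have "?d = 0" using has_vector_derivative_unique_Icc t0 Suc.prems by blast
  then show ?case by (simp add: algebra_simps)
qed

lemma jacobi_ode_deriv_eq_0:
  fixes D :: "nat \<Rightarrow> real \<Rightarrow> complex"
  assumes "t0 < 1"
    and "\<And>k \<tau>. \<tau> \<in> {t0..1} \<Longrightarrow> (D k has_vector_derivative D (Suc k) \<tau>) (at \<tau> within {t0..1})"
    and "\<And>\<tau>. \<tau> \<in> {t0..1} \<Longrightarrow> of_real (1 - \<tau>\<^sup>2) * D 2 \<tau> + of_real (2 * real p - 6 * \<tau>) * D 1 \<tau>
                + of_real ((real l - 2) * (real l + 3)) * D 0 \<tau> = 0"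
    and "2 \<le> l" "p \<noteq> l + 1"
  shows "D (l - 1) 1 = 0"
proof -
  \<comment> \<open>For k = l - 2 the factor l - 2 - k is zero, and at \<tau> = 1 so is 1 -
    \<tau>^2; the surviving coefficient is 2 (p - l - 1).\<close>
  have "of_real (2 * real p - (6 + 2 * real (l - 2))) * D (l - 1) 1 = 0"
    using jacobi_ode_iterated[OF assms(1,2,3), of 1 "l - 2"] assms(1,4)
    by (simp add: of_nat_diff eval_nat_numeral Suc_diff_Suc)
  moreover have "2 * real p - (6 + 2 * real (l - 2)) \<noteq> 0"
    using assms(4,5) by (simp add: of_nat_diff)
  ultimately show ?thesis by (simp only: mult_eq_0_iff of_real_eq_0_iff) simp
qed

text \<open>Dividing by \<open>(1 + \<tau>)\<^sup>p\<^sup>+\<^sup>2\<close> removes one of the exponents at \<open>\<tau> = -1\<close>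
  and turns the equation for \<open>a\<^sub>4\<close> into the Jacobi equation of degree \<open>l - 2\<close>.\<close>

lemma mode_ode_to_jacobi_ode:
  fixes D A :: "nat \<Rightarrow> real \<Rightarrow> complex"
  assumes t0: "0 \<le> t0" "t0 < 1"
    and derA: "\<And>k \<tau>. \<tau> \<in> {t0..1} \<Longrightarrow> (A k has_vector_derivative A (Suc k) \<tau>) (at \<tau> within {t0..1})"
    and derD: "\<And>k \<tau>. \<tau> \<in> {t0..1} \<Longrightarrow> (D k has_vector_derivative D (Suc k) \<tau>) (at \<tau> within {t0..1})"
    and odeA: "\<And>\<tau>. \<tau> \<in> {t0..1} \<Longrightarrow> of_real (1 - \<tau>\<^sup>2) * A 2 \<tau> + of_real (2 * (real p - 1) * \<tau> - 4) * A 1 \<tau>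
                + of_real ((real l + real p) * (real l - real p + 1)) * A 0 \<tau> = 0"
    and D0: "\<And>\<tau>. \<tau> \<in> {t0..1} \<Longrightarrow> D 0 \<tau> = A 0 \<tau> * of_real (1 / (1 + \<tau>) ^ (p + 2))"
    and tau: "\<tau> \<in> {t0..1}"
  shows "of_real (1 - \<tau>\<^sup>2) * D 2 \<tau> + of_real (2 * real p - 6 * \<tau>) * D 1 \<tau>
                + of_real ((real l - 2) * (real l + 3)) * D 0 \<tau> = 0"
proof -
  define w where "w q \<tau> = complex_of_real (1 / (1 + \<tau>) ^ q)" for q \<tau>
  have dw: "(w q has_vector_derivative of_real (- real q) * w (Suc q) \<tau>) (at \<tau> within {t0..1})"
    if "\<tau> \<in> {t0..1}" for q \<tau>
    using has_vector_derivative_inverse_power[of \<tau> q] that t0 by (simp add: w_def[abs_def])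
  have D1: "D 1 \<tau> = A 0 \<tau> * (of_real (- real (p + 2)) * w (Suc (p + 2)) \<tau>) + A 1 \<tau> * w (p + 2) \<tau>"
    if s: "\<tau> \<in> {t0..1}" for \<tau>
  proof (rule has_vector_derivative_unique_Icc[OF t0(2) s])
    show "(D 0 has_vector_derivative D 1 \<tau>) (at \<tau> within {t0..1})" using derD[OF s, of 0] by simp
    have "((\<lambda>\<tau>. A 0 \<tau> * w (p + 2) \<tau>) has_vector_derivative
      (A 0 \<tau> * (of_real (- real (p + 2)) * w (Suc (p + 2)) \<tau>) + A (Suc 0) \<tau> * w (p + 2) \<tau>)) (at \<tau> within {t0..1})"
      by (intro has_vector_derivative_mult dw derA s)
    then have "((\<lambda>\<tau>. A 0 \<tau> * w (p + 2) \<tau>) has_vector_derivative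
      (A 0 \<tau> * (of_real (- real (p + 2)) * w (Suc (p + 2)) \<tau>) + A 1 \<tau> * w (p + 2) \<tau>)) (at \<tau> within {t0..1})"
      by simp
    then show "(D 0 has_vector_derivative
      (A 0 \<tau> * (of_real (- real (p + 2)) * w (Suc (p + 2)) \<tau>) + A 1 \<tau> * w (p + 2) \<tau>)) (at \<tau> within {t0..1})"
      by (rule has_vector_derivative_cong_on[OF _ s]) (simp add: D0 w_def)
  qed
  let ?P = "complex_of_real (- real (p + 2))" and ?P' = "complex_of_real (- real (Suc (p + 2)))"
  have D2: "D 2 \<tau> = (A 0 \<tau> * (?P * (?P' * w (Suc (Suc (p + 2))) \<tau>)) + A (Suc 0) \<tau> * (?P * w (Suc (p + 2)) \<tau>))
      + (A 1 \<tau> * (?P * w (Suc (p + 2)) \<tau>) + A (Suc 1) \<tau> * w (p + 2) \<tau>)"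
  proof (rule has_vector_derivative_unique_Icc[OF t0(2) tau])
    show "(D 1 has_vector_derivative D 2 \<tau>) (at \<tau> within {t0..1})"
      using derD[OF tau, of 1] by (simp add: numeral_2_eq_2)
    have "((\<lambda>\<tau>. A 0 \<tau> * (?P * w (Suc (p + 2)) \<tau>) + A 1 \<tau> * w (p + 2) \<tau>) has_vector_derivative
      (A 0 \<tau> * (?P * (?P' * w (Suc (Suc (p + 2))) \<tau>)) + A (Suc 0) \<tau> * (?P * w (Suc (p + 2)) \<tau>))
      + (A 1 \<tau> * (?P * w (Suc (p + 2)) \<tau>) + A (Suc 1) \<tau> * w (p + 2) \<tau>)) (at \<tau> within {t0..1})"
      by (intro has_vector_derivative_add has_vector_derivative_mult dw derA tau
          has_vector_derivative_mult_right)
    then show "(D 1 has_vector_derivative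
      (A 0 \<tau> * (?P * (?P' * w (Suc (Suc (p + 2))) \<tau>)) + A (Suc 0) \<tau> * (?P * w (Suc (p + 2)) \<tau>))
      + (A 1 \<tau> * (?P * w (Suc (p + 2)) \<tau>) + A (Suc 1) \<tau> * w (p + 2) \<tau>)) (at \<tau> within {t0..1})"
      by (rule has_vector_derivative_cong_on[OF _ tau]) (rule D1)
  qed
  \<comment> \<open>All powers of 1 / (1 + \<tau>) become multiples of the most singular one,
    \<open>W\<close> = (1 + \<tau>)^-(p+4). What remains is a polynomial identity in y: the claim is
    y^2 W times the equation \<open>O\<close>.\<close>
  define W where "W = w (Suc (Suc (p + 2))) \<tau>"
  define y where "y = 1 + complex_of_real \<tau>"
  have y: "y \<noteq> 0" "complex_of_real \<tau> = y - 1"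
    using tau t0(1) by (auto simp: y_def complex_eq_iff)
  have nz: "1 + \<tau> \<noteq> 0" using tau t0(1) by auto
  have yr: "y = of_real (1 + \<tau>)" by (simp add: y_def)
  have shift: "w q \<tau> = y * w (Suc q) \<tau>" for q
    unfolding w_def yr of_real_mult[symmetric] using nz by (intro arg_cong[of _ _ of_real]) simp
  have w1: "w (Suc (p + 2)) \<tau> = y * W" "w (p + 2) \<tau> = y\<^sup>2 * W"
    unfolding W_def by (simp_all only: shift[of "p + 2"] shift[of "Suc (p + 2)"] power2_eq_square mult.assoc)
  define q where "q = complex_of_nat p"
  define m where "m = complex_of_nat l"
  define B0 B1 B2 where "B0 = A 0 \<tau>" and "B1 = A 1 \<tau>" and "B2 = A 2 \<tau>"
  have d0: "D 0 \<tau> = B0 * (y\<^sup>2 * W)"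
    using D0[OF tau] unfolding w_def[symmetric] w1 B0_def .
  have d1: "D 1 \<tau> = B0 * (- (q + 2) * (y * W)) + B1 * (y\<^sup>2 * W)"
    unfolding D1[OF tau] w1 B0_def B1_def by (simp add: q_def)
  have d2: "D 2 \<tau> = B0 * ((q + 2) * (q + 3) * W) + 2 * B1 * (- (q + 2) * (y * W)) + B2 * (y\<^sup>2 * W)"
    unfolding D2 w1 W_def[symmetric] B0_def B1_def B2_def
    by (simp add: q_def numeral_2_eq_2[symmetric] algebra_simps)
  have r: "complex_of_real (1 - \<tau>\<^sup>2) = 1 - (y - 1)\<^sup>2"
    "complex_of_real (2 * real p - 6 * \<tau>) = 2 * q - 6 * (y - 1)"
    "complex_of_real ((real l - 2) * (real l + 3)) = (m - 2) * (m + 3)"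
    "complex_of_real (2 * (real p - 1) * \<tau> - 4) = 2 * (q - 1) * (y - 1) - 4"
    "complex_of_real ((real l + real p) * (real l - real p + 1)) = (m + q) * (m - q + 1)"
    by (simp_all add: y(2) q_def m_def)
  have O: "(1 - (y - 1)\<^sup>2) * B2 + (2 * (q - 1) * (y - 1) - 4) * B1 + (m + q) * (m - q + 1) * B0 = 0"
    using odeA[OF tau] unfolding r B0_def B1_def B2_def .
  show ?thesis unfolding r d0 d1 d2 using O by algebra
qed

text \<open>What matters is the degree bound: l - 1 derivatives annihilate the polynomial of degree
  at most l - 2 that comes from \<open>Q1\<close>. For special \<alpha>, \<beta> the degree drops,
  hence an inequality.\<close>

lemma jacobi_P_reflected_poly:
  "\<exists>P. degree P \<le> k \<and> (\<forall>x. jacobi_P k \<alpha> \<beta> (- x) = poly P x)"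
proof -
  define c where "c s = ((of_nat k + \<alpha>) gchoose (k - s)) * ((of_nat k + \<beta>) gchoose s)" for s
  define P where "P = (\<Sum>s\<le>k. smult (c s) ([:-1/2, -1/2:] ^ s * [:1/2, -1/2:] ^ (k - s)))"
  have "degree P \<le> k" unfolding P_def
  proof (rule degree_sum_le)
    fix s assume s: "s \<in> {..k}"
    have "degree ([:-1/2, -1/2:] ^ s * [:1/2, -1/2:] ^ (k - s) :: real poly)
        \<le> degree ([:-1/2, -1/2:] :: real poly) * s + degree ([:1/2, -1/2:] :: real poly) * (k - s)"
      by (intro order.trans[OF degree_mult_le] add_mono degree_power_le)
    also have "\<dots> \<le> k" using s by simp
    finally show "degree (smult (c s) ([:-1/2, -1/2:] ^ s * [:1/2, -1/2:] ^ (k - s))) \<le> k"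
      using degree_smult_le order.trans by blast
  qed simp
  moreover have "jacobi_P k \<alpha> \<beta> (- x) = poly P x" for x
    by (simp add: jacobi_P_def P_def poly_sum c_def diff_divide_distrib add_divide_distrib mult.assoc
        minus_diff_commute)
  ultimately show ?thesis by blast
qed

lemma deriv_at_scri_eq:
  fixes D :: "nat \<Rightarrow> real \<Rightarrow> complex"
  assumes t0: "0 \<le> t0" "t0 < 1"
    and der: "\<And>k \<tau>. \<tau> \<in> {t0..1} \<Longrightarrow> (D k has_vector_derivative D (Suc k) \<tau>) (at \<tau> within {t0..1})"
    and D0: "\<And>\<tau>. \<tau> \<in> {t0..1} \<Longrightarrow>
       D 0 \<tau> = (c + K * of_real (Q1 (l + 1) l (- \<tau>))) * of_real (1 / (1 + \<tau>) ^ (l + 3))"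
    and l: "2 \<le> l"
  shows "D (l - 1) 1 = c * of_real ((-1) ^ (l - 1) * pochhammer (real l + 3) (l - 1) / 2 ^ (2 * l + 2))"
proof -
  obtain P where P: "degree P \<le> l - 2"
    "\<And>x. jacobi_P (l - 2) (real (l + 1) + 2) (- real (l + 1) + 2) (- x) = poly P x"
    using jacobi_P_reflected_poly by blast
  \<comment> \<open>The k-th derivative in closed form. Differentiating (1 + \<tau>)^-(l+3)
    repeatedly produces the rising factorial of l + 3; the factor (1 + \<tau>)^(l+3) of the
    reflected \<open>Q1\<close> cancels and leaves \<open>P\<close>.\<close>
  define E where "E k \<tau> = c * of_real ((-1) ^ k * pochhammer (real l + 3) k * (1 / (1 + \<tau>) ^ (l + 3 + k)))
     + K / 2 ^ (l + 3) * of_real (poly ((pderiv ^^ k) P) \<tau>)" for k \<tau>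
  have dE: "(E k has_vector_derivative E (Suc k) \<tau>) (at \<tau> within {t0..1})" if s: "\<tau> \<in> {t0..1}" for k \<tau>
  proof -
    have 1: "((\<lambda>\<tau>. c * of_real ((-1) ^ k * pochhammer (real l + 3) k * (1 / (1 + \<tau>) ^ (l + 3 + k))))
      has_vector_derivative c * (of_real ((-1) ^ k * pochhammer (real l + 3) k) *
         of_real (- real (l + 3 + k) / (1 + \<tau>) ^ (l + 3 + k + 1)))) (at \<tau> within {t0..1})"
      unfolding of_real_mult[of _ "1 / _"]
      by (intro has_vector_derivative_mult_right has_vector_derivative_inverse_power) (use s t0 in auto)
    have 2: "((\<lambda>\<tau>. K / 2 ^ (l + 3) * of_real (poly ((pderiv ^^ k) P) \<tau>)) has_vector_derivative
       K / 2 ^ (l + 3) * of_real (poly (pderiv ((pderiv ^^ k) P)) \<tau>)) (at \<tau> within {t0..1})"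
      by (intro has_vector_derivative_mult_right has_vector_derivative_of_real poly_DERIV
          has_field_derivative_at_within)
    show ?thesis
      using has_vector_derivative_add[OF 1 2]
      by (simp add: E_def [abs_def] pochhammer_Suc algebra_simps)
  qed
  \<comment> \<open>Only \<open>D 0\<close> is given; agreement passes to higher k because one-sided
    derivatives are unique.\<close>
  have "D k \<tau> = E k \<tau>" if "\<tau> \<in> {t0..1}" for k \<tau>
    using that
  proof (induction k arbitrary: \<tau>)
    case 0
    then have nz: "1 + \<tau> \<noteq> 0" using t0 by auto
    have "Q1 (l + 1) l (- \<tau>) = (1 + \<tau>) ^ (l + 3) * (poly P \<tau> / 2 ^ (l + 3))"
      unfolding Q1_def P(2) by (simp add: power_divide numeral_3_eq_3)
    then have "of_real (Q1 (l + 1) l (- \<tau>)) * complex_of_real (1 / (1 + \<tau>) ^ (l + 3))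
        = of_real (poly P \<tau> / 2 ^ (l + 3))"
      unfolding of_real_mult[symmetric] using nz by simp
    then show ?case
      unfolding D0[OF 0] E_def distrib_right mult.assoc by simp
  next
    case (Suc k)
    have "(D k has_vector_derivative E (Suc k) \<tau>) (at \<tau> within {t0..1})"
      by (rule has_vector_derivative_cong_on[OF dE[OF Suc.prems] Suc.prems]) (rule Suc.IH)
    then show ?case using has_vector_derivative_unique_Icc[OF t0(2) Suc.prems der[OF Suc.prems]] by blast
  qed
  moreover have "(pderiv ^^ (l - 1)) P = 0"
  proof -
    have "degree ((pderiv ^^ k) P) \<le> l - 2 - k" for k
      by (induction k) (use P(1) in \<open>auto simp: degree_pderiv\<close>)
    from this[of "l - 2"] have "degree ((pderiv ^^ (l - 2)) P) = 0" by simp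
    then have "pderiv ((pderiv ^^ (l - 2)) P) = 0" by (simp add: pderiv_eq_0_iff)
    moreover have "l - 1 = Suc (l - 2)" using l by simp
    ultimately show ?thesis by simp
  qed
  \<comment> \<open>At \<tau> = 1 the denominator (1 + \<tau>)^(l+3+k) with k = l - 1 is
    2^(2l+2).\<close>
  moreover have "l + 3 + (l - 1) = 2 * l + 2" using l by simp
  ultimately show ?thesis using t0 by (simp add: E_def)
qed

section \<open>The diagonal modes \<open>p = l + 1\<close>\<close>

text \<open>For p = l + 1 one upper index in each Jacobi sum, degree plus \<beta> in
  \<open>Q1\<close> and degree plus \<alpha> in \<open>Q3\<close>, equals -1. Its binomials are then
  signs, which combine with those of ((\<tau> - 1)/2)^s.\<close>

lemma gbinomial_minus_one: "(-1 :: real) gchoose k = (-1) ^ k"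
  by (simp add: gbinomial_negated_upper[of "-1"] binomial_gbinomial[symmetric])

text \<open>Here k = l - 2, so 2k + 5 = 2l + 1. The factor ((1 - \<tau>)/2)^(p+2) completes every
  term of the Jacobi sum to total degree 2l + 1, which gives one end of a binomial
  expansion.\<close>

lemma Q1_diagonal:
  "Q1 (k + 3) (k + 2) \<tau> =
     (\<Sum>j\<le>k. real ((2 * k + 5) choose j) * ((1 + \<tau>) / 2) ^ j * ((1 - \<tau>) / 2) ^ (2 * k + 5 - j))"
proof -
  let ?u = "(1 - \<tau>) / 2" and ?v = "(1 + \<tau>) / 2"
  have "jacobi_P k (real (k + 3) + 2) (- real (k + 3) + 2) \<tau>
      = (\<Sum>s\<le>k. real ((2 * k + 5) choose (k - s)) * ?u ^ s * ?v ^ (k - s))"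
    unfolding jacobi_P_def
  proof (rule sum.cong[OF refl])
    fix s
    have "(\<tau> - 1) / 2 = (-1) * ?u" by (simp add: field_simps)
    then have e: "((\<tau> - 1) / 2) ^ s = (-1) ^ s * ?u ^ s" by (simp only: power_mult_distrib)
    have a: "real k + (real (k + 3) + 2) = real (2 * k + 5)" "real k + (- real (k + 3) + 2) = -1"
      by simp_all
    show "(real k + (real (k + 3) + 2) gchoose (k - s)) * (real k + (- real (k + 3) + 2) gchoose s) *
         ((\<tau> - 1) / 2) ^ s * ((\<tau> + 1) / 2) ^ (k - s)
      = real ((2 * k + 5) choose (k - s)) * ?u ^ s * ?v ^ (k - s)"
      unfolding e a gbinomial_minus_one binomial_gbinomial by (simp add: add.commute)
  qed
  also have "\<dots> = (\<Sum>j\<le>k. real ((2 * k + 5) choose j) * ?u ^ (k - j) * ?v ^ j)"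
    by (rule sum.reindex_bij_witness[of _ "\<lambda>j. k - j" "\<lambda>j. k - j"]) auto
  finally have J: "jacobi_P k (real (k + 3) + 2) (- real (k + 3) + 2) \<tau>
      = (\<Sum>j\<le>k. real ((2 * k + 5) choose j) * ?u ^ (k - j) * ?v ^ j)" .
  have e: "k + 3 + 2 = k + 5" "k + 2 - 2 = k" by simp_all
  have "Q1 (k + 3) (k + 2) \<tau>
      = (\<Sum>j\<le>k. ?u ^ (k + 5) * (real ((2 * k + 5) choose j) * ?u ^ (k - j) * ?v ^ j))"
    unfolding Q1_def e J by (simp only: sum_distrib_left)
  also have "\<dots> = (\<Sum>j\<le>k. real ((2 * k + 5) choose j) * ?v ^ j * ?u ^ (2 * k + 5 - j))"
  proof (rule sum.cong[OF refl])
    fix j assume "j \<in> {..k}"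
    then have "2 * k + 5 - j = k + 5 + (k - j)" by auto
    then show "?u ^ (k + 5) * (real ((2 * k + 5) choose j) * ?u ^ (k - j) * ?v ^ j)
        = real ((2 * k + 5) choose j) * ?v ^ j * ?u ^ (2 * k + 5 - j)"
      by (simp only: power_add mult_ac)
  qed
  finally show ?thesis .
qed

text \<open>The sign (-1)^k stands for (-1)^l, as l = k + 2. The result is a partial sum of the same
  binomial expansion, now ordered by powers of (1 - \<tau>)/2.\<close>

lemma Q3_diagonal:
  "(-1) ^ k * Q3 (k + 3) (k + 2) \<tau> =
     (\<Sum>s\<le>k + 4. real ((2 * k + 5) choose s) * ((1 - \<tau>) / 2) ^ s * ((1 + \<tau>) / 2) ^ (2 * k + 5 - s))"
proof -
  let ?u = "(1 - \<tau>) / 2" and ?v = "(1 + \<tau>) / 2"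
  have "jacobi_P (k + 4) (- real (k + 3) - 2) (real (k + 3) - 2) \<tau>
      = (\<Sum>s\<le>k + 4. (-1) ^ k * (real ((2 * k + 5) choose s) * ?u ^ s * ?v ^ (k + 4 - s)))"
    unfolding jacobi_P_def
  proof (rule sum.cong[OF refl])
    fix s assume s: "s \<in> {..k + 4}"
    have "(\<tau> - 1) / 2 = (-1) * ?u" by (simp add: field_simps)
    then have e: "((\<tau> - 1) / 2) ^ s = (-1) ^ s * ?u ^ s" by (simp only: power_mult_distrib)
    have a: "real (k + 4) + (- real (k + 3) - 2) = -1" "real (k + 4) + (real (k + 3) - 2) = real (2 * k + 5)"
      by simp_all
    have "(-1 :: real) ^ (k + 4 - s) * (-1) ^ s = (-1) ^ (k + 4)"
      using s by (simp add: power_add[symmetric])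
    then have sg: "(-1 :: real) ^ (k + 4 - s) * ((-1) ^ s * x) = (-1) ^ k * x" for x
      by (simp add: mult.assoc[symmetric] power_add)
    show "(real (k + 4) + (- real (k + 3) - 2) gchoose (k + 4 - s)) *
         (real (k + 4) + (real (k + 3) - 2) gchoose s) * ((\<tau> - 1) / 2) ^ s * ((\<tau> + 1) / 2) ^ (k + 4 - s)
      = (-1) ^ k * (real ((2 * k + 5) choose s) * ?u ^ s * ?v ^ (k + 4 - s))"
      unfolding e a gbinomial_minus_one binomial_gbinomial sg[symmetric] by (simp add: ac_simps)
  qed
  then have J: "jacobi_P (k + 4) (- real (k + 3) - 2) (real (k + 3) - 2) \<tau>
      = (-1) ^ k * (\<Sum>s\<le>k + 4. real ((2 * k + 5) choose s) * ?u ^ s * ?v ^ (k + 4 - s))"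
    by (simp only: sum_distrib_left)
  have e: "k + 3 - 2 = k + 1" "k + 2 + 2 = k + 4" by simp_all
  have "(-1) ^ k * Q3 (k + 3) (k + 2) \<tau>
      = ((-1) ^ k * (-1) ^ k) * (?v ^ (k + 1) * (\<Sum>s\<le>k + 4. real ((2 * k + 5) choose s) * ?u ^ s * ?v ^ (k + 4 - s)))"
    unfolding Q3_def e J by (simp only: mult_ac)
  also have "(-1 :: real) ^ k * (-1) ^ k = 1" by (simp add: power_mult_distrib[symmetric])
  also have "1 * (?v ^ (k + 1) * (\<Sum>s\<le>k + 4. real ((2 * k + 5) choose s) * ?u ^ s * ?v ^ (k + 4 - s)))
      = (\<Sum>s\<le>k + 4. ?v ^ (k + 1) * (real ((2 * k + 5) choose s) * ?u ^ s * ?v ^ (k + 4 - s)))"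
    by (simp only: sum_distrib_left mult_1_left)
  also have "\<dots> = (\<Sum>s\<le>k + 4. real ((2 * k + 5) choose s) * ?u ^ s * ?v ^ (2 * k + 5 - s))"
  proof (rule sum.cong[OF refl])
    fix s assume "s \<in> {..k + 4}"
    then have "2 * k + 5 - s = k + 1 + (k + 4 - s)" by auto
    then show "?v ^ (k + 1) * (real ((2 * k + 5) choose s) * ?u ^ s * ?v ^ (k + 4 - s))
        = real ((2 * k + 5) choose s) * ?u ^ s * ?v ^ (2 * k + 5 - s)"
      by (simp only: power_add mult_ac)
  qed
  finally show ?thesis .
qed

text \<open>Replacing j by 2k + 5 - j moves the terms of \<open>Q1\<close> to the indices k + 5,
  ..., 2k + 5, exactly those missing from the sum for \<open>Q3\<close>.\<close>

lemma Q1_add_Q3_diagonal: "Q1 (k + 3) (k + 2) \<tau> + (-1) ^ k * Q3 (k + 3) (k + 2) \<tau> = 1"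
proof -
  let ?u = "(1 - \<tau>) / 2" and ?v = "(1 + \<tau>) / 2"
  let ?N = "2 * k + 5"
  let ?t = "\<lambda>s. real (?N choose s) * ?u ^ s * ?v ^ (?N - s)"
  have "Q1 (k + 3) (k + 2) \<tau> = (\<Sum>s\<in>{k+5..?N}. ?t s)"
    unfolding Q1_diagonal
  proof (rule sum.reindex_bij_witness[of _ "\<lambda>j. ?N - j" "\<lambda>j. ?N - j"])
    fix j assume "j \<in> {..k}"
    then show "real (?N choose (?N - j)) * ?u ^ (?N - j) * ?v ^ (?N - (?N - j))
        = real (?N choose j) * ?v ^ j * ?u ^ (?N - j)"
      using binomial_symmetric[of j ?N] by simp
  qed auto
  moreover have "(\<Sum>s\<le>k + 4. ?t s) + (\<Sum>s\<in>{k+5..?N}. ?t s) = (\<Sum>s\<le>?N. ?t s)"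
  proof -
    have "{..?N} = {..k + 4} \<union> {k+5..?N}" by auto
    then show ?thesis by (simp add: sum.union_disjoint)
  qed
  moreover have "(\<Sum>s\<le>?N. ?t s) = (?u + ?v) ^ ?N" by (simp add: binomial_ring)
  moreover have "?u + ?v = 1" by (simp add: field_simps)
  ultimately show ?thesis unfolding Q3_diagonal by simp
qed

text \<open>This makes the matrix that defines C invertible, since its determinant is 2q - 1 with q
  this value. At \<tau> = 0 the two summands of the preceding identity are partial sums of one
  binomial row, with k + 1 and k + 5 entries, so the first is below one half.\<close>

lemma Q1_diagonal_at_0: "Q1 (k + 3) (k + 2) 0 < 1 / 2"
proof -
  let ?N = "2 * k + 5"
  have "Q1 (k + 3) (k + 2) 0 = (\<Sum>j\<le>k. real (?N choose j)) / 2 ^ ?N"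
    unfolding Q1_diagonal sum_divide_distrib
    by (rule sum.cong[OF refl]) (simp add: power_divide power_add[symmetric])
  moreover have "(-1) ^ k * Q3 (k + 3) (k + 2) 0 = (\<Sum>j\<le>k + 4. real (?N choose j)) / 2 ^ ?N"
    unfolding Q3_diagonal sum_divide_distrib
    by (rule sum.cong[OF refl]) (simp add: power_divide power_add[symmetric])
  moreover have "(\<Sum>j\<le>k. real (?N choose j)) < (\<Sum>j\<le>k + 4. real (?N choose j))"
    by (rule sum_strict_mono2[of _ _ "k + 1"]) auto
  then have "(\<Sum>j\<le>k. real (?N choose j)) / 2 ^ ?N < (\<Sum>j\<le>k + 4. real (?N choose j)) / 2 ^ ?N"
    by (simp add: divide_strict_right_mono)
  ultimately show ?thesis using Q1_add_Q3_diagonal[of k 0] by linarith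
qed

text \<open>The derivatives of consecutive terms telescope and leave one boundary term. Up to
  scaling this is the derivative of the binomial distribution function in its success probability, a
  beta density.\<close>

lemma partial_binomial_sum_deriv:
  fixes \<tau> :: real
  assumes "k < N"
  shows "((\<lambda>\<tau>. \<Sum>j\<le>k. real (N choose j) * ((1 + \<tau>) / 2) ^ j * ((1 - \<tau>) / 2) ^ (N - j)) has_real_derivative
     - (real (N - k) * real (N choose k) / 2) * ((1 + \<tau>) / 2) ^ k * ((1 - \<tau>) / 2) ^ (N - 1 - k)) (at \<tau>)"
  using assms
proof (induction k)
  case 0
  then show ?case by (auto intro!: derivative_eq_intros)
next
  case (Suc k)
  let ?u = "(1 - \<tau>) / 2" and ?v = "(1 + \<tau>) / 2"
  define M where "M = N - 2 - k"
  have N: "N = M + k + 2" using Suc.prems by (simp add: M_def)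
  have dv: "((\<lambda>\<tau>. (1 + \<tau>) / 2) has_real_derivative 1 / 2) (at \<tau>)"
    and du: "((\<lambda>\<tau>. (1 - \<tau>) / 2) has_real_derivative - 1 / 2) (at \<tau>)"
    by (auto intro!: derivative_eq_intros)
  have "((\<lambda>\<tau>. real (N choose Suc k) * (((1 + \<tau>) / 2) ^ Suc k * ((1 - \<tau>) / 2) ^ (M + 1))) has_real_derivative
      real (N choose Suc k) * (real (Suc k) * (1 / 2 * ?v ^ (Suc k - Suc 0)) * ?u ^ (M + 1)
        + real (M + 1) * (- 1 / 2 * ?u ^ (M + 1 - Suc 0)) * ?v ^ Suc k)) (at \<tau>)"
    by (rule DERIV_cmult[OF DERIV_mult[OF DERIV_power[OF dv] DERIV_power[OF du]]])
  then have "((\<lambda>\<tau>. real (N choose Suc k) * ((1 + \<tau>) / 2) ^ Suc k * ((1 - \<tau>) / 2) ^ (M + 1)) has_real_derivative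
      real (N choose Suc k) * (real (Suc k) / 2 * ?v ^ k * ?u ^ (M + 1) - real (M + 1) / 2 * ?v ^ Suc k * ?u ^ M)) (at \<tau>)"
    by (simp add: mult_ac)
  from DERIV_add[OF Suc.IH this] Suc.prems
  have "((\<lambda>\<tau>. \<Sum>j\<le>Suc k. real (N choose j) * ((1 + \<tau>) / 2) ^ j * ((1 - \<tau>) / 2) ^ (N - j)) has_real_derivative
     - (real (N - k) * real (N choose k) / 2) * ?v ^ k * ?u ^ (N - 1 - k) +
     real (N choose Suc k) * (real (Suc k) / 2 * ?v ^ k * ?u ^ (M + 1) - real (M + 1) / 2 * ?v ^ Suc k * ?u ^ M)) (at \<tau>)"
    by (simp add: N)
  \<comment> \<open>The absorption identity by which the boundary term for k cancels the first half
    of the new term's derivative.\<close>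
  moreover have "real (Suc k) * real (N choose Suc k) = real (N - k) * real (N choose k)"
    using binomial_absorb_comp[of N k] binomial_absorption[of k "N - 1"] Suc.prems
    by (metis N add_2_eq_Suc' binomial_absorption diff_Suc_1 of_nat_mult)
  then have "- (real (N - k) * real (N choose k) / 2) * ?v ^ k * ?u ^ (N - 1 - k) +
     real (N choose Suc k) * (real (Suc k) / 2 * ?v ^ k * ?u ^ (M + 1) - real (M + 1) / 2 * ?v ^ Suc k * ?u ^ M)
     = - (real (N - Suc k) * real (N choose Suc k) / 2) * ?v ^ Suc k * ?u ^ (N - 1 - Suc k)"
  proof -
    assume E: "real (Suc k) * real (N choose Suc k) = real (N - k) * real (N choose k)"
    have e: "N - 1 - k = M + 1" "N - 1 - Suc k = M" "N - Suc k = M + 1" by (simp_all add: N)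
    show ?thesis unfolding E[symmetric] e by (simp add: field_simps)
  qed
  ultimately show ?case by simp
qed

text \<open>The derivative is a multiple of the weight that solves the first-order equation for the
  derivative of a diagonal mode, so the reflected \<open>Q1\<close> is its non-constant
  solution.\<close>

lemma Q1_diagonal_reflected_deriv:
  obtains \<kappa> where "\<kappa> \<noteq> 0"
    "\<And>\<tau>. ((\<lambda>\<tau>. Q1 (k + 3) (k + 2) (- \<tau>)) has_real_derivative \<kappa> * ((1 + \<tau>) ^ (k + 4) * (1 - \<tau>) ^ k)) (at \<tau>)"
proof
  let ?N = "2 * k + 5"
  let ?\<kappa> = "real (?N - k) * real (?N choose k) / 2 / 2 ^ (2 * k + 4)"
  show "?\<kappa> \<noteq> 0" by simp
  fix \<tau>
  have "((\<lambda>\<tau>. Q1 (k + 3) (k + 2) (- \<tau>)) has_real_derivative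
    - (real (?N - k) * real (?N choose k) / 2) * ((1 + - \<tau>) / 2) ^ k * ((1 - - \<tau>) / 2) ^ (?N - 1 - k) * (-1)) (at \<tau>)"
    unfolding Q1_diagonal
    by (rule DERIV_chain2[OF partial_binomial_sum_deriv]) (auto intro!: derivative_eq_intros)
  moreover have "- (b / 2) * ((1 + - \<tau>) / 2) ^ k * ((1 - - \<tau>) / 2) ^ (?N - 1 - k) * (-1)
      = b / 2 / 2 ^ (2 * k + 4) * ((1 + \<tau>) ^ (k + 4) * (1 - \<tau>) ^ k)" for b
  proof -
    have e: "?N - 1 - k = k + 4" "2 * k + 4 = k + (k + 4)" by simp_all
    show ?thesis unfolding e power_divide power_add[of 2 k "k + 4"] by (simp add: mult_ac)
  qed
  ultimately show "((\<lambda>\<tau>. Q1 (k + 3) (k + 2) (- \<tau>)) has_real_derivative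
      ?\<kappa> * ((1 + \<tau>) ^ (k + 4) * (1 - \<tau>) ^ k)) (at \<tau>)"
    by (simp only:)
qed

lemma Q1_diagonal_endpoints: "Q1 (k + 3) (k + 2) 1 = 0" "Q1 (k + 3) (k + 2) (-1) = 1"
proof -
  show "Q1 (k + 3) (k + 2) 1 = 0" by (simp add: Q1_def)
  show "Q1 (k + 3) (k + 2) (-1) = 1"
    unfolding Q1_diagonal by (simp add: sum.atMost_shift)
qed


text \<open>For p = l + 1 the factor l - p + 1 removes the zeroth-order term of the mode equation,
  so constants are solutions and a first-order equation for \<open>A 1\<close> is left, with
  integrating factor 1 / w. It is singular at both endpoints: it is integrated in the open interval
  and the result is carried to [-1, 1] by continuity.\<close>

lemma diagonal_mode_solution:
  fixes A :: "nat \<Rightarrow> real \<Rightarrow> complex"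
  assumes der: "\<And>j \<tau>. j < 2 \<Longrightarrow> \<tau> \<in> {-1..1} \<Longrightarrow> (A j has_vector_derivative A (Suc j) \<tau>) (at \<tau> within {-1..1})"
    and ode: "\<And>\<tau>. \<tau> \<in> {-1..1} \<Longrightarrow> of_real (1 - \<tau>\<^sup>2) * A 2 \<tau> = of_real (4 - 2 * (real k + 2) * \<tau>) * A 1 \<tau>"
  obtains K where "\<And>\<tau>. \<tau> \<in> {-1..1} \<Longrightarrow> A 0 \<tau> = A 0 (-1) + K * of_real (Q1 (k + 3) (k + 2) (- \<tau>))"
proof -
  define w where "w \<tau> = (1 + \<tau>) ^ (k + 4) * (1 - \<tau>) ^ k" for \<tau> :: real
  define g where "g \<tau> = A 1 \<tau> * of_real (1 / w \<tau>)" for \<tau>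
  have open_der: "(A j has_vector_derivative A (Suc j) \<tau>) (at \<tau>)" if "j < 2" "\<tau> \<in> {-1<..<1}" for j \<tau>
  proof -
    have "at \<tau> within {-1..1} = at \<tau>" using that(2) by (intro at_within_Icc_at) auto
    then show ?thesis using der[OF that(1), of \<tau>] that(2) by simp
  qed
  have dg: "(g has_vector_derivative 0) (at \<tau> within {-1<..<1})" if s: "\<tau> \<in> {-1<..<1}" for \<tau>
  proof -
    have nz: "1 + \<tau> \<noteq> 0" "1 - \<tau> \<noteq> 0" using s by auto
    then have w0: "w \<tau> \<noteq> 0" by (simp add: w_def)
    \<comment> \<open>From w' / w = (k + 4) / (1 + \<tau>) - k / (1 - \<tau>) over a common
      denominator; the numerator is the coefficient of \<open>A 1\<close> in the equation.\<close>
    let ?w' = "((4 - 2 * (real k + 2) * \<tau>) * w \<tau> / ((1 + \<tau>) * (1 - \<tau>)))"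
    have "(w has_real_derivative (real (k + 4) * (1 + \<tau>) ^ (k + 3) * (1 - \<tau>) ^ k
        - real k * (1 + \<tau>) ^ (k + 4) * (1 - \<tau>) ^ (k - 1))) (at \<tau>)"
      unfolding w_def[abs_def] by (auto intro!: derivative_eq_intros simp: algebra_simps numeral_3_eq_3)
    moreover have "real (k + 4) * (1 + \<tau>) ^ (k + 3) * (1 - \<tau>) ^ k
        - real k * (1 + \<tau>) ^ (k + 4) * (1 - \<tau>) ^ (k - 1) = ?w'"
    \<comment> \<open>For k = 0 the exponent k - 1 is truncated to 0, while the coefficient k in
      front of it vanishes.\<close>
    proof (cases k)
      case 0
      define x where "x = 1 + \<tau>"
      have "x \<noteq> 0" "2 - x \<noteq> 0" "\<tau> = x - 1" using nz by (auto simp: x_def)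
      then show ?thesis by (simp add: w_def 0 field_simps eval_nat_numeral)
    next
      case (Suc i)
      define x y where "x = 1 + \<tau>" and "y = 1 - \<tau>"
      have "\<tau> = x - 1" "y = 2 - x" by (simp_all add: x_def y_def)
      have "real (k + 4) * x ^ (k + 3) * y ^ k - real k * x ^ (k + 4) * y ^ (k - 1)
        = (x ^ (k + 3) * y ^ i) * (real (k + 4) * y - real k * x)"
        unfolding Suc by (simp add: algebra_simps eval_nat_numeral)
      also have "real (k + 4) * y - real k * x = 4 - 2 * (real k + 2) * \<tau>"
        by (simp add: x_def y_def algebra_simps)
      also have "x ^ (k + 3) * y ^ i = w \<tau> / (x * y)"
      proof -
        have "w \<tau> = (x * y) * (x ^ (k + 3) * y ^ i)"
          unfolding w_def x_def[symmetric] y_def[symmetric] Suc by (simp add: eval_nat_numeral mult_ac)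
        then show ?thesis using nz by (simp add: x_def y_def)
      qed
      finally show ?thesis by (simp add: x_def y_def)
    qed
    ultimately have dw: "(w has_real_derivative ?w') (at \<tau>)" by simp
    define v where "v = ?w'"
    from DERIV_inverse'[OF dw[folded v_def] w0]
    have "((\<lambda>x. 1 / w x) has_real_derivative - (v / (w \<tau>)\<^sup>2)) (at \<tau>)"
      by (simp add: inverse_eq_divide power2_eq_square)
    from has_vector_derivative_mult[OF open_der[OF _ s, of 1] has_vector_derivative_of_real[OF this]]
    have "(g has_vector_derivative A 1 \<tau> * of_real (- (v / (w \<tau>)\<^sup>2)) + A 2 \<tau> * of_real (1 / w \<tau>)) (at \<tau>)"
      by (simp add: g_def[abs_def] numeral_2_eq_2)
    moreover have "A 1 \<tau> * of_real (- (v / (w \<tau>)\<^sup>2)) + A 2 \<tau> * of_real (1 / w \<tau>) = 0"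
    proof -
      have "1 - \<tau>\<^sup>2 = (1 + \<tau>) * (1 - \<tau>)" by (simp add: power2_eq_square algebra_simps)
      then have nz2: "1 - \<tau>\<^sup>2 \<noteq> 0" "(1 + \<tau>) * (1 - \<tau>) = 1 - \<tau>\<^sup>2" using nz by auto
      have "A 2 \<tau> = of_real (4 - 2 * (real k + 2) * \<tau>) * A 1 \<tau> / of_real (1 - \<tau>\<^sup>2)"
        using ode[of \<tau>] s nz2(1) by (simp add: nonzero_eq_divide_eq mult.commute del: of_real_diff)
      moreover have "- (v / (w \<tau>)\<^sup>2) = - ((4 - 2 * (real k + 2) * \<tau>) / (1 - \<tau>\<^sup>2) * (1 / w \<tau>))"
        using w0 unfolding v_def nz2(2) by (simp add: power2_eq_square)
      ultimately show ?thesis by (simp only: of_real_minus of_real_mult of_real_divide) simp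
    qed
    ultimately have "(g has_vector_derivative 0) (at \<tau>)" by simp
    then show ?thesis by (rule has_vector_derivative_at_within)
  qed
  have "\<exists>c. \<forall>\<tau>\<in>{-1<..<1}. g \<tau> = c"
    using has_vector_derivative_zero_constant[of "{-1<..<1}" g] dg by (metis convex_real_interval(8))
  then obtain c where c: "\<And>\<tau>. \<tau> \<in> {-1<..<1} \<Longrightarrow> g \<tau> = c" by blast
  have A1: "A 1 \<tau> = c * of_real (w \<tau>)" if "\<tau> \<in> {-1<..<1}" for \<tau>
  proof -
    have "w \<tau> \<noteq> 0" using that by (simp add: w_def)
    then show ?thesis using c[OF that] by (simp add: g_def field_simps)
  qed
  obtain \<kappa> where \<kappa>: "\<kappa> \<noteq> 0"
    "\<And>\<tau>. ((\<lambda>\<tau>. Q1 (k + 3) (k + 2) (- \<tau>)) has_real_derivative \<kappa> * w \<tau>) (at \<tau>)"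
    using Q1_diagonal_reflected_deriv unfolding w_def by blast
  define q where "q \<tau> = Q1 (k + 3) (k + 2) (- \<tau>)" for \<tau>
  define h where "h \<tau> = A 0 \<tau> - c / of_real \<kappa> * of_real (q \<tau>)" for \<tau>
  have dq: "((\<lambda>\<tau>. complex_of_real (q \<tau>)) has_vector_derivative of_real (\<kappa> * w \<tau>)) (at \<tau> within S)" for \<tau> S
    unfolding q_def by (rule has_vector_derivative_of_real[OF has_field_derivative_at_within[OF \<kappa>(2)]])
  have dh: "(h has_vector_derivative A 1 \<tau> - c / of_real \<kappa> * of_real (\<kappa> * w \<tau>)) (at \<tau> within {-1..1})"
    if "\<tau> \<in> {-1..1}" for \<tau>
    unfolding h_def[abs_def]
    using has_vector_derivative_diff[OF der[of 0 \<tau>] has_vector_derivative_mult_right[OF dq, of "c / of_real \<kappa>"]] that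
    by (simp del: times_divide_eq_left times_divide_eq_right)
  have h: "h \<tau> = h (-1)" if "\<tau> \<in> {-1..1}" for \<tau>
  \<comment> \<open>The formula for \<open>A 1\<close> is known only in the open interval. The
    criterion admits finitely many exceptional points, here -1 and 1, at which h is merely
    continuous.\<close>
  proof (rule has_derivative_zero_unique_strong_interval[of "{-1, 1}"])
    show "continuous_on {-1..1} h"
      by (rule continuous_on_vector_derivative[OF dh])
    show "(h has_derivative (\<lambda>_. 0)) (at x within {-1..1})" if "x \<in> {-1..1} - {-1, 1}" for x
      using dh[of x] A1[of x] that \<kappa>(1) by (auto simp: has_vector_derivative_def)
  qed (use that in auto)
  \<comment> \<open>As the reflected \<open>Q1\<close> vanishes at -1, the additive constant is the
    value of \<open>A 0\<close> there.\<close>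
  have q0: "q (-1) = 0" using Q1_diagonal_endpoints(1)[of k] by (simp add: q_def)
  have "A 0 \<tau> = A 0 (-1) + c / of_real \<kappa> * of_real (q \<tau>)" if "\<tau> \<in> {-1..1}" for \<tau>
  proof -
    show ?thesis using h[OF that] q0 by (simp add: h_def diff_eq_eq)
  qed
  then show ?thesis using that unfolding q_def by blast
qed

text \<open>At \<tau> = 0 the matrix has rows (q, 1 - q) and (1 - q, q), with q the value of
  \<open>Q1\<close>, and it maps (c, c + K) to the given data. Hence C = c and D = c + K.\<close>

lemma C_constant_diagonal:
  assumes "a 0 (k + 3) (k + 2) m 0 = c + K - K * of_real (Q1 (k + 3) (k + 2) 0)"
    and "a 4 (k + 3) (k + 2) m 0 = c + K * of_real (Q1 (k + 3) (k + 2) 0)"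
  shows "C_constant a (k + 3) (k + 2) m = c"
proof -
  define q where "q = Q1 (k + 3) (k + 2) 0"
  define X where "X = X_matrix (k + 3) (k + 2) 0"
  have q3: "(-1) ^ (k + 2) * Q3 (k + 3) (k + 2) 0 = 1 - q"
    using Q1_add_Q3_diagonal[of k 0] by (simp add: q_def)
  have X: "X = vector [vector [of_real q, of_real (1 - q)], vector [of_real (1 - q), of_real q]]"
    unfolding X_def X_matrix_def minus_zero q3 by (simp add: q_def)
  have "det X = of_real (2 * q - 1)"
    by (simp add: X det_2 algebra_simps)
  moreover have "2 * q - 1 \<noteq> 0" using Q1_diagonal_at_0[of k] by (simp add: q_def)
  ultimately have "invertible X" by (metis invertible_det_nz of_real_eq_0_iff)
  then have inv: "matrix_inv X ** X = mat 1"
    unfolding invertible_def matrix_inv_def by (rule someI2_ex) (rule conjunct2)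
  have "vector [a 0 (k + 3) (k + 2) m 0, a 4 (k + 3) (k + 2) m 0] = X *v vector [c, c + K]"
    unfolding assms q_def[symmetric] X
    by (simp add: vec_eq_iff forall_2 matrix_vector_mult_def sum_2 algebra_simps)
  then have "CD_constants a (k + 3) (k + 2) m = (matrix_inv X ** X) *v vector [c, c + K]"
    unfolding CD_constants_def X_def[symmetric] by (simp only: matrix_vector_mul_assoc)
  then have "CD_constants a (k + 3) (k + 2) m = vector [c, c + K]"
    unfolding inv by simp
  then show ?thesis by (simp add: C_constant_def)
qed

section \<open>Integration against spin-weighted harmonics\<close>

text \<open>\<open>sphere_integral\<close> is 0 by default on non-integrable functions, so its
  additivity needs this as a separate side condition.\<close>

definition sphere_integrable :: "sphere_fun \<Rightarrow> bool" where
  "sphere_integrable f \<longleftrightarrow>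
     set_integrable lborel ({0<..<pi} \<times> {0..<2 * pi}) (\<lambda>x. sin (fst x) *\<^sub>R f (fst x) (snd x))"

lemma sphere_domain_sets: "{0<..<pi} \<times> {0..<2 * pi} \<in> sets (lborel :: (real \<times> real) measure)"
  by (simp add: borel_Times)

lemma sphere_domain_finite: "emeasure lborel ({0<..<pi} \<times> {0..<2 * pi} :: (real \<times> real) set) < \<infinity>"
  by (rule emeasure_bounded_finite, rule bounded_Times) auto

lemma sphere_integral_cong:
  assumes "\<And>\<theta> \<phi>. (\<theta>, \<phi>) \<in> chart \<Longrightarrow> f \<theta> \<phi> = g \<theta> \<phi>"
  shows "sphere_integral f = sphere_integral g"
  unfolding sphere_integral_def
  by (rule set_lebesgue_integral_cong) (use assms sphere_domain_sets in \<open>auto simp: chart_def\<close>)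

lemma sphere_integrable_cong:
  assumes "\<And>\<theta> \<phi>. (\<theta>, \<phi>) \<in> chart \<Longrightarrow> f \<theta> \<phi> = g \<theta> \<phi>"
  shows "sphere_integrable f \<longleftrightarrow> sphere_integrable g"
  unfolding sphere_integrable_def
  by (rule set_integrable_cong) (use assms in \<open>auto simp: chart_def\<close>)

lemma sphere_measurable:
  assumes "continuous_on chart (\<lambda>(\<theta>, \<phi>). f \<theta> \<phi> :: complex)"
  shows "set_borel_measurable lborel ({0<..<pi} \<times> {0..<2 * pi})
           (\<lambda>x. sin (fst x) *\<^sub>R f (fst x) (snd x))"
proof -
  have "continuous_on chart (\<lambda>x. f (fst x) (snd x))"
    using assms by (simp add: case_prod_unfold)
  then have "continuous_on ({0<..<pi} \<times> {0..<2 * pi}) (\<lambda>x. f (fst x) (snd x))"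
    by (rule continuous_on_subset) (auto simp: chart_def)
  then have c: "continuous_on ({0<..<pi} \<times> {0..<2 * pi}) (\<lambda>x. sin (fst x) *\<^sub>R f (fst x) (snd x))"
    by (intro continuous_on_scaleR continuous_on_sin continuous_on_fst continuous_on_id)
  show ?thesis
    using borel_measurable_continuous_on_indicator[OF _ c] sphere_domain_sets
    by (simp add: set_borel_measurable_def)
qed

lemma sphere_integrable_bound:
  assumes "continuous_on chart (\<lambda>(\<theta>, \<phi>). f \<theta> \<phi> :: complex)" "sphere_integrable g"
    and "\<And>\<theta> \<phi>. (\<theta>, \<phi>) \<in> chart \<Longrightarrow> norm (f \<theta> \<phi>) \<le> norm (g \<theta> \<phi>)"
  shows "sphere_integrable f"
  unfolding sphere_integrable_def
proof (rule set_integrable_bound[OF assms(2)[unfolded sphere_integrable_def] sphere_measurable[OF assms(1)]])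
  show "AE x in lborel. x \<in> {0<..<pi} \<times> {0..<2 * pi} \<longrightarrow>
     norm (sin (fst x) *\<^sub>R f (fst x) (snd x)) \<le> norm (sin (fst x) *\<^sub>R g (fst x) (snd x))"
    using assms(3) by (auto simp: chart_def intro!: mult_left_mono)
qed

lemma sphere_integrable_const: "sphere_integrable (\<lambda>_ _. c)"
  unfolding sphere_integrable_def
proof (rule set_integrable_bound)
  show "set_integrable lborel ({0<..<pi} \<times> {0..<2 * pi}) (\<lambda>_ :: real \<times> real. c)"
    using sphere_domain_sets sphere_domain_finite by (simp add: set_integrable_def)
  show "set_borel_measurable lborel ({0<..<pi} \<times> {0..<2 * pi}) (\<lambda>x. sin (fst x) *\<^sub>R c)"
    by (rule sphere_measurable) (simp add: case_prod_unfold)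
  show "AE x in lborel. x \<in> {0<..<pi} \<times> {0..<2 * pi} \<longrightarrow> norm (sin (fst x) *\<^sub>R c) \<le> norm c"
    by (auto intro!: mult_left_le_one_le)
qed

lemma sphere_integrable_cmult: "sphere_integrable f \<Longrightarrow> sphere_integrable (\<lambda>\<theta> \<phi>. c * f \<theta> \<phi>)"
  using set_integrable_mult_right[of c lborel "{0<..<pi} \<times> {0..<2 * pi}" "\<lambda>x. sin (fst x) *\<^sub>R f (fst x) (snd x)"]
  by (simp add: sphere_integrable_def)

lemma sphere_integrable_add:
  "sphere_integrable f \<Longrightarrow> sphere_integrable g \<Longrightarrow> sphere_integrable (\<lambda>\<theta> \<phi>. f \<theta> \<phi> + g \<theta> \<phi>)"
  using set_integral_add(1) by (simp add: sphere_integrable_def scaleR_add_right)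

lemma sphere_integral_cmult: "sphere_integral (\<lambda>\<theta> \<phi>. c * f \<theta> \<phi>) = c * sphere_integral f"
  unfolding sphere_integral_def mult_scaleR_right[symmetric] by (rule set_integral_mult_right)

lemma sphere_integral_add:
  "sphere_integrable f \<Longrightarrow> sphere_integrable g \<Longrightarrow>
     sphere_integral (\<lambda>\<theta> \<phi>. f \<theta> \<phi> + g \<theta> \<phi>) = sphere_integral f + sphere_integral g"
  using set_integral_add(2) by (simp add: sphere_integrable_def sphere_integral_def scaleR_add_right)

lemma sphere_integral_sum:
  assumes "finite I" "\<And>i. i \<in> I \<Longrightarrow> sphere_integrable (f i)"
  shows "sphere_integrable (\<lambda>\<theta> \<phi>. \<Sum>i\<in>I. f i \<theta> \<phi>) \<and>
         sphere_integral (\<lambda>\<theta> \<phi>. \<Sum>i\<in>I. f i \<theta> \<phi>) = (\<Sum>i\<in>I. sphere_integral (f i))"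
  using assms
proof (induction I rule: finite_induct)
  case empty
  show ?case
    using sphere_integrable_const[of 0] by (simp add: sphere_integral_def set_lebesgue_integral_def)
next
  case (insert i I)
  then show ?case by (simp add: sphere_integral_add sphere_integrable_add)
qed

text \<open>The error is at most the uniform distance of \<open>F N\<close> from \<open>G\<close>
  times the L1 norm of g for the area element, so integrability of g stands in for a bound on
  it.\<close>

lemma sphere_integral_uniform_limit:
  assumes g: "continuous_on chart (\<lambda>(\<theta>, \<phi>). g \<theta> \<phi> :: complex)" "sphere_integrable g"
    and F: "\<And>N. continuous_on chart (\<lambda>(\<theta>, \<phi>). F N \<theta> \<phi>)"
      "\<And>N. sphere_integrable (\<lambda>\<theta> \<phi>. g \<theta> \<phi> * F N \<theta> \<phi>)"
    and lim: "uniform_limit chart (\<lambda>N (\<theta>, \<phi>). F N \<theta> \<phi>) (\<lambda>(\<theta>, \<phi>). G \<theta> \<phi>) sequentially"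
  shows "(\<lambda>N. sphere_integral (\<lambda>\<theta> \<phi>. g \<theta> \<phi> * F N \<theta> \<phi>)) \<longlonglongrightarrow> sphere_integral (\<lambda>\<theta> \<phi>. g \<theta> \<phi> * G \<theta> \<phi>)"
proof (rule LIMSEQ_I)
  let ?D = "{0<..<pi} \<times> {0..<2 * pi}"
  let ?B = "\<lambda>\<theta> \<phi>. complex_of_real (norm (g \<theta> \<phi>))"
  have G: "continuous_on chart (\<lambda>(\<theta>, \<phi>). G \<theta> \<phi>)"
    by (rule uniform_limit_theorem[OF _ lim]) (use F(1) in auto)
  have B: "sphere_integrable ?B"
    by (rule sphere_integrable_bound[OF _ g(2)])
      (use g(1) in \<open>auto simp: case_prod_unfold intro!: continuous_intros\<close>)
  define C where "C = (LINT x : ?D | lborel. sin (fst x) * norm (g (fst x) (snd x)))"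
  have Cint: "set_integrable lborel ?D (\<lambda>x. sin (fst x) * norm (g (fst x) (snd x)))"
  proof -
    have "set_integrable lborel ?D (\<lambda>x. norm (sin (fst x) *\<^sub>R g (fst x) (snd x)))"
      using set_integrable_norm[OF g(2)[unfolded sphere_integrable_def]] .
    then show ?thesis
      by (subst set_integrable_cong[OF refl]) (auto simp: sin_gt_zero less_imp_le)
  qed
  have C0: "0 \<le> C"
    unfolding C_def set_lebesgue_integral_def
    by (rule integral_nonneg_AE) (auto simp: indicator_def sin_gt_zero less_imp_le)
  fix e :: real assume e: "0 < e"
  \<comment> \<open>\<open>C + 1\<close> in place of \<open>C\<close> keeps the quotient meaningful
    when \<open>C = 0\<close>.\<close>
  define d where "d = e / (C + 1)"
  have d: "0 < d" "d * C < e" using C0 e by (auto simp: d_def field_simps)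
  have "\<forall>\<^sub>F N in sequentially. \<forall>x\<in>chart. dist ((\<lambda>(\<theta>, \<phi>). F N \<theta> \<phi>) x) ((\<lambda>(\<theta>, \<phi>). G \<theta> \<phi>) x) < d"
    using lim d(1) by (simp add: uniform_limit_iff)
  then obtain N0 where N0: "\<And>N \<theta> \<phi>. N0 \<le> N \<Longrightarrow> (\<theta>, \<phi>) \<in> chart \<Longrightarrow> norm (F N \<theta> \<phi> - G \<theta> \<phi>) < d"
    unfolding eventually_sequentially by (force simp: dist_norm)
  show "\<exists>no. \<forall>n\<ge>no. norm (sphere_integral (\<lambda>\<theta> \<phi>. g \<theta> \<phi> * F n \<theta> \<phi>)
      - sphere_integral (\<lambda>\<theta> \<phi>. g \<theta> \<phi> * G \<theta> \<phi>)) < e"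
  proof (intro exI[of _ N0] allI impI)
    fix N assume N: "N0 \<le> N"
    let ?h = "\<lambda>\<theta> \<phi>. g \<theta> \<phi> * (G \<theta> \<phi> - F N \<theta> \<phi>)"
    have h: "norm (?h \<theta> \<phi>) \<le> d * norm (g \<theta> \<phi>)" if "(\<theta>, \<phi>) \<in> chart" for \<theta> \<phi>
    proof -
      have "norm (g \<theta> \<phi>) * norm (G \<theta> \<phi> - F N \<theta> \<phi>) \<le> norm (g \<theta> \<phi>) * d"
        using N0[OF N that] by (intro mult_left_mono) (simp_all add: norm_minus_commute)
      then show ?thesis by (simp add: norm_mult mult.commute)
    qed
    have hint: "sphere_integrable ?h"
    proof (rule sphere_integrable_bound[OF _ sphere_integrable_cmult[OF B, of "of_real d"]])
      show "continuous_on chart (\<lambda>(\<theta>, \<phi>). ?h \<theta> \<phi>)"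
        using g(1) G F(1)[of N] by (auto simp: case_prod_unfold intro!: continuous_intros)
      show "norm (?h \<theta> \<phi>) \<le> norm (of_real d * ?B \<theta> \<phi>)" if "(\<theta>, \<phi>) \<in> chart" for \<theta> \<phi>
        using h[OF that] d(1) by (simp add: norm_mult)
    qed
    have "sphere_integral (\<lambda>\<theta> \<phi>. g \<theta> \<phi> * G \<theta> \<phi>)
        = sphere_integral (\<lambda>\<theta> \<phi>. g \<theta> \<phi> * F N \<theta> \<phi>) + sphere_integral ?h"
      using sphere_integral_add[OF F(2)[of N] hint] by (simp add: algebra_simps)
    then have "norm (sphere_integral (\<lambda>\<theta> \<phi>. g \<theta> \<phi> * F N \<theta> \<phi>) - sphere_integral (\<lambda>\<theta> \<phi>. g \<theta> \<phi> * G \<theta> \<phi>))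
       = norm (sphere_integral ?h)" by simp
    also have "\<dots> \<le> (LINT x : ?D | lborel. d * (sin (fst x) * norm (g (fst x) (snd x))))"
      unfolding sphere_integral_def set_lebesgue_integral_def
    proof (rule Bochner_Integration.integral_norm_bound_integral)
      show "integrable lborel (\<lambda>x. indicat_real ?D x *\<^sub>R sin (fst x) *\<^sub>R ?h (fst x) (snd x))"
        using hint by (simp add: sphere_integrable_def set_integrable_def)
      show "integrable lborel (\<lambda>x. indicat_real ?D x *\<^sub>R (d * (sin (fst x) * norm (g (fst x) (snd x)))))"
        using set_integrable_mult_right[of d, OF Cint] by (simp add: set_integrable_def)
      fix x
      show "norm (indicat_real ?D x *\<^sub>R sin (fst x) *\<^sub>R ?h (fst x) (snd x))
          \<le> indicat_real ?D x *\<^sub>R (d * (sin (fst x) * norm (g (fst x) (snd x))))"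
      proof (cases "x \<in> ?D")
        case True
        then have "0 < sin (fst x)" "norm (?h (fst x) (snd x)) \<le> d * norm (g (fst x) (snd x))"
          using h[of "fst x" "snd x"] by (auto simp: chart_def intro!: sin_gt_zero)
        then show ?thesis using True by (simp add: mult.left_commute mult_left_mono)
      qed simp
    qed
    also have "\<dots> = d * C" unfolding C_def by (rule set_integral_mult_right)
    finally show "norm (sphere_integral (\<lambda>\<theta> \<phi>. g \<theta> \<phi> * F N \<theta> \<phi>)
       - sphere_integral (\<lambda>\<theta> \<phi>. g \<theta> \<phi> * G \<theta> \<phi>)) < e" using d(2) by simp
  qed
qed

section \<open>Integrability and orthogonal projection of the harmonics\<close>

context
  fixes Y assumes harm: "spin_weighted_harmonics Y"
begin

lemma harmonic_smooth:
  "\<bar>s\<bar> \<le> int l \<Longrightarrow> \<bar>m\<bar> \<le> int l \<Longrightarrow> smooth_on chart (\<lambda>(\<theta>, \<phi>). Y s l m \<theta> \<phi>)"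
  using harm by (simp add: spin_weighted_harmonics_def)

lemma harmonic_continuous:
  assumes "\<bar>s\<bar> \<le> int l" "\<bar>m\<bar> \<le> int l"
  shows "continuous_on chart (\<lambda>(\<theta>, \<phi>). Y s l m \<theta> \<phi>)"
  using spec[OF harmonic_smooth[OF assms, unfolded smooth_on_def], of 0] by simp

lemma harmonic_eth:
  assumes "\<bar>s\<bar> \<le> int l" "\<bar>m\<bar> \<le> int l" "(\<theta>, \<phi>) \<in> chart"
  shows "eth s (Y s l m) \<theta> \<phi> = of_real (sqrt (of_int ((int l - s) * (int l + s + 1)))) * Y (s + 1) l m \<theta> \<phi>"
    and "ethbar s (Y s l m) \<theta> \<phi> = - of_real (sqrt (of_int ((int l + s) * (int l - s + 1)))) * Y (s - 1) l m \<theta> \<phi>"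
  using harm assms unfolding spin_weighted_harmonics_def by blast+

lemma harmonic_orthonormal:
  assumes "\<bar>s\<bar> \<le> int l" "\<bar>m\<bar> \<le> int l" "\<bar>s\<bar> \<le> int l'" "\<bar>m'\<bar> \<le> int l'"
  shows "sphere_integral (\<lambda>\<theta> \<phi>. cnj (Y s l m \<theta> \<phi>) * Y s l' m' \<theta> \<phi>) = (if l = l' \<and> m = m' then 1 else 0)"
  using harm assms unfolding spin_weighted_harmonics_def by blast

text \<open>By convention a non-integrable function has integral 0, whereas orthonormality gives
  1.\<close>

lemma harmonic_square_integrable:
  assumes "\<bar>s\<bar> \<le> int l" "\<bar>m\<bar> \<le> int l"
  shows "sphere_integrable (\<lambda>\<theta> \<phi>. cnj (Y s l m \<theta> \<phi>) * Y s l m \<theta> \<phi>)"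
proof (rule ccontr)
  assume "\<not> ?thesis"
  then have "sphere_integral (\<lambda>\<theta> \<phi>. cnj (Y s l m \<theta> \<phi>) * Y s l m \<theta> \<phi>) = 0"
    unfolding sphere_integrable_def sphere_integral_def set_integrable_def set_lebesgue_integral_def
    by (rule not_integrable_integral_eq)
  then show False using harmonic_orthonormal[OF assms assms] by simp
qed

text \<open>Pointwise |ab| is at most |a|^2 + |b|^2, so square integrability of each factor
  suffices, also for different spin weights.\<close>

lemma harmonic_product_integrable:
  assumes "\<bar>s\<bar> \<le> int l" "\<bar>m\<bar> \<le> int l" "\<bar>s'\<bar> \<le> int l'" "\<bar>m'\<bar> \<le> int l'"
  shows "sphere_integrable (\<lambda>\<theta> \<phi>. cnj (Y s l m \<theta> \<phi>) * Y s' l' m' \<theta> \<phi>)"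
proof (rule sphere_integrable_bound)
  show "continuous_on chart (\<lambda>(\<theta>, \<phi>). cnj (Y s l m \<theta> \<phi>) * Y s' l' m' \<theta> \<phi>)"
    using harmonic_continuous[OF assms(1,2)] harmonic_continuous[OF assms(3,4)]
    by (auto simp: case_prod_unfold intro!: continuous_intros)
  show "sphere_integrable (\<lambda>\<theta> \<phi>. cnj (Y s l m \<theta> \<phi>) * Y s l m \<theta> \<phi> + cnj (Y s' l' m' \<theta> \<phi>) * Y s' l' m' \<theta> \<phi>)"
    by (intro sphere_integrable_add harmonic_square_integrable assms)
  have *: "norm (cnj a * b) \<le> norm (cnj a * a + cnj b * b)" for a b :: complex
  proof -
    have "cnj a * a + cnj b * b = of_real ((norm a)\<^sup>2 + (norm b)\<^sup>2)"
      unfolding of_real_add complex_norm_square by (simp add: mult.commute)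
    then have "norm (cnj a * a + cnj b * b) = (norm a)\<^sup>2 + (norm b)\<^sup>2"
      by (simp only: norm_of_real) simp
    moreover have "2 * (norm a * norm b) \<le> (norm a)\<^sup>2 + (norm b)\<^sup>2"
      using sum_squares_bound[of "norm a" "norm b"] by (simp add: mult.assoc)
    moreover have "0 \<le> norm a * norm b" by simp
    ultimately show ?thesis unfolding norm_mult complex_mod_cnj by linarith
  qed
  show "norm (cnj (Y s l m \<theta> \<phi>) * Y s' l' m' \<theta> \<phi>)
     \<le> norm (cnj (Y s l m \<theta> \<phi>) * Y s l m \<theta> \<phi> + cnj (Y s' l' m' \<theta> \<phi>) * Y s' l' m' \<theta> \<phi>)" for \<theta> \<phi>
    by (rule *)
qed

text \<open>The same comparison with one factor equal to 1: |a| is at most 1 + |a|^2, and the sphere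
  has finite area.\<close>

lemma harmonic_cnj_integrable:
  assumes "\<bar>s\<bar> \<le> int l" "\<bar>m\<bar> \<le> int l"
  shows "sphere_integrable (\<lambda>\<theta> \<phi>. cnj (Y s l m \<theta> \<phi>))"
proof (rule sphere_integrable_bound)
  show "continuous_on chart (\<lambda>(\<theta>, \<phi>). cnj (Y s l m \<theta> \<phi>))"
    using harmonic_continuous[OF assms] by (auto simp: case_prod_unfold intro!: continuous_intros)
  show "sphere_integrable (\<lambda>\<theta> \<phi>. 1 + cnj (Y s l m \<theta> \<phi>) * Y s l m \<theta> \<phi>)"
    by (intro sphere_integrable_add sphere_integrable_const harmonic_square_integrable assms)
  have "norm (cnj a) \<le> norm (1 + cnj a * a)" for a :: complex
  proof -
    have "1 + cnj a * a = of_real (1 + (norm a)\<^sup>2)"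
      unfolding of_real_add complex_norm_square by (simp add: mult.commute)
    then have "norm (1 + cnj a * a) = 1 + (norm a)\<^sup>2"
      by (simp only: norm_of_real) simp
    moreover have "2 * norm a \<le> 1 + (norm a)\<^sup>2"
      using sum_squares_bound[of 1 "norm a"] by simp
    moreover have "0 \<le> norm a" by simp
    ultimately show ?thesis unfolding complex_mod_cnj by linarith
  qed
  then show "norm (cnj (Y s l m \<theta> \<phi>)) \<le> norm (1 + cnj (Y s l m \<theta> \<phi>) * Y s l m \<theta> \<phi>)" for \<theta> \<phi> .
qed

lemma harmonic_projection:
  assumes l: "\<bar>s\<bar> \<le> int l" "\<bar>m\<bar> \<le> int l"
    and I: "finite I" "\<And>l m. (l, m) \<in> I \<Longrightarrow> \<bar>s\<bar> \<le> int l \<and> \<bar>m\<bar> \<le> int l"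
  shows "sphere_integrable (\<lambda>\<theta> \<phi>. cnj (Y s l m \<theta> \<phi>) * (\<Sum>(l', m')\<in>I. c l' m' * Y s l' m' \<theta> \<phi>))"
    and "sphere_integral (\<lambda>\<theta> \<phi>. cnj (Y s l m \<theta> \<phi>) * (\<Sum>(l', m')\<in>I. c l' m' * Y s l' m' \<theta> \<phi>))
           = (if (l, m) \<in> I then c l m else 0)"
proof -
  have *: "cnj (Y s l m \<theta> \<phi>) * (\<Sum>(l', m')\<in>I. c l' m' * Y s l' m' \<theta> \<phi>)
      = (\<Sum>i\<in>I. c (fst i) (snd i) * (cnj (Y s l m \<theta> \<phi>) * Y s (fst i) (snd i) \<theta> \<phi>))" for \<theta> \<phi>
    by (simp add: sum_distrib_left case_prod_unfold mult_ac)
  have int: "sphere_integrable (\<lambda>\<theta> \<phi>. c (fst i) (snd i) * (cnj (Y s l m \<theta> \<phi>) * Y s (fst i) (snd i) \<theta> \<phi>))"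
    if "i \<in> I" for i
    using I(2)[of "fst i" "snd i"] that by (intro sphere_integrable_cmult harmonic_product_integrable l) auto
  let ?f = "\<lambda>i \<theta> \<phi>. c (fst i) (snd i) * (cnj (Y s l m \<theta> \<phi>) * Y s (fst i) (snd i) \<theta> \<phi>)"
  have S: "sphere_integrable (\<lambda>\<theta> \<phi>. \<Sum>i\<in>I. ?f i \<theta> \<phi>) \<and>
      sphere_integral (\<lambda>\<theta> \<phi>. \<Sum>i\<in>I. ?f i \<theta> \<phi>) = (\<Sum>i\<in>I. sphere_integral (?f i))"
    by (rule sphere_integral_sum[OF I(1) int])
  show "sphere_integrable (\<lambda>\<theta> \<phi>. cnj (Y s l m \<theta> \<phi>) * (\<Sum>(l', m')\<in>I. c l' m' * Y s l' m' \<theta> \<phi>))"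
    unfolding * using S by blast
  have "sphere_integral (\<lambda>\<theta> \<phi>. cnj (Y s l m \<theta> \<phi>) * (\<Sum>(l', m')\<in>I. c l' m' * Y s l' m' \<theta> \<phi>))
      = (\<Sum>i\<in>I. c (fst i) (snd i) * (if l = fst i \<and> m = snd i then 1 else 0))"
    unfolding * conjunct2[OF S] sphere_integral_cmult
    using harmonic_orthonormal[OF l] I(2) by (intro sum.cong refl) auto
  also have "\<dots> = (\<Sum>i\<in>I. if i = (l, m) then c l m else 0)"
    by (rule sum.cong) auto
  finally show "sphere_integral (\<lambda>\<theta> \<phi>. cnj (Y s l m \<theta> \<phi>) * (\<Sum>(l', m')\<in>I. c l' m' * Y s l' m' \<theta> \<phi>))
           = (if (l, m) \<in> I then c l m else 0)" using I(1) by simp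
qed

text \<open>After \<eth> or its conjugate has acted, a sum of harmonics still starts at the old
  lowest l, which can lie below |s|. Orthonormality says nothing there; those terms disappear
  because the ladder factor is zero, which is the condition on \<open>c\<close>.\<close>

lemma harmonic_projection_sum:
  assumes l: "\<bar>s\<bar> \<le> int l" "\<bar>m\<bar> \<le> int l" "k \<le> l" "l \<le> p"
    and c: "\<And>l' m'. k \<le> l' \<Longrightarrow> int l' < \<bar>s\<bar> \<Longrightarrow> c l' m' = 0"
  shows "sphere_integrable (\<lambda>\<theta> \<phi>. cnj (Y s l m \<theta> \<phi>) *
            (\<Sum>l'=k..p. \<Sum>m'=- int l'..int l'. c l' m' * Y s l' m' \<theta> \<phi>))"
    and "sphere_integral (\<lambda>\<theta> \<phi>. cnj (Y s l m \<theta> \<phi>) *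
            (\<Sum>l'=k..p. \<Sum>m'=- int l'..int l'. c l' m' * Y s l' m' \<theta> \<phi>)) = c l m"
proof -
  let ?L = "{l'\<in>{k..p}. \<bar>s\<bar> \<le> int l'}"
  let ?I = "SIGMA l' : ?L. {- int l'..int l'}"
  have eq: "(\<Sum>l'=k..p. \<Sum>m'=- int l'..int l'. c l' m' * Y s l' m' \<theta> \<phi>)
      = (\<Sum>(l', m')\<in>?I. c l' m' * Y s l' m' \<theta> \<phi>)" for \<theta> \<phi>
  proof -
    have "(\<Sum>l'=k..p. \<Sum>m'=- int l'..int l'. c l' m' * Y s l' m' \<theta> \<phi>)
        = (\<Sum>l'\<in>?L. \<Sum>m'=- int l'..int l'. c l' m' * Y s l' m' \<theta> \<phi>)"
    proof (rule sum.mono_neutral_right)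
      have "c l' m' = 0" if "l' \<in> {k..p} - ?L" for l' m'
        using c[of l' m'] that by auto
      then show "\<forall>l'\<in>{k..p} - ?L. (\<Sum>m'=- int l'..int l'. c l' m' * Y s l' m' \<theta> \<phi>) = 0"
        by (intro ballI sum.neutral) simp
    qed auto
    then show ?thesis by (simp add: sum.Sigma)
  qed
  have I: "finite ?I" "\<And>l m. (l, m) \<in> ?I \<Longrightarrow> \<bar>s\<bar> \<le> int l \<and> \<bar>m\<bar> \<le> int l"
    by auto
  note * = harmonic_projection[OF l(1,2) I, of c]
  show "sphere_integrable (\<lambda>\<theta> \<phi>. cnj (Y s l m \<theta> \<phi>) *
            (\<Sum>l'=k..p. \<Sum>m'=- int l'..int l'. c l' m' * Y s l' m' \<theta> \<phi>))"
    unfolding eq by (rule *(1))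
  have mem: "(l, m) \<in> ?I" using l by auto
  show "sphere_integral (\<lambda>\<theta> \<phi>. cnj (Y s l m \<theta> \<phi>) *
            (\<Sum>l'=k..p. \<Sum>m'=- int l'..int l'. c l' m' * Y s l' m' \<theta> \<phi>)) = c l m"
    unfolding eq by (rule trans[OF *(2) if_P[OF mem]])
qed

end

section \<open>Termwise differentiation of the expansion\<close>

lemma uniform_limit_slice:
  assumes "uniform_limit X f g F" "\<And>t. t \<in> S \<Longrightarrow> h t \<in> X"
  shows "uniform_limit S (\<lambda>N t. f N (h t)) (\<lambda>t. g (h t)) F"
  using assms unfolding uniform_limit_iff by (fast elim: eventually_mono)

lemma higher_deriv_power_has_deriv:
  "((deriv ^^ j) (\<lambda>r. r ^ p) has_real_derivative (deriv ^^ Suc j) (\<lambda>r. r ^ p) x) (at x within S)"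
proof -
  \<comment> \<open>Every iterated derivative of r^p is a monomial, possibly with c = 0, so its
    coefficients need not be computed.\<close>
  have "\<exists>c q. (deriv ^^ j) (\<lambda>r::real. r ^ p) = (\<lambda>r. c * r ^ q)"
  proof (induction j)
    case 0
    show ?case by (intro exI[of _ 1] exI[of _ p]) simp
  next
    case (Suc j)
    then obtain c q where cq: "(deriv ^^ j) (\<lambda>r::real. r ^ p) = (\<lambda>r. c * r ^ q)" by blast
    have "((\<lambda>r. c * r ^ q) has_real_derivative c * real q * r ^ (q - 1)) (at r)" for r
      by (auto intro!: derivative_eq_intros)
    then have "deriv (\<lambda>r. c * r ^ q) = (\<lambda>r. c * real q * r ^ (q - 1))"
      by (intro ext DERIV_imp_deriv)
    then show ?case using cq by auto
  qed
  then obtain c q where cq: "(deriv ^^ j) (\<lambda>r::real. r ^ p) = (\<lambda>r. c * r ^ q)" by blast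
  have "((\<lambda>r. c * r ^ q) has_real_derivative c * real q * x ^ (q - 1)) (at x)"
    by (auto intro!: derivative_eq_intros)
  then have "((\<lambda>r. c * r ^ q) has_real_derivative deriv (\<lambda>r. c * r ^ q) x) (at x)"
    using DERIV_imp_deriv by metis
  then show ?thesis by (simp add: cq has_field_derivative_at_within)
qed

lemma double_sum_linear:
  fixes K A B C :: "'a \<Rightarrow> 'b \<Rightarrow> complex"
  shows "x * (y * (\<Sum>l\<in>L. \<Sum>m\<in>M l. K l m * A l m)
       - 1 / 2 * ((\<Sum>l\<in>L. \<Sum>m\<in>M l. K l m * B l m) - (\<Sum>l\<in>L. \<Sum>m\<in>M l. K l m * C l m)))
     = (\<Sum>l\<in>L. \<Sum>m\<in>M l. K l m * (x * (y * A l m - 1 / 2 * (B l m - C l m))))"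
  unfolding sum_subtractf[symmetric] sum_distrib_left
  by (intro sum.cong refl) (simp add: algebra_simps)

locale spin2_expansion =
  fixes Y :: "int \<Rightarrow> nat \<Rightarrow> int \<Rightarrow> sphere_fun" and \<Phi> :: spin2_field and a :: coeffs and \<rho>0 :: real
  assumes harm: "spin_weighted_harmonics Y"
    and eqs: "spin2_equations \<Phi>"
    and rho0: "0 < \<rho>0"
    and expn: "has_expansion Y \<rho>0 a \<Phi>"
begin

abbreviation in_domain :: "real \<Rightarrow> real \<Rightarrow> real \<Rightarrow> real \<Rightarrow> bool" where
  "in_domain \<tau> \<rho> \<theta> \<phi> \<equiv> \<tau> \<in> {-1..1} \<and> \<rho> \<in> {0..<\<rho>0} \<and> (\<theta>, \<phi>) \<in> chart"

text \<open>\<open>term_deriv\<close> without its \<rho>-factor: for j = 0 it is the coefficient of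
  \<rho>^p in the differentiated expansion.\<close>

definition ang :: "nat \<Rightarrow> bool list \<Rightarrow> nat \<Rightarrow> nat \<Rightarrow> real \<Rightarrow> sphere_fun" where
  "ang i w n p \<tau> \<theta> \<phi> = (\<Sum>l = min_ell n..p. \<Sum>m = - int l..int l.
        1 / fact p * (deriv_tau ^^ i) (a n p l m) \<tau> * eth_word w (2 - int n) (Y (2 - int n) l m) \<theta> \<phi>)"

lemma term_deriv_eq:
  "term_deriv Y a i j w n p \<tau> \<rho> \<theta> \<phi> = ang i w n p \<tau> \<theta> \<phi> * of_real ((deriv ^^ j) (\<lambda>r. r ^ p) \<rho>)"
  by (simp add: term_deriv_def ang_def sum_distrib_right)

text \<open>Below \<open>min_ell n\<close> the inner sum over l is empty, so all series may start at
  p = 0, whatever n is.\<close>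

lemma term_deriv_sum_atMost:
  "(\<Sum>p = min_ell n..N. term_deriv Y a i j w n p \<tau> \<rho> \<theta> \<phi>) = (\<Sum>p\<le>N. term_deriv Y a i j w n p \<tau> \<rho> \<theta> \<phi>)"
  by (rule sum.mono_neutral_left) (auto simp: term_deriv_def)

definition tsum :: "nat \<Rightarrow> nat \<Rightarrow> bool list \<Rightarrow> nat \<Rightarrow> real \<Rightarrow> real \<Rightarrow> sphere_fun" where
  "tsum i j w n \<tau> \<rho> \<theta> \<phi> = lim (\<lambda>N. \<Sum>p\<le>N. term_deriv Y a i j w n p \<tau> \<rho> \<theta> \<phi>)"

lemma tsum_uniform:
  assumes "n \<le> 4" "0 \<le> r" "r < \<rho>0"
  shows "uniform_limit (expansion_domain r)
    (\<lambda>N (\<tau>, \<rho>, \<theta>, \<phi>). \<Sum>p\<le>N. term_deriv Y a i j w n p \<tau> \<rho> \<theta> \<phi>)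
    (\<lambda>(\<tau>, \<rho>, \<theta>, \<phi>). tsum i j w n \<tau> \<rho> \<theta> \<phi>) sequentially"
proof -
  have "uniformly_convergent_on (expansion_domain r)
          (\<lambda>N (\<tau>, \<rho>, \<theta>, \<phi>). \<Sum>p\<le>N. term_deriv Y a i j w n p \<tau> \<rho> \<theta> \<phi>)"
    using expn assms unfolding has_expansion_def term_deriv_sum_atMost by blast
  then show ?thesis
    unfolding uniformly_convergent_uniform_limit_iff
    by (simp add: case_prod_unfold tsum_def)
qed

lemma tsum_slice:
  assumes "n \<le> 4" "0 \<le> r" "r < \<rho>0" "\<And>t. t \<in> S \<Longrightarrow> (f1 t, f2 t, f3 t, f4 t) \<in> expansion_domain r"
  shows "uniform_limit S (\<lambda>N t. \<Sum>p\<le>N. term_deriv Y a i j w n p (f1 t) (f2 t) (f3 t) (f4 t))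
           (\<lambda>t. tsum i j w n (f1 t) (f2 t) (f3 t) (f4 t)) sequentially"
  using uniform_limit_slice[OF tsum_uniform[OF assms(1-3), of i j w], of S "\<lambda>t. (f1 t, f2 t, f3 t, f4 t)"] assms(4)
  by simp

lemma tsum_tendsto:
  assumes "n \<le> 4" "in_domain \<tau> \<rho> \<theta> \<phi>"
  shows "(\<lambda>N. \<Sum>p\<le>N. term_deriv Y a i j w n p \<tau> \<rho> \<theta> \<phi>) \<longlonglongrightarrow> tsum i j w n \<tau> \<rho> \<theta> \<phi>"
proof -
  have "uniform_limit {()} (\<lambda>N t. \<Sum>p\<le>N. term_deriv Y a i j w n p \<tau> \<rho> \<theta> \<phi>)
           (\<lambda>t. tsum i j w n \<tau> \<rho> \<theta> \<phi>) sequentially"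
    by (rule tsum_slice[of n \<rho>]) (use assms in \<open>auto simp: expansion_domain_def\<close>)
  from tendsto_uniform_limitI[OF this, of "()"] show ?thesis by simp
qed

lemma tsum_sums:
  assumes "n \<le> 4" "in_domain \<tau> \<rho> \<theta> \<phi>"
  shows "(\<lambda>p. term_deriv Y a i j w n p \<tau> \<rho> \<theta> \<phi>) sums tsum i j w n \<tau> \<rho> \<theta> \<phi>"
  using tsum_tendsto[OF assms] by (simp add: sums_def_le)

lemma field_eq_tsum:
  assumes "n \<le> 4" "in_domain \<tau> \<rho> \<theta> \<phi>"
  shows "\<Phi> n \<tau> \<rho> \<theta> \<phi> = tsum 0 0 [] n \<tau> \<rho> \<theta> \<phi>"
proof -
  have "uniform_limit (expansion_domain \<rho>)
          (\<lambda>N (\<tau>, \<rho>, \<theta>, \<phi>). \<Sum>p\<le>N. term_deriv Y a 0 0 [] n p \<tau> \<rho> \<theta> \<phi>)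
          (\<lambda>(\<tau>, \<rho>, \<theta>, \<phi>). \<Phi> n \<tau> \<rho> \<theta> \<phi>) sequentially"
    using expn assms unfolding has_expansion_def term_deriv_sum_atMost by auto
  from tendsto_uniform_limitI[OF this, of "(\<tau>, \<rho>, \<theta>, \<phi>)"]
  have "(\<lambda>N. \<Sum>p\<le>N. term_deriv Y a 0 0 [] n p \<tau> \<rho> \<theta> \<phi>) \<longlonglongrightarrow> \<Phi> n \<tau> \<rho> \<theta> \<phi>"
    using assms by (simp add: expansion_domain_def)
  then show ?thesis using LIMSEQ_unique tsum_tendsto[OF assms] by blast
qed

lemma coeff_smooth:
  "n \<le> 4 \<Longrightarrow> min_ell n \<le> l \<Longrightarrow> l \<le> p \<Longrightarrow> \<bar>m\<bar> \<le> int l \<Longrightarrow> smooth_on {-1..1} (a n p l m)"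
  using expn by (simp add: has_expansion_def)

lemma ang_deriv:
  assumes "n \<le> 4" "\<tau> \<in> {-1..1}"
  shows "((\<lambda>\<tau>. ang i w n p \<tau> \<theta> \<phi>) has_vector_derivative ang (Suc i) w n p \<tau> \<theta> \<phi>) (at \<tau> within {-1..1})"
  unfolding ang_def
  by (intro has_vector_derivative_sum has_vector_derivative_mult_left has_vector_derivative_mult_right
      has_vector_derivative_deriv_tau_funpow coeff_smooth assms) auto

lemma d_tau_field:
  assumes "n \<le> 4" "in_domain \<tau> \<rho> \<theta> \<phi>"
  shows "d_tau (\<Phi> n) \<tau> \<rho> \<theta> \<phi> = tsum 1 0 [] n \<tau> \<rho> \<theta> \<phi>"
proof -
  have "((\<lambda>t. \<Phi> n t \<rho> \<theta> \<phi>) has_vector_derivative tsum 1 0 [] n \<tau> \<rho> \<theta> \<phi>) (at \<tau> within {-1..1})"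
  proof (rule has_vector_derivative_sequence[of _
        "\<lambda>N t. \<Sum>p\<le>N. term_deriv Y a 0 0 [] n p t \<rho> \<theta> \<phi>" "\<lambda>N t. \<Sum>p\<le>N. term_deriv Y a 1 0 [] n p t \<rho> \<theta> \<phi>"])
    show "((\<lambda>t. \<Sum>p\<le>N. term_deriv Y a 0 0 [] n p t \<rho> \<theta> \<phi>) has_vector_derivative
        (\<Sum>p\<le>N. term_deriv Y a 1 0 [] n p t \<rho> \<theta> \<phi>)) (at t within {-1..1})" if "t \<in> {-1..1}" for N t
      unfolding term_deriv_eq One_nat_def
      by (intro has_vector_derivative_sum has_vector_derivative_mult_left ang_deriv assms that)
    show "(\<lambda>N. \<Sum>p\<le>N. term_deriv Y a 0 0 [] n p t \<rho> \<theta> \<phi>) \<longlonglongrightarrow> \<Phi> n t \<rho> \<theta> \<phi>"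
      if "t \<in> {-1..1}" for t
      using tsum_tendsto[of n t \<rho> \<theta> \<phi> 0 0 "[]"] field_eq_tsum[of n t \<rho> \<theta> \<phi>] assms that by simp
    show "uniform_limit {-1..1} (\<lambda>N t. \<Sum>p\<le>N. term_deriv Y a 1 0 [] n p t \<rho> \<theta> \<phi>)
        (\<lambda>t. tsum 1 0 [] n t \<rho> \<theta> \<phi>) sequentially"
      by (rule tsum_slice[of n \<rho>]) (use assms in \<open>auto simp: expansion_domain_def\<close>)
  qed (use assms in auto)
  then show ?thesis
    unfolding d_tau_def using assms by (intro vector_derivative_within_closed_interval) auto
qed

lemma d_rho_field:
  assumes "n \<le> 4" "in_domain \<tau> \<rho> \<theta> \<phi>" "0 < \<rho>"
  shows "d_rho (\<Phi> n) \<tau> \<rho> \<theta> \<phi> = tsum 0 1 [] n \<tau> \<rho> \<theta> \<phi>"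
proof -
  \<comment> \<open>Uniformity holds on [0, r] for r below \<open>\<rho>0\<close>; taking r above
    \<rho> makes \<rho> an interior point, so the derivative within [0, r] is the full one.\<close>
  obtain r where r: "\<rho> < r" "r < \<rho>0" using assms(2) dense[of \<rho> \<rho>0] by auto
  have "((\<lambda>t. \<Phi> n \<tau> t \<theta> \<phi>) has_vector_derivative tsum 0 1 [] n \<tau> \<rho> \<theta> \<phi>) (at \<rho> within {0..r})"
  proof (rule has_vector_derivative_sequence[of _
        "\<lambda>N t. \<Sum>p\<le>N. term_deriv Y a 0 0 [] n p \<tau> t \<theta> \<phi>" "\<lambda>N t. \<Sum>p\<le>N. term_deriv Y a 0 1 [] n p \<tau> t \<theta> \<phi>"])
    show "((\<lambda>t. \<Sum>p\<le>N. term_deriv Y a 0 0 [] n p \<tau> t \<theta> \<phi>) has_vector_derivative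
        (\<Sum>p\<le>N. term_deriv Y a 0 1 [] n p \<tau> t \<theta> \<phi>)) (at t within {0..r})" for N t
      unfolding term_deriv_eq One_nat_def
      by (intro has_vector_derivative_sum has_vector_derivative_mult_right)
        (rule has_vector_derivative_of_real[OF higher_deriv_power_has_deriv])
    show "(\<lambda>N. \<Sum>p\<le>N. term_deriv Y a 0 0 [] n p \<tau> t \<theta> \<phi>) \<longlonglongrightarrow> \<Phi> n \<tau> t \<theta> \<phi>"
      if "t \<in> {0..r}" for t
      using tsum_tendsto[of n \<tau> t \<theta> \<phi> 0 0 "[]"] field_eq_tsum[of n \<tau> t \<theta> \<phi>] assms that r by simp
    show "uniform_limit {0..r} (\<lambda>N t. \<Sum>p\<le>N. term_deriv Y a 0 1 [] n p \<tau> t \<theta> \<phi>)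
        (\<lambda>t. tsum 0 1 [] n \<tau> t \<theta> \<phi>) sequentially"
      by (rule tsum_slice[of n r]) (use assms r in \<open>auto simp: expansion_domain_def\<close>)
  qed (use assms r in auto)
  moreover have "at \<rho> within {0..r} = at \<rho>" using r assms(3) by (intro at_within_Icc_at) auto
  moreover have "at \<rho> within {0..} = at \<rho>"
    using assms(3) by (intro at_within_open_subset[of _ "{0<..}"]) auto
  ultimately show ?thesis unfolding d_rho_def by (simp add: vector_derivative_at)
qed

text \<open>The expansion hypothesis controls words in \<eth> and its conjugate, not coordinate
  derivatives. This and \<open>ang_phi\<close> recover the latter by solving the definitions of the
  two operators for them.\<close>

definition ang_theta :: "nat \<Rightarrow> nat \<Rightarrow> real \<Rightarrow> sphere_fun" where
  "ang_theta n p \<tau> \<theta> \<phi> = - 1 / 2 * (ang 0 [True] n p \<tau> \<theta> \<phi> + ang 0 [False] n p \<tau> \<theta> \<phi>)"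

definition ang_phi :: "nat \<Rightarrow> nat \<Rightarrow> real \<Rightarrow> sphere_fun" where
  "ang_phi n p \<tau> \<theta> \<phi> = - \<i> * of_real (sin \<theta>) * (of_int (2 - int n) * of_real (cot \<theta>) * ang 0 [] n p \<tau> \<theta> \<phi>
     - 1 / 2 * (ang 0 [True] n p \<tau> \<theta> \<phi> - ang 0 [False] n p \<tau> \<theta> \<phi>))"

lemma d_theta_from_eth: "d_theta f \<theta> \<phi> = - 1 / 2 * (eth s f \<theta> \<phi> + ethbar s f \<theta> \<phi>)"
  by (simp add: eth_def ethbar_def)

lemma d_phi_from_eth:
  assumes "(\<theta>, \<phi>) \<in> chart"
  shows "d_phi f \<theta> \<phi> = - \<i> * of_real (sin \<theta>) * (of_int s * of_real (cot \<theta>) * f \<theta> \<phi>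
     - 1 / 2 * (eth s f \<theta> \<phi> - ethbar s f \<theta> \<phi>))"
proof -
  have "sin \<theta> \<noteq> 0" using assms sin_gt_zero[of \<theta>] by (auto simp: chart_def)
  then show ?thesis
    unfolding eth_def ethbar_def by (simp add: field_simps)
qed

lemma ang_partials:
  assumes "n \<le> 4" "(\<theta>, \<phi>) \<in> chart"
  shows "((\<lambda>x. ang 0 [] n p \<tau> x \<phi>) has_vector_derivative ang_theta n p \<tau> \<theta> \<phi>) (at \<theta>)"
    and "((\<lambda>x. ang 0 [] n p \<tau> \<theta> x) has_vector_derivative ang_phi n p \<tau> \<theta> \<phi>) (at \<phi>)"
proof -
  let ?s = "2 - int n"
  have sm: "smooth_on chart (\<lambda>(\<theta>, \<phi>). Y ?s l m \<theta> \<phi>)" if "l \<in> {min_ell n..p}" "m \<in> {- int l..int l}" for l m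
    using that by (intro harmonic_smooth[OF harm]) (auto simp: min_ell_def)
  have "ang_theta n p \<tau> \<theta> \<phi> = (\<Sum>l = min_ell n..p. \<Sum>m = - int l..int l.
        1 / fact p * (deriv_tau ^^ 0) (a n p l m) \<tau> * d_theta (Y ?s l m) \<theta> \<phi>)"
    unfolding ang_theta_def ang_def d_theta_from_eth[of _ _ _ ?s] eth_word.simps
    by (simp add: sum_distrib_left sum.distrib[symmetric] algebra_simps)
  then show "((\<lambda>x. ang 0 [] n p \<tau> x \<phi>) has_vector_derivative ang_theta n p \<tau> \<theta> \<phi>) (at \<theta>)"
    unfolding ang_def eth_word.simps
    by (simp only:) (intro has_vector_derivative_sum has_vector_derivative_mult_right chart_partials(1) sm assms)
  have "ang_phi n p \<tau> \<theta> \<phi> = (\<Sum>l = min_ell n..p. \<Sum>m = - int l..int l.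
        1 / fact p * (deriv_tau ^^ 0) (a n p l m) \<tau> * d_phi (Y ?s l m) \<theta> \<phi>)"
    unfolding ang_phi_def ang_def d_phi_from_eth[OF assms(2), of _ ?s] eth_word.simps
    by (rule double_sum_linear)
  then show "((\<lambda>x. ang 0 [] n p \<tau> \<theta> x) has_vector_derivative ang_phi n p \<tau> \<theta> \<phi>) (at \<phi>)"
    unfolding ang_def eth_word.simps
    by (simp only:) (intro has_vector_derivative_sum has_vector_derivative_mult_right chart_partials(2) sm assms)
qed

text \<open>Convergence of the \<eth>-series and its conjugate yields uniform convergence of the
  termwise coordinate derivatives, so the field is differentiable termwise, and recombining gives
  the two operators. The combination for \<theta> has constant coefficients; the one for \<phi>
  contains the unbounded cot \<theta>, but is used only on lines of fixed \<theta>.\<close>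

lemma eth_field:
  assumes "n \<le> 4" "in_domain \<tau> \<rho> \<theta> \<phi>"
  shows "eth (2 - int n) (\<Phi> n \<tau> \<rho>) \<theta> \<phi> = tsum 0 0 [True] n \<tau> \<rho> \<theta> \<phi>"
    and "ethbar (2 - int n) (\<Phi> n \<tau> \<rho>) \<theta> \<phi> = tsum 0 0 [False] n \<tau> \<rho> \<theta> \<phi>"
proof -
  let ?T = "\<lambda>w x y. tsum 0 0 w n \<tau> \<rho> x y"
  have c: "\<theta> \<in> {0<..<pi}" using assms by (simp add: chart_def)
  define dth where "dth x y = - 1 / 2 * (?T [True] x y + ?T [False] x y)" for x y
  define dph where "dph x y = - \<i> * of_real (sin x) * (of_int (2 - int n) * of_real (cot x) * ?T [] x y
     - 1 / 2 * (?T [True] x y - ?T [False] x y))" for x y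
  have slice: "uniform_limit S (\<lambda>N t. \<Sum>p\<le>N. term_deriv Y a 0 0 w n p \<tau> \<rho> (f t) (g t))
      (\<lambda>t. ?T w (f t) (g t)) sequentially" if "\<And>t. t \<in> S \<Longrightarrow> (f t, g t) \<in> chart" for S f g w
    by (rule tsum_slice[of n \<rho> S "\<lambda>_. \<tau>" "\<lambda>_. \<rho>" f g]) (use assms that in \<open>auto simp: expansion_domain_def\<close>)
  have "((\<lambda>x. \<Phi> n \<tau> \<rho> x \<phi>) has_vector_derivative dth \<theta> \<phi>) (at \<theta> within {0<..<pi})"
  proof (rule has_vector_derivative_sequence[of _
        "\<lambda>N x. \<Sum>p\<le>N. term_deriv Y a 0 0 [] n p \<tau> \<rho> x \<phi>" "\<lambda>N x. \<Sum>p\<le>N. ang_theta n p \<tau> x \<phi> * of_real (\<rho> ^ p)"])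
    show "((\<lambda>x. \<Sum>p\<le>N. term_deriv Y a 0 0 [] n p \<tau> \<rho> x \<phi>) has_vector_derivative
        (\<Sum>p\<le>N. ang_theta n p \<tau> x \<phi> * of_real (\<rho> ^ p))) (at x within {0<..<pi})" if "x \<in> {0<..<pi}" for N x
      unfolding term_deriv_eq funpow_0
      by (intro has_vector_derivative_sum has_vector_derivative_mult_left
          ang_partials(1)[THEN has_vector_derivative_at_within] assms) (use that in \<open>simp add: chart_def\<close>)
    show "(\<lambda>N. \<Sum>p\<le>N. term_deriv Y a 0 0 [] n p \<tau> \<rho> x \<phi>) \<longlonglongrightarrow> \<Phi> n \<tau> \<rho> x \<phi>"
      if "x \<in> {0<..<pi}" for x
      using tsum_tendsto[of n \<tau> \<rho> x \<phi> 0 0 "[]"] field_eq_tsum[of n \<tau> \<rho> x \<phi>] assms that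
      by (simp add: chart_def)
    have "(\<Sum>p\<le>N. ang_theta n p \<tau> x \<phi> * of_real (\<rho> ^ p)) = - 1 / 2 *
        ((\<Sum>p\<le>N. term_deriv Y a 0 0 [True] n p \<tau> \<rho> x \<phi>) + (\<Sum>p\<le>N. term_deriv Y a 0 0 [False] n p \<tau> \<rho> x \<phi>))" for N x
      unfolding term_deriv_eq ang_theta_def funpow_0 sum.distrib[symmetric] sum_distrib_left
      by (intro sum.cong refl) (simp add: algebra_simps)
    then show "uniform_limit {0<..<pi} (\<lambda>N x. \<Sum>p\<le>N. ang_theta n p \<tau> x \<phi> * of_real (\<rho> ^ p))
        (\<lambda>x. dth x \<phi>) sequentially"
      unfolding dth_def
      by (simp only:) (intro bounded_linear.uniform_limit[OF bounded_linear_mult_right] uniform_limit_add slice,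
          auto simp: chart_def)
  qed (use c in auto)
  then have th: "d_theta (\<Phi> n \<tau> \<rho>) \<theta> \<phi> = dth \<theta> \<phi>"
    using c by (simp add: d_theta_def at_within_open[of \<theta> "{0<..<pi}"] vector_derivative_at)
  have "((\<lambda>x. \<Phi> n \<tau> \<rho> \<theta> x) has_vector_derivative dph \<theta> \<phi>) (at \<phi> within UNIV)"
  proof (rule has_vector_derivative_sequence[of _
        "\<lambda>N x. \<Sum>p\<le>N. term_deriv Y a 0 0 [] n p \<tau> \<rho> \<theta> x" "\<lambda>N x. \<Sum>p\<le>N. ang_phi n p \<tau> \<theta> x * of_real (\<rho> ^ p)"])
    show "((\<lambda>x. \<Sum>p\<le>N. term_deriv Y a 0 0 [] n p \<tau> \<rho> \<theta> x) has_vector_derivative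
        (\<Sum>p\<le>N. ang_phi n p \<tau> \<theta> x * of_real (\<rho> ^ p))) (at x within UNIV)" for N x
      unfolding term_deriv_eq funpow_0
      by (intro has_vector_derivative_sum has_vector_derivative_mult_left
          ang_partials(2)[THEN has_vector_derivative_at_within] assms) (use c in \<open>simp add: chart_def\<close>)
    show "(\<lambda>N. \<Sum>p\<le>N. term_deriv Y a 0 0 [] n p \<tau> \<rho> \<theta> x) \<longlonglongrightarrow> \<Phi> n \<tau> \<rho> \<theta> x" for x
      using tsum_tendsto[of n \<tau> \<rho> \<theta> x 0 0 "[]"] field_eq_tsum[of n \<tau> \<rho> \<theta> x] assms
      by (simp add: chart_def)
    have "(\<Sum>p\<le>N. ang_phi n p \<tau> \<theta> x * of_real (\<rho> ^ p)) = - \<i> * of_real (sin \<theta>) * (of_int (2 - int n) * of_real (cot \<theta>) *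
        (\<Sum>p\<le>N. term_deriv Y a 0 0 [] n p \<tau> \<rho> \<theta> x) - 1 / 2 *
        ((\<Sum>p\<le>N. term_deriv Y a 0 0 [True] n p \<tau> \<rho> \<theta> x) - (\<Sum>p\<le>N. term_deriv Y a 0 0 [False] n p \<tau> \<rho> \<theta> x)))" for N x
      unfolding term_deriv_eq ang_phi_def funpow_0 sum_subtractf[symmetric] sum_distrib_left
      by (intro sum.cong refl) (simp add: algebra_simps)
    then show "uniform_limit UNIV (\<lambda>N x. \<Sum>p\<le>N. ang_phi n p \<tau> \<theta> x * of_real (\<rho> ^ p))
        (\<lambda>x. dph \<theta> x) sequentially"
      unfolding dph_def
      by (simp only:) (intro bounded_linear.uniform_limit[OF bounded_linear_mult_right] uniform_limit_minus slice,
          use c in \<open>auto simp: chart_def\<close>)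
  qed auto
  then have ph: "d_phi (\<Phi> n \<tau> \<rho>) \<theta> \<phi> = dph \<theta> \<phi>"
    by (simp add: d_phi_def vector_derivative_at)
  have s: "sin \<theta> \<noteq> 0" using c sin_gt_zero[of \<theta>] by auto
  have Phi: "\<Phi> n \<tau> \<rho> \<theta> \<phi> = ?T [] \<theta> \<phi>" using field_eq_tsum assms by blast
  have e: "\<i> / of_real (sin \<theta>) * dph \<theta> \<phi> = of_int (2 - int n) * of_real (cot \<theta>) * ?T [] \<theta> \<phi>
     - 1 / 2 * (?T [True] \<theta> \<phi> - ?T [False] \<theta> \<phi>)"
    unfolding dph_def using s by simp
  show "eth (2 - int n) (\<Phi> n \<tau> \<rho>) \<theta> \<phi> = ?T [True] \<theta> \<phi>"
    unfolding eth_def th ph e Phi dth_def by (simp add: field_simps)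
  show "ethbar (2 - int n) (\<Phi> n \<tau> \<rho>) \<theta> \<phi> = ?T [False] \<theta> \<phi>"
    unfolding ethbar_def th ph e Phi dth_def by (simp add: field_simps)
qed

end

section \<open>Projection of the field equations\<close>

context spin2_expansion
begin

lemma ang_sums:
  assumes "n \<le> 4" "in_domain \<tau> \<rho> \<theta> \<phi>"
  shows "(\<lambda>p. ang i w n p \<tau> \<theta> \<phi> * of_real \<rho> ^ p) sums tsum i 0 w n \<tau> \<rho> \<theta> \<phi>"
  using tsum_sums[OF assms, of i 0 w] by (simp add: term_deriv_eq)

text \<open>The operator \<rho> d/d\<rho> multiplies \<rho>^p by p and does not shift the order,
  which is why the field equations decouple in p.\<close>

lemma ang_sums_d_rho:
  assumes "n \<le> 4" "in_domain \<tau> \<rho> \<theta> \<phi>"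
  shows "(\<lambda>p. of_nat p * ang 0 [] n p \<tau> \<theta> \<phi> * of_real \<rho> ^ p) sums (of_real \<rho> * tsum 0 1 [] n \<tau> \<rho> \<theta> \<phi>)"
proof -
  have d: "\<rho> * (deriv ^^ 1) (\<lambda>r. r ^ p) \<rho> = real p * \<rho> ^ p" for p
  proof -
    have "((\<lambda>r. r ^ p) has_real_derivative real p * \<rho> ^ (p - 1)) (at \<rho>)"
      by (auto intro!: derivative_eq_intros)
    then have "deriv (\<lambda>r. r ^ p) \<rho> = real p * \<rho> ^ (p - 1)" by (rule DERIV_imp_deriv)
    then show ?thesis by (cases p) auto
  qed
  have "of_real \<rho> * term_deriv Y a 0 1 [] n p \<tau> \<rho> \<theta> \<phi> = of_nat p * ang 0 [] n p \<tau> \<theta> \<phi> * of_real \<rho> ^ p" for p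
  proof -
    have "of_real \<rho> * term_deriv Y a 0 1 [] n p \<tau> \<rho> \<theta> \<phi>
        = ang 0 [] n p \<tau> \<theta> \<phi> * of_real (\<rho> * (deriv ^^ 1) (\<lambda>r. r ^ p) \<rho>)"
      by (simp add: term_deriv_eq)
    then show ?thesis unfolding d by simp
  qed
  then show ?thesis using sums_mult[OF tsum_sums[OF assms, of 0 1 "[]"], of "of_real \<rho>"] by simp
qed

text \<open>One template for all eight field equations: each combines derivatives of a single
  component n with \<eth> of an upper neighbour and the conjugate operator on a lower one.\<close>

lemma coefficient_equation:
  assumes n: "n \<le> 4" "n1 \<le> 4" "n2 \<le> 4" and tau: "\<tau> \<in> {-1..1}" and ch: "(\<theta>, \<phi>) \<in> chart"
    and eq: "\<And>\<rho>. 0 < \<rho> \<Longrightarrow> \<rho> < \<rho>0 \<Longrightarrow>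
      x1 * tsum 1 0 [] n \<tau> \<rho> \<theta> \<phi> + x2 * tsum 0 0 [] n \<tau> \<rho> \<theta> \<phi> + x3 * (of_real \<rho> * tsum 0 1 [] n \<tau> \<rho> \<theta> \<phi>)
      + x4 * tsum 0 0 [True] n1 \<tau> \<rho> \<theta> \<phi> + x5 * tsum 0 0 [False] n2 \<tau> \<rho> \<theta> \<phi> = 0"
  shows "x1 * ang 1 [] n p \<tau> \<theta> \<phi> + (x2 + x3 * of_nat p) * ang 0 [] n p \<tau> \<theta> \<phi>
      + x4 * ang 0 [True] n1 p \<tau> \<theta> \<phi> + x5 * ang 0 [False] n2 p \<tau> \<theta> \<phi> = 0"
proof (rule powser_zero_on_interval[OF rho0])
  fix \<rho> assume \<rho>: "0 < \<rho>" "\<rho> < \<rho>0"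
  then have dom: "in_domain \<tau> \<rho> \<theta> \<phi>" using tau ch by simp
  let ?f = "\<lambda>p. x1 * (ang 1 [] n p \<tau> \<theta> \<phi> * of_real \<rho> ^ p) + x2 * (ang 0 [] n p \<tau> \<theta> \<phi> * of_real \<rho> ^ p)
      + x3 * (of_nat p * ang 0 [] n p \<tau> \<theta> \<phi> * of_real \<rho> ^ p)
      + x4 * (ang 0 [True] n1 p \<tau> \<theta> \<phi> * of_real \<rho> ^ p) + x5 * (ang 0 [False] n2 p \<tau> \<theta> \<phi> * of_real \<rho> ^ p)"
  have "?f sums 0"
    unfolding eq[OF \<rho>, symmetric]
    by (intro sums_add sums_mult ang_sums ang_sums_d_rho n dom)
  moreover have "?f p = (x1 * ang 1 [] n p \<tau> \<theta> \<phi> + (x2 + x3 * of_nat p) * ang 0 [] n p \<tau> \<theta> \<phi>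
      + x4 * ang 0 [True] n1 p \<tau> \<theta> \<phi> + x5 * ang 0 [False] n2 p \<tau> \<theta> \<phi>) * of_real \<rho> ^ p" for p
    by (simp add: algebra_simps)
  ultimately show "(\<lambda>p. (x1 * ang 1 [] n p \<tau> \<theta> \<phi> + (x2 + x3 * of_nat p) * ang 0 [] n p \<tau> \<theta> \<phi>
      + x4 * ang 0 [True] n1 p \<tau> \<theta> \<phi> + x5 * ang 0 [False] n2 p \<tau> \<theta> \<phi>) * of_real \<rho> ^ p) sums 0"
    by simp
qed

definition proj :: "int \<Rightarrow> nat \<Rightarrow> int \<Rightarrow> sphere_fun \<Rightarrow> complex" where
  "proj s l m f = sphere_integral (\<lambda>\<theta> \<phi>. cnj (Y s l m \<theta> \<phi>) * f \<theta> \<phi>)"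

definition projectable :: "int \<Rightarrow> nat \<Rightarrow> int \<Rightarrow> sphere_fun \<Rightarrow> bool" where
  "projectable s l m f \<longleftrightarrow> sphere_integrable (\<lambda>\<theta> \<phi>. cnj (Y s l m \<theta> \<phi>) * f \<theta> \<phi>)"

lemma proj_cmult:
  "projectable s l m f \<Longrightarrow> projectable s l m (\<lambda>\<theta> \<phi>. c * f \<theta> \<phi>)"
  "proj s l m (\<lambda>\<theta> \<phi>. c * f \<theta> \<phi>) = c * proj s l m f"
  using sphere_integrable_cmult[of "\<lambda>\<theta> \<phi>. cnj (Y s l m \<theta> \<phi>) * f \<theta> \<phi>" c]
    sphere_integral_cmult[of c "\<lambda>\<theta> \<phi>. cnj (Y s l m \<theta> \<phi>) * f \<theta> \<phi>"]
  by (simp_all add: projectable_def proj_def mult.left_commute)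

lemma proj_add:
  assumes "projectable s l m f" "projectable s l m g"
  shows "projectable s l m (\<lambda>\<theta> \<phi>. f \<theta> \<phi> + g \<theta> \<phi>)"
    and "proj s l m (\<lambda>\<theta> \<phi>. f \<theta> \<phi> + g \<theta> \<phi>) = proj s l m f + proj s l m g"
  using sphere_integrable_add[OF assms[unfolded projectable_def]]
    sphere_integral_add[OF assms[unfolded projectable_def]]
  by (simp_all add: projectable_def proj_def distrib_left)

lemma proj_cong:
  assumes "\<And>\<theta> \<phi>. (\<theta>, \<phi>) \<in> chart \<Longrightarrow> f \<theta> \<phi> = g \<theta> \<phi>"
  shows "projectable s l m f \<longleftrightarrow> projectable s l m g" "proj s l m f = proj s l m g"
  unfolding projectable_def proj_def
  by (rule sphere_integrable_cong sphere_integral_cong, simp add: assms)+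

lemma proj_zero: "projectable s l m (\<lambda>_ _. 0)" "proj s l m (\<lambda>_ _. 0) = 0"
  using sphere_integrable_const[of 0]
  by (simp_all add: projectable_def proj_def sphere_integral_def set_lebesgue_integral_def)

lemma proj_harmonic_sum:
  assumes "\<bar>s\<bar> \<le> int l" "\<bar>m\<bar> \<le> int l" "k \<le> l" "l \<le> p"
    and "\<And>l' m'. k \<le> l' \<Longrightarrow> int l' < \<bar>s\<bar> \<Longrightarrow> c l' m' = 0"
    and "\<And>\<theta> \<phi>. (\<theta>, \<phi>) \<in> chart \<Longrightarrow> f \<theta> \<phi> = (\<Sum>l'=k..p. \<Sum>m'=- int l'..int l'. c l' m' * Y s l' m' \<theta> \<phi>)"
  shows "projectable s l m f" "proj s l m f = c l m"
  using harmonic_projection_sum[OF harm assms(1-4), where c = c, OF assms(5)] proj_cong[OF assms(6)]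
  unfolding projectable_def proj_def by simp_all

lemma proj_ang:
  assumes "min_ell n \<le> l" "l \<le> p" "\<bar>m\<bar> \<le> int l"
  shows "projectable (2 - int n) l m (ang i [] n p \<tau>)"
    and "proj (2 - int n) l m (ang i [] n p \<tau>) = 1 / fact p * (deriv_tau ^^ i) (a n p l m) \<tau>"
proof -
  have *: "\<bar>2 - int n\<bar> \<le> int l" using assms(1) by (simp add: min_ell_def)
  note P = proj_harmonic_sum[OF * assms(3,1,2), of "\<lambda>l m. 1 / fact p * (deriv_tau ^^ i) (a n p l m) \<tau>" "ang i [] n p \<tau>"]
  show "projectable (2 - int n) l m (ang i [] n p \<tau>)"
    by (rule P(1)) (auto simp: min_ell_def ang_def)
  show "proj (2 - int n) l m (ang i [] n p \<tau>) = 1 / fact p * (deriv_tau ^^ i) (a n p l m) \<tau>"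
    by (rule P(2)) (auto simp: min_ell_def ang_def)
qed

lemma proj_ang_eth:
  assumes "min_ell n \<le> l" "l \<le> p" "\<bar>m\<bar> \<le> int l" "\<bar>s\<bar> \<le> int l" "s = 3 - int n"
  shows "projectable s l m (ang 0 [True] n p \<tau>)"
    and "proj s l m (ang 0 [True] n p \<tau>)
      = 1 / fact p * a n p l m \<tau> * of_real (sqrt (of_int ((int l - (2 - int n)) * (int l + (2 - int n) + 1))))"
proof -
  have s: "2 - int n + 1 = s" using assms(5) by simp
  define c where "c l m = 1 / fact p * a n p l m \<tau> *
      of_real (sqrt (of_int ((int l - (2 - int n)) * (int l + (2 - int n) + 1))))" for l m
  have f: "ang 0 [True] n p \<tau> \<theta> \<phi> = (\<Sum>l'=min_ell n..p. \<Sum>m'=- int l'..int l'. c l' m' * Y s l' m' \<theta> \<phi>)"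
    if "(\<theta>, \<phi>) \<in> chart" for \<theta> \<phi>
    unfolding ang_def
  proof (intro sum.cong refl)
    fix l' m' assume "l' \<in> {min_ell n..p}" "m' \<in> {- int l'..int l'}"
    then have "\<bar>2 - int n\<bar> \<le> int l'" "\<bar>m'\<bar> \<le> int l'" by (auto simp: min_ell_def)
    note e = harmonic_eth(1)[OF harm this that, unfolded s]
    show "1 / fact p * (deriv_tau ^^ 0) (a n p l' m') \<tau> * eth_word [True] (2 - int n) (Y (2 - int n) l' m') \<theta> \<phi>
        = c l' m' * Y s l' m' \<theta> \<phi>"
      unfolding eth_word.simps e c_def funpow_0 by (simp only: mult_ac mult_minus_left mult_minus_right)
  qed
  \<comment> \<open>The bounds |2 - n| and |3 - n| differ by one, so only l' = 2 - n, the top of the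
    ladder, can lie in the gap; there the factor l' - (2 - n) is zero.\<close>
  have c0: "c l' m' = 0" if "min_ell n \<le> l'" "int l' < \<bar>s\<bar>" for l' m'
  proof -
    have "int l' = 2 - int n" using that assms(5) by (auto simp: min_ell_def abs_if split: if_splits)
    then show ?thesis by (simp add: c_def)
  qed
  show "projectable s l m (ang 0 [True] n p \<tau>)"
    by (rule proj_harmonic_sum(1)[OF assms(4,3,1,2) c0 f])
  show "proj s l m (ang 0 [True] n p \<tau>) = 1 / fact p * a n p l m \<tau> *
      of_real (sqrt (of_int ((int l - (2 - int n)) * (int l + (2 - int n) + 1))))"
    using proj_harmonic_sum(2)[OF assms(4,3,1,2) c0 f] by (simp add: c_def)
qed

lemma proj_ang_ethbar:
  assumes "min_ell n \<le> l" "l \<le> p" "\<bar>m\<bar> \<le> int l" "\<bar>s\<bar> \<le> int l" "s = 1 - int n"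
  shows "projectable s l m (ang 0 [False] n p \<tau>)"
    and "proj s l m (ang 0 [False] n p \<tau>)
      = - (1 / fact p * a n p l m \<tau> * of_real (sqrt (of_int ((int l + (2 - int n)) * (int l - (2 - int n) + 1)))))"
proof -
  have s: "2 - int n - 1 = s" using assms(5) by simp
  define c where "c l m = - (1 / fact p * a n p l m \<tau> *
      of_real (sqrt (of_int ((int l + (2 - int n)) * (int l - (2 - int n) + 1)))))" for l m
  have f: "ang 0 [False] n p \<tau> \<theta> \<phi> = (\<Sum>l'=min_ell n..p. \<Sum>m'=- int l'..int l'. c l' m' * Y s l' m' \<theta> \<phi>)"
    if "(\<theta>, \<phi>) \<in> chart" for \<theta> \<phi>
    unfolding ang_def
  proof (intro sum.cong refl)
    fix l' m' assume "l' \<in> {min_ell n..p}" "m' \<in> {- int l'..int l'}"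
    then have "\<bar>2 - int n\<bar> \<le> int l'" "\<bar>m'\<bar> \<le> int l'" by (auto simp: min_ell_def)
    note e = harmonic_eth(2)[OF harm this that, unfolded s]
    show "1 / fact p * (deriv_tau ^^ 0) (a n p l' m') \<tau> * eth_word [False] (2 - int n) (Y (2 - int n) l' m') \<theta> \<phi>
        = c l' m' * Y s l' m' \<theta> \<phi>"
      unfolding eth_word.simps e c_def funpow_0 by (simp only: mult_ac mult_minus_left mult_minus_right)
  qed
  \<comment> \<open>Here only the bottom of the ladder, l' = -(2 - n), can occur, and the factor l'
    + (2 - n) vanishes.\<close>
  have c0: "c l' m' = 0" if "min_ell n \<le> l'" "int l' < \<bar>s\<bar>" for l' m'
  proof -
    have "int l' = - (2 - int n)" using that assms(5) by (auto simp: min_ell_def abs_if split: if_splits)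
    then show ?thesis by (simp add: c_def)
  qed
  show "projectable s l m (ang 0 [False] n p \<tau>)"
    by (rule proj_harmonic_sum(1)[OF assms(4,3,1,2) c0 f])
  show "proj s l m (ang 0 [False] n p \<tau>) = - (1 / fact p * a n p l m \<tau> *
      of_real (sqrt (of_int ((int l + (2 - int n)) * (int l - (2 - int n) + 1)))))"
    using proj_harmonic_sum(2)[OF assms(4,3,1,2) c0 f] by (simp add: c_def)
qed

text \<open>A component \<open>\<phi>\<^sub>n\<close> with \<open>n = 0\<close> (or \<open>n = 4\<close>) has no lower (or upper) neighbour; the
  corresponding coefficient is then zero.\<close>

lemma mode_equation:
  assumes n: "n \<le> 4" "n1 \<le> 4" "n2 \<le> 4"
    and n1: "x4 = 0 \<or> n1 = n + 1" and n2: "x5 = 0 \<or> n = n2 + 1"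
    and l: "2 \<le> l" "l \<le> p" "\<bar>m\<bar> \<le> int l" and tau: "\<tau> \<in> {-1..1}"
    and eq: "\<And>\<rho> \<theta> \<phi>. 0 < \<rho> \<Longrightarrow> \<rho> < \<rho>0 \<Longrightarrow> (\<theta>, \<phi>) \<in> chart \<Longrightarrow>
      x1 * tsum 1 0 [] n \<tau> \<rho> \<theta> \<phi> + x2 * tsum 0 0 [] n \<tau> \<rho> \<theta> \<phi> + x3 * (of_real \<rho> * tsum 0 1 [] n \<tau> \<rho> \<theta> \<phi>)
      + x4 * tsum 0 0 [True] n1 \<tau> \<rho> \<theta> \<phi> + x5 * tsum 0 0 [False] n2 \<tau> \<rho> \<theta> \<phi> = 0"
  shows "x1 * deriv_tau (a n p l m) \<tau> + (x2 + x3 * of_nat p) * a n p l m \<tau>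
      + x4 * (of_real (sqrt (of_int ((int l - (2 - int n1)) * (int l + (2 - int n1) + 1)))) * a n1 p l m \<tau>)
      - x5 * (of_real (sqrt (of_int ((int l + (2 - int n2)) * (int l - (2 - int n2) + 1)))) * a n2 p l m \<tau>) = 0"
proof -
  let ?s = "2 - int n"
  define A where "A = complex_of_real (sqrt (of_int ((int l - (2 - int n1)) * (int l + (2 - int n1) + 1))))"
  define B where "B = complex_of_real (sqrt (of_int ((int l + (2 - int n2)) * (int l - (2 - int n2) + 1))))"
  have ml: "min_ell n \<le> l" "min_ell n1 \<le> l" "min_ell n2 \<le> l" "\<bar>?s\<bar> \<le> int l"
    using n l(1) by (auto simp: min_ell_def)
  have 1: "projectable ?s l m (\<lambda>\<theta> \<phi>. x1 * ang 1 [] n p \<tau> \<theta> \<phi>)"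
    "proj ?s l m (\<lambda>\<theta> \<phi>. x1 * ang 1 [] n p \<tau> \<theta> \<phi>) = x1 * (1 / fact p * deriv_tau (a n p l m) \<tau>)"
    using proj_ang[OF ml(1) l(2,3), of 1 \<tau>] by (simp_all add: proj_cmult)
  have 2: "projectable ?s l m (\<lambda>\<theta> \<phi>. (x2 + x3 * of_nat p) * ang 0 [] n p \<tau> \<theta> \<phi>)"
    "proj ?s l m (\<lambda>\<theta> \<phi>. (x2 + x3 * of_nat p) * ang 0 [] n p \<tau> \<theta> \<phi>) = (x2 + x3 * of_nat p) * (1 / fact p * a n p l m \<tau>)"
    using proj_ang[OF ml(1) l(2,3), of 0 \<tau>] by (simp_all add: proj_cmult)
  have 3: "projectable ?s l m (\<lambda>\<theta> \<phi>. x4 * ang 0 [True] n1 p \<tau> \<theta> \<phi>) \<and>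
    proj ?s l m (\<lambda>\<theta> \<phi>. x4 * ang 0 [True] n1 p \<tau> \<theta> \<phi>) = x4 * (1 / fact p * a n1 p l m \<tau> * A)"
  proof (cases "x4 = 0")
    case False
    then have "?s = 3 - int n1" using n1 by auto
    then show ?thesis using proj_ang_eth[OF ml(2) l(2,3) ml(4), of \<tau>] unfolding A_def[symmetric] B_def[symmetric] by (simp add: proj_cmult)
  qed (simp add: proj_zero)
  have 4: "projectable ?s l m (\<lambda>\<theta> \<phi>. x5 * ang 0 [False] n2 p \<tau> \<theta> \<phi>) \<and>
    proj ?s l m (\<lambda>\<theta> \<phi>. x5 * ang 0 [False] n2 p \<tau> \<theta> \<phi>) = x5 * - (1 / fact p * a n2 p l m \<tau> * B)"
  proof (cases "x5 = 0")
    case False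
    then have "?s = 1 - int n2" using n2 by auto
    then show ?thesis using proj_ang_ethbar[OF ml(3) l(2,3) ml(4), of \<tau>] unfolding A_def[symmetric] B_def[symmetric] by (simp add: proj_cmult)
  qed (simp add: proj_zero)
  have "proj ?s l m (\<lambda>\<theta> \<phi>. x1 * ang 1 [] n p \<tau> \<theta> \<phi> + (x2 + x3 * of_nat p) * ang 0 [] n p \<tau> \<theta> \<phi>
      + x4 * ang 0 [True] n1 p \<tau> \<theta> \<phi> + x5 * ang 0 [False] n2 p \<tau> \<theta> \<phi>) = proj ?s l m (\<lambda>_ _. 0)"
    by (rule proj_cong(2)) (rule coefficient_equation[OF n tau _ eq])
  then have "x1 * (1 / fact p * deriv_tau (a n p l m) \<tau>) + (x2 + x3 * of_nat p) * (1 / fact p * a n p l m \<tau>)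
     + x4 * (1 / fact p * a n1 p l m \<tau> * A) + x5 * - (1 / fact p * a n2 p l m \<tau> * B) = 0"
    using 1 2 3 4 by (simp add: proj_add proj_zero)
  then have "1 / fact p * (x1 * deriv_tau (a n p l m) \<tau> + (x2 + x3 * of_nat p) * a n p l m \<tau>
     + x4 * (A * a n1 p l m \<tau>) - x5 * (B * a n2 p l m \<tau>)) = 0"
    unfolding distrib_left right_diff_distrib by (simp only: mult_ac mult_minus_right diff_conv_add_uminus)
  then show ?thesis unfolding A_def[symmetric] B_def[symmetric] by simp
qed

lemma field_equations_tsum:
  assumes "in_domain \<tau> \<rho> \<theta> \<phi>" "0 < \<rho>"
  shows "of_real (1 + \<tau>) * tsum 1 0 [] 0 \<tau> \<rho> \<theta> \<phi> - of_real \<rho> * tsum 0 1 [] 0 \<tau> \<rho> \<theta> \<phi>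
          + tsum 0 0 [True] 1 \<tau> \<rho> \<theta> \<phi> = - 2 * tsum 0 0 [] 0 \<tau> \<rho> \<theta> \<phi>"
    and "tsum 1 0 [] 1 \<tau> \<rho> \<theta> \<phi> + 1/2 * tsum 0 0 [False] 0 \<tau> \<rho> \<theta> \<phi> + 1/2 * tsum 0 0 [True] 2 \<tau> \<rho> \<theta> \<phi>
          = - tsum 0 0 [] 1 \<tau> \<rho> \<theta> \<phi>"
    and "tsum 1 0 [] 2 \<tau> \<rho> \<theta> \<phi> + 1/2 * tsum 0 0 [False] 1 \<tau> \<rho> \<theta> \<phi> + 1/2 * tsum 0 0 [True] 3 \<tau> \<rho> \<theta> \<phi> = 0"
    and "tsum 1 0 [] 3 \<tau> \<rho> \<theta> \<phi> + 1/2 * tsum 0 0 [False] 2 \<tau> \<rho> \<theta> \<phi> + 1/2 * tsum 0 0 [True] 4 \<tau> \<rho> \<theta> \<phi>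
          = tsum 0 0 [] 3 \<tau> \<rho> \<theta> \<phi>"
    and "of_real (1 - \<tau>) * tsum 1 0 [] 4 \<tau> \<rho> \<theta> \<phi> + of_real \<rho> * tsum 0 1 [] 4 \<tau> \<rho> \<theta> \<phi>
          + tsum 0 0 [False] 3 \<tau> \<rho> \<theta> \<phi> = 2 * tsum 0 0 [] 4 \<tau> \<rho> \<theta> \<phi>"
    and "k \<in> {1, 2, 3} \<Longrightarrow> of_real \<tau> * tsum 1 0 [] k \<tau> \<rho> \<theta> \<phi> - of_real \<rho> * tsum 0 1 [] k \<tau> \<rho> \<theta> \<phi>
             + 1/2 * tsum 0 0 [True] (k + 1) \<tau> \<rho> \<theta> \<phi> - 1/2 * tsum 0 0 [False] (k - 1) \<tau> \<rho> \<theta> \<phi> = 0"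
proof -
  have F: "\<Phi> n \<tau> \<rho> \<theta> \<phi> = tsum 0 0 [] n \<tau> \<rho> \<theta> \<phi>" "d_tau (\<Phi> n) \<tau> \<rho> \<theta> \<phi> = tsum 1 0 [] n \<tau> \<rho> \<theta> \<phi>"
    "d_rho (\<Phi> n) \<tau> \<rho> \<theta> \<phi> = tsum 0 1 [] n \<tau> \<rho> \<theta> \<phi>"
    "eth (2 - int n) (\<Phi> n \<tau> \<rho>) \<theta> \<phi> = tsum 0 0 [True] n \<tau> \<rho> \<theta> \<phi>"
    "ethbar (2 - int n) (\<Phi> n \<tau> \<rho>) \<theta> \<phi> = tsum 0 0 [False] n \<tau> \<rho> \<theta> \<phi>" if "n \<le> 4" for n
    using field_eq_tsum[OF that assms(1)] d_tau_field[OF that assms(1)] d_rho_field[OF that assms(1,2)]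
      eth_field[OF that assms(1)] by simp_all
  have le: "1 \<le> (4::nat)" "2 \<le> (4::nat)" "3 \<le> (4::nat)" "4 \<le> (4::nat)" by simp_all
  have E: "eth 1 (\<Phi> 1 \<tau> \<rho>) \<theta> \<phi> = tsum 0 0 [True] 1 \<tau> \<rho> \<theta> \<phi>" "eth 0 (\<Phi> 2 \<tau> \<rho>) \<theta> \<phi> = tsum 0 0 [True] 2 \<tau> \<rho> \<theta> \<phi>"
    "eth (-1) (\<Phi> 3 \<tau> \<rho>) \<theta> \<phi> = tsum 0 0 [True] 3 \<tau> \<rho> \<theta> \<phi>" "eth (-2) (\<Phi> 4 \<tau> \<rho>) \<theta> \<phi> = tsum 0 0 [True] 4 \<tau> \<rho> \<theta> \<phi>"
    "ethbar 2 (\<Phi> 0 \<tau> \<rho>) \<theta> \<phi> = tsum 0 0 [False] 0 \<tau> \<rho> \<theta> \<phi>" "ethbar 1 (\<Phi> 1 \<tau> \<rho>) \<theta> \<phi> = tsum 0 0 [False] 1 \<tau> \<rho> \<theta> \<phi>"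
    "ethbar 0 (\<Phi> 2 \<tau> \<rho>) \<theta> \<phi> = tsum 0 0 [False] 2 \<tau> \<rho> \<theta> \<phi>" "ethbar (-1) (\<Phi> 3 \<tau> \<rho>) \<theta> \<phi> = tsum 0 0 [False] 3 \<tau> \<rho> \<theta> \<phi>"
    using F(4)[of 1] F(4)[of 2] F(4)[of 3] F(4)[of 4] F(5)[of 0] F(5)[of 1] F(5)[of 2] F(5)[of 3] by simp_all
  note A = eqs[unfolded spin2_equations_def, rule_format, of \<tau> \<rho> "(\<theta>, \<phi>)", simplified case_prod_conv]
  have dom: "\<tau> \<in> {-1..1}" "\<rho> \<ge> 0" "(\<theta>, \<phi>) \<in> chart" using assms by auto
  note B = A[OF dom]
  show "of_real (1 + \<tau>) * tsum 1 0 [] 0 \<tau> \<rho> \<theta> \<phi> - of_real \<rho> * tsum 0 1 [] 0 \<tau> \<rho> \<theta> \<phi>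
          + tsum 0 0 [True] 1 \<tau> \<rho> \<theta> \<phi> = - 2 * tsum 0 0 [] 0 \<tau> \<rho> \<theta> \<phi>"
    using B[THEN conjunct1] by (simp only: F[of 0] E)
  note B = B[THEN conjunct2]
  show "tsum 1 0 [] 1 \<tau> \<rho> \<theta> \<phi> + 1/2 * tsum 0 0 [False] 0 \<tau> \<rho> \<theta> \<phi> + 1/2 * tsum 0 0 [True] 2 \<tau> \<rho> \<theta> \<phi>
          = - tsum 0 0 [] 1 \<tau> \<rho> \<theta> \<phi>"
    using B[THEN conjunct1] by (simp only: F(1-3)[OF le(1)] E)
  note B = B[THEN conjunct2]
  show "tsum 1 0 [] 2 \<tau> \<rho> \<theta> \<phi> + 1/2 * tsum 0 0 [False] 1 \<tau> \<rho> \<theta> \<phi> + 1/2 * tsum 0 0 [True] 3 \<tau> \<rho> \<theta> \<phi> = 0"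
    using B[THEN conjunct1] by (simp only: F(1-3)[OF le(2)] E)
  note B = B[THEN conjunct2]
  show "tsum 1 0 [] 3 \<tau> \<rho> \<theta> \<phi> + 1/2 * tsum 0 0 [False] 2 \<tau> \<rho> \<theta> \<phi> + 1/2 * tsum 0 0 [True] 4 \<tau> \<rho> \<theta> \<phi>
          = tsum 0 0 [] 3 \<tau> \<rho> \<theta> \<phi>"
    using B[THEN conjunct1] by (simp only: F(1-3)[OF le(3)] E)
  note B = B[THEN conjunct2]
  show "of_real (1 - \<tau>) * tsum 1 0 [] 4 \<tau> \<rho> \<theta> \<phi> + of_real \<rho> * tsum 0 1 [] 4 \<tau> \<rho> \<theta> \<phi>
          + tsum 0 0 [False] 3 \<tau> \<rho> \<theta> \<phi> = 2 * tsum 0 0 [] 4 \<tau> \<rho> \<theta> \<phi>"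
    using B[THEN conjunct1] by (simp only: F(1-3)[OF le(4)] E)
  note B = B[THEN conjunct2]
  show "of_real \<tau> * tsum 1 0 [] k \<tau> \<rho> \<theta> \<phi> - of_real \<rho> * tsum 0 1 [] k \<tau> \<rho> \<theta> \<phi>
             + 1/2 * tsum 0 0 [True] (k + 1) \<tau> \<rho> \<theta> \<phi> - 1/2 * tsum 0 0 [False] (k - 1) \<tau> \<rho> \<theta> \<phi> = 0"
    if k: "k \<in> {1, 2, 3}"
  proof -
    have "k \<le> 4" "k + 1 \<le> 4" "k - 1 \<le> 4" using k by auto
    then show ?thesis using bspec[OF B k] F by (simp only:)
  qed
qed

text \<open>The factors by which \<open>\<eth>\<close> and its conjugate act between the spin weights \<open>\<plusminus>1, \<plusminus>2\<close> and
  \<open>0, \<plusminus>1\<close>.\<close>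

definition beta :: "nat \<Rightarrow> complex" where "beta l = of_real (sqrt (of_int ((int l - 1) * (int l + 2))))"
definition gamma :: "nat \<Rightarrow> complex" where "gamma l = of_real (sqrt (of_int (int l * (int l + 1))))"

lemma beta_gamma_squares:
  assumes "2 \<le> l"
  shows "beta l * beta l = (of_nat l - 1) * (of_nat l + 2)" "gamma l * gamma l = of_nat l * (of_nat l + 1)"
    "beta l \<noteq> 0"
proof -
  have "0 < (int l - 1) * (int l + 2)" "0 \<le> int l * (int l + 1)" using assms by simp_all
  then have nn: "0 < real_of_int ((int l - 1) * (int l + 2))" "0 \<le> real_of_int (int l * (int l + 1))"
    by (simp_all only: of_int_0_less_iff of_int_0_le_iff)
  have "beta l * beta l = of_real (of_int ((int l - 1) * (int l + 2)))"
    "gamma l * gamma l = of_real (of_int (int l * (int l + 1)))"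
    unfolding beta_def gamma_def of_real_mult[symmetric] using nn by (simp_all only: real_sqrt_mult_self abs_of_nonneg less_imp_le)
  then show "beta l * beta l = (of_nat l - 1) * (of_nat l + 2)" "gamma l * gamma l = of_nat l * (of_nat l + 1)"
    by simp_all
  show "beta l \<noteq> 0" unfolding beta_def using nn(1) by (simp only: of_real_eq_0_iff real_sqrt_eq_zero_cancel_iff)
qed

text \<open>The first five relations are the evolution equations, the last three the constraints.
  For l at least 2 all spin weights from -2 to 2 are admissible, so each of the five components has
  a mode (l, m). The minus signs are those of the conjugate operator on the harmonics.\<close>

lemma mode_system:
  assumes l: "2 \<le> l" "l \<le> p" "\<bar>m\<bar> \<le> int l" and tau: "\<tau> \<in> {-1..1}"
  defines "A \<equiv> \<lambda>n. a n p l m \<tau>" and "A' \<equiv> \<lambda>n. deriv_tau (a n p l m) \<tau>"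
  shows "of_real (1 + \<tau>) * A' 0 + (2 - of_nat p) * A 0 + beta l * A 1 = 0"
    and "A' 1 + A 1 + 1/2 * (gamma l * A 2) - 1/2 * (beta l * A 0) = 0"
    and "A' 2 + 1/2 * (gamma l * A 3) - 1/2 * (gamma l * A 1) = 0"
    and "A' 3 - A 3 + 1/2 * (beta l * A 4) - 1/2 * (gamma l * A 2) = 0"
    and "of_real (1 - \<tau>) * A' 4 + (of_nat p - 2) * A 4 - beta l * A 3 = 0"
    and "of_real \<tau> * A' 1 - of_nat p * A 1 + 1/2 * (gamma l * A 2) + 1/2 * (beta l * A 0) = 0"
    and "of_real \<tau> * A' 2 - of_nat p * A 2 + 1/2 * (gamma l * A 3) + 1/2 * (gamma l * A 1) = 0"
    and "of_real \<tau> * A' 3 - of_nat p * A 3 + 1/2 * (beta l * A 4) + 1/2 * (gamma l * A 2) = 0"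
proof -
  have dom: "in_domain \<tau> \<rho> \<theta> \<phi>" if "0 < \<rho>" "\<rho> < \<rho>0" "(\<theta>, \<phi>) \<in> chart" for \<rho> \<theta> \<phi> using that tau by simp
  note feq = field_equations_tsum[OF dom]
  note M = mode_equation[OF _ _ _ _ _ l tau]
  have b: "(int l - (2 - int 1)) * (int l + (2 - int 1) + 1) = (int l - 1) * (int l + 2)"
    "(int l - (2 - int 4)) * (int l + (2 - int 4) + 1) = (int l - 1) * (int l + 2)"
    "(int l + (2 - int 0)) * (int l - (2 - int 0) + 1) = (int l - 1) * (int l + 2)"
    "(int l + (2 - int 3)) * (int l - (2 - int 3) + 1) = (int l - 1) * (int l + 2)"
    "(int l - (2 - int 2)) * (int l + (2 - int 2) + 1) = int l * (int l + 1)"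
    "(int l - (2 - int 3)) * (int l + (2 - int 3) + 1) = int l * (int l + 1)"
    "(int l + (2 - int 1)) * (int l - (2 - int 1) + 1) = int l * (int l + 1)"
    "(int l + (2 - int 2)) * (int l - (2 - int 2) + 1) = int l * (int l + 1)"
    by (simp_all add: algebra_simps)
  \<comment> \<open>The lower-neighbour slot is filled by index 3 with coefficient 0, chosen so that
    its ladder factor is one of those rewritten by \<open>b\<close>.\<close>
  have "of_real (1 + \<tau>) * deriv_tau (a 0 p l m) \<tau> + (2 + (-1) * of_nat p) * a 0 p l m \<tau>
     + 1 * (beta l * a 1 p l m \<tau>) - 0 * (beta l * a 3 p l m \<tau>) = 0"
    by (rule M[of 0 1 3 1 0 "of_real (1 + \<tau>)" 2 "-1", unfolded b beta_def[symmetric] gamma_def[symmetric]])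
      (use feq(1) in \<open>simp_all add: algebra_simps eq_neg_iff_add_eq_0\<close>)
  then show "of_real (1 + \<tau>) * A' 0 + (2 - of_nat p) * A 0 + beta l * A 1 = 0" by (simp add: A_def A'_def)
  have "1 * deriv_tau (a 1 p l m) \<tau> + (1 + 0 * of_nat p) * a 1 p l m \<tau>
     + 1/2 * (gamma l * a 2 p l m \<tau>) - 1/2 * (beta l * a 0 p l m \<tau>) = 0"
    by (rule M[of 1 2 0 "1/2" "1/2" 1 1 0, unfolded b beta_def[symmetric] gamma_def[symmetric]])
      (use feq(2) in \<open>simp_all add: algebra_simps eq_neg_iff_add_eq_0\<close>)
  then show "A' 1 + A 1 + 1/2 * (gamma l * A 2) - 1/2 * (beta l * A 0) = 0" by (simp add: A_def A'_def)
  have "1 * deriv_tau (a 2 p l m) \<tau> + (0 + 0 * of_nat p) * a 2 p l m \<tau>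
     + 1/2 * (gamma l * a 3 p l m \<tau>) - 1/2 * (gamma l * a 1 p l m \<tau>) = 0"
    by (rule M[of 2 3 1 "1/2" "1/2" 1 0 0, unfolded b beta_def[symmetric] gamma_def[symmetric]])
      (use feq(3) in \<open>simp_all add: algebra_simps eq_neg_iff_add_eq_0\<close>)
  then show "A' 2 + 1/2 * (gamma l * A 3) - 1/2 * (gamma l * A 1) = 0" by (simp add: A_def A'_def)
  have "1 * deriv_tau (a 3 p l m) \<tau> + (-1 + 0 * of_nat p) * a 3 p l m \<tau>
     + 1/2 * (beta l * a 4 p l m \<tau>) - 1/2 * (gamma l * a 2 p l m \<tau>) = 0"
    by (rule M[of 3 4 2 "1/2" "1/2" 1 "-1" 0, unfolded b beta_def[symmetric] gamma_def[symmetric]])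
      (use feq(4) in \<open>simp_all add: algebra_simps eq_neg_iff_add_eq_0\<close>)
  then show "A' 3 - A 3 + 1/2 * (beta l * A 4) - 1/2 * (gamma l * A 2) = 0" by (simp add: A_def A'_def)
  have "of_real (1 - \<tau>) * deriv_tau (a 4 p l m) \<tau> + (-2 + 1 * of_nat p) * a 4 p l m \<tau>
     + 0 * (beta l * a 1 p l m \<tau>) - 1 * (beta l * a 3 p l m \<tau>) = 0"
    by (rule M[of 4 1 3 0 1 "of_real (1 - \<tau>)" "-2" 1, unfolded b beta_def[symmetric] gamma_def[symmetric]])
      (use feq(5) in \<open>simp_all add: algebra_simps eq_neg_iff_add_eq_0\<close>)
  then show "of_real (1 - \<tau>) * A' 4 + (of_nat p - 2) * A 4 - beta l * A 3 = 0" by (simp add: A_def A'_def)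
  have "of_real \<tau> * deriv_tau (a 1 p l m) \<tau> + (0 + (-1) * of_nat p) * a 1 p l m \<tau>
     + 1/2 * (gamma l * a 2 p l m \<tau>) - (-1/2) * (beta l * a 0 p l m \<tau>) = 0"
    by (rule M[of 1 2 0 "1/2" "-1/2" "of_real \<tau>" 0 "-1", unfolded b beta_def[symmetric] gamma_def[symmetric]])
      (use feq(6)[where k = 1] in \<open>simp_all add: algebra_simps eval_nat_numeral\<close>)
  then show "of_real \<tau> * A' 1 - of_nat p * A 1 + 1/2 * (gamma l * A 2) + 1/2 * (beta l * A 0) = 0"
    by (simp add: A_def A'_def)
  have "of_real \<tau> * deriv_tau (a 2 p l m) \<tau> + (0 + (-1) * of_nat p) * a 2 p l m \<tau>
     + 1/2 * (gamma l * a 3 p l m \<tau>) - (-1/2) * (gamma l * a 1 p l m \<tau>) = 0"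
    by (rule M[of 2 3 1 "1/2" "-1/2" "of_real \<tau>" 0 "-1", unfolded b beta_def[symmetric] gamma_def[symmetric]])
      (use feq(6)[where k = 2] in \<open>simp_all add: algebra_simps eval_nat_numeral\<close>)
  then show "of_real \<tau> * A' 2 - of_nat p * A 2 + 1/2 * (gamma l * A 3) + 1/2 * (gamma l * A 1) = 0"
    by (simp add: A_def A'_def)
  have "of_real \<tau> * deriv_tau (a 3 p l m) \<tau> + (0 + (-1) * of_nat p) * a 3 p l m \<tau>
     + 1/2 * (beta l * a 4 p l m \<tau>) - (-1/2) * (gamma l * a 2 p l m \<tau>) = 0"
    by (rule M[of 3 4 2 "1/2" "-1/2" "of_real \<tau>" 0 "-1", unfolded b beta_def[symmetric] gamma_def[symmetric]])
      (use feq(6)[where k = 3] in \<open>simp_all add: algebra_simps eval_nat_numeral\<close>)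
  then show "of_real \<tau> * A' 3 - of_nat p * A 3 + 1/2 * (beta l * A 4) + 1/2 * (gamma l * A 2) = 0"
    by (simp add: A_def A'_def)
qed

end

section \<open>Solution of the mode equations\<close>

context spin2_expansion
begin

lemma coeff_derivs:
  assumes "n \<le> 4" "2 \<le> l" "l \<le> p" "\<bar>m\<bar> \<le> int l" "\<tau> \<in> {-1..1}"
  shows "((deriv_tau ^^ i) (a n p l m) has_vector_derivative (deriv_tau ^^ Suc i) (a n p l m) \<tau>) (at \<tau> within {-1..1})"
  by (rule has_vector_derivative_deriv_tau_funpow[OF coeff_smooth assms(5)])
    (use assms in \<open>auto simp: min_ell_def\<close>)

text \<open>The fifth relation expresses \<open>a 3\<close> through \<open>a 4\<close>. In the sum
  of evolution and constraint equation for \<open>a 3\<close> the component \<open>a 2\<close>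
  cancels; multiplying by \<open>beta l\<close> and inserting its square leaves an equation for
  \<open>a 4\<close> alone.\<close>

lemma mode_ode_4:
  assumes l: "2 \<le> l" "l \<le> p" "\<bar>m\<bar> \<le> int l" and tau: "\<tau> \<in> {-1..1}"
  shows "of_real (1 - \<tau>\<^sup>2) * (deriv_tau ^^ 2) (a 4 p l m) \<tau> + of_real (2 * (real p - 1) * \<tau> - 4) * (deriv_tau ^^ 1) (a 4 p l m) \<tau>
           + of_real ((real l + real p) * (real l - real p + 1)) * (deriv_tau ^^ 0) (a 4 p l m) \<tau> = 0"
proof -
  let ?D = "\<lambda>i. (deriv_tau ^^ i) (a 4 p l m)"
  have a3: "beta l * a 3 p l m \<tau> = of_real (1 - \<tau>) * ?D 1 \<tau> + (of_nat p - 2) * ?D 0 \<tau>" if "\<tau> \<in> {-1..1}" for \<tau>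
    using mode_system(5)[OF l that] by (simp add: algebra_simps)
  have "((\<lambda>\<tau>. of_real (1 - \<tau>) * ?D 1 \<tau> + (of_nat p - 2) * ?D 0 \<tau>) has_vector_derivative
     (of_real (1 - \<tau>) * ?D (Suc 1) \<tau> + of_real (-1) * ?D 1 \<tau>) + (of_nat p - 2) * ?D (Suc 0) \<tau>) (at \<tau> within {-1..1})"
    by (intro has_vector_derivative_add has_vector_derivative_mult has_vector_derivative_mult_right
        coeff_derivs l tau has_vector_derivative_of_real) (auto intro!: derivative_eq_intros)
  then have "((\<lambda>\<tau>. beta l * a 3 p l m \<tau>) has_vector_derivative
     (of_real (1 - \<tau>) * ?D (Suc 1) \<tau> + of_real (-1) * ?D 1 \<tau>) + (of_nat p - 2) * ?D (Suc 0) \<tau>) (at \<tau> within {-1..1})"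
    by (rule has_vector_derivative_cong_on[OF _ tau]) (rule a3)
  moreover have "((\<lambda>\<tau>. beta l * a 3 p l m \<tau>) has_vector_derivative beta l * deriv_tau (a 3 p l m) \<tau>) (at \<tau> within {-1..1})"
    using has_vector_derivative_mult_right[OF coeff_derivs[OF _ l tau, of 3 0], of "beta l"] by simp
  ultimately have d3: "beta l * deriv_tau (a 3 p l m) \<tau>
      = (of_real (1 - \<tau>) * ?D (Suc 1) \<tau> + of_real (-1) * ?D 1 \<tau>) + (of_nat p - 2) * ?D (Suc 0) \<tau>"
    using has_vector_derivative_unique_Icc[OF _ tau] by simp
  define b where "b = beta l"
  define g where "g = gamma l * a 2 p l m \<tau>"
  define t where "t = complex_of_real \<tau>"
  define q where "q = complex_of_nat p"
  define n where "n = complex_of_nat l"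
  define A3 A3' where "A3 = a 3 p l m \<tau>" and "A3' = deriv_tau (a 3 p l m) \<tau>"
  define B0 B1 B2 where "B0 = a 4 p l m \<tau>" and "B1 = ?D 1 \<tau>" and "B2 = ?D 2 \<tau>"
  have E: "A3' - A3 + 1/2 * (b * B0) - 1/2 * g = 0" "t * A3' - q * A3 + 1/2 * (b * B0) + 1/2 * g = 0"
    using mode_system(4,8)[OF l tau] by (simp_all add: b_def g_def t_def q_def A3_def A3'_def B0_def)
  have bb: "b * b = (n - 1) * (n + 2)" using beta_gamma_squares(1)[OF l(1)] by (simp add: b_def n_def)
  have a: "b * A3 = (1 - t) * B1 + (q - 2) * B0"
    using a3[OF tau] by (simp add: b_def A3_def t_def q_def B1_def B0_def)
  have d: "b * A3' = (1 - t) * B2 - B1 + (q - 2) * B1"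
    using d3 by (simp add: b_def A3'_def t_def q_def B1_def B2_def numeral_2_eq_2)
  have "(1 - t\<^sup>2) * B2 + (2 * (q - 1) * t - 4) * B1 + (n + q) * (n - q + 1) * B0 = 0"
    using E bb a d by algebra
  then show ?thesis by (simp add: t_def q_def n_def B0_def B1_def B2_def)
qed

text \<open>The mirror image under \<tau> to -\<tau>: the first relation expresses
  \<open>a 1\<close>, and now the difference of evolution and constraint equation for
  \<open>a 1\<close> cancels \<open>a 2\<close>.\<close>

lemma mode_ode_0:
  assumes l: "2 \<le> l" "l \<le> p" "\<bar>m\<bar> \<le> int l" and tau: "\<tau> \<in> {-1..1}"
  shows "of_real (1 - \<tau>\<^sup>2) * (deriv_tau ^^ 2) (a 0 p l m) \<tau> + of_real (2 * (real p - 1) * \<tau> + 4) * (deriv_tau ^^ 1) (a 0 p l m) \<tau>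
           + of_real ((real l + real p) * (real l - real p + 1)) * (deriv_tau ^^ 0) (a 0 p l m) \<tau> = 0"
proof -
  let ?D = "\<lambda>i. (deriv_tau ^^ i) (a 0 p l m)"
  have a1: "beta l * a 1 p l m \<tau> = of_real (- 1 - \<tau>) * ?D 1 \<tau> + (of_nat p - 2) * ?D 0 \<tau>" if "\<tau> \<in> {-1..1}" for \<tau>
    using mode_system(1)[OF l that] by (simp add: algebra_simps add_eq_0_iff)
  have "((\<lambda>\<tau>. of_real (- 1 - \<tau>) * ?D 1 \<tau> + (of_nat p - 2) * ?D 0 \<tau>) has_vector_derivative
     (of_real (- 1 - \<tau>) * ?D (Suc 1) \<tau> + of_real (-1) * ?D 1 \<tau>) + (of_nat p - 2) * ?D (Suc 0) \<tau>) (at \<tau> within {-1..1})"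
    by (intro has_vector_derivative_add has_vector_derivative_mult has_vector_derivative_mult_right
        coeff_derivs l tau has_vector_derivative_of_real) (auto intro!: derivative_eq_intros)
  then have "((\<lambda>\<tau>. beta l * a 1 p l m \<tau>) has_vector_derivative
     (of_real (- 1 - \<tau>) * ?D (Suc 1) \<tau> + of_real (-1) * ?D 1 \<tau>) + (of_nat p - 2) * ?D (Suc 0) \<tau>) (at \<tau> within {-1..1})"
    by (rule has_vector_derivative_cong_on[OF _ tau]) (rule a1)
  moreover have "((\<lambda>\<tau>. beta l * a 1 p l m \<tau>) has_vector_derivative beta l * deriv_tau (a 1 p l m) \<tau>) (at \<tau> within {-1..1})"
    using has_vector_derivative_mult_right[OF coeff_derivs[OF _ l tau, of 1 0], of "beta l"] by simp
  ultimately have d1: "beta l * deriv_tau (a 1 p l m) \<tau>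
      = (of_real (- 1 - \<tau>) * ?D (Suc 1) \<tau> + of_real (-1) * ?D 1 \<tau>) + (of_nat p - 2) * ?D (Suc 0) \<tau>"
    using has_vector_derivative_unique_Icc[OF _ tau] by simp
  define b where "b = beta l"
  define g where "g = gamma l * a 2 p l m \<tau>"
  define t where "t = complex_of_real \<tau>"
  define q where "q = complex_of_nat p"
  define n where "n = complex_of_nat l"
  define A1 A1' where "A1 = a 1 p l m \<tau>" and "A1' = deriv_tau (a 1 p l m) \<tau>"
  define B0 B1 B2 where "B0 = a 0 p l m \<tau>" and "B1 = ?D 1 \<tau>" and "B2 = ?D 2 \<tau>"
  have E: "A1' + A1 + 1/2 * g - 1/2 * (b * B0) = 0" "t * A1' - q * A1 + 1/2 * g + 1/2 * (b * B0) = 0"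
    using mode_system(2,6)[OF l tau] by (simp_all add: b_def g_def t_def q_def A1_def A1'_def B0_def)
  have bb: "b * b = (n - 1) * (n + 2)" using beta_gamma_squares(1)[OF l(1)] by (simp add: b_def n_def)
  have a: "b * A1 = (- 1 - t) * B1 + (q - 2) * B0"
    using a1[OF tau] by (simp add: b_def A1_def t_def q_def B1_def B0_def)
  have d: "b * A1' = (- 1 - t) * B2 - B1 + (q - 2) * B1"
    using d1 by (simp add: b_def A1'_def t_def q_def B1_def B2_def numeral_2_eq_2)
  have "(1 - t\<^sup>2) * B2 + (2 * (q - 1) * t + 4) * B1 + (n + q) * (n - q + 1) * B0 = 0"
    using E bb a d by algebra
  then show ?thesis by (simp add: t_def q_def n_def B0_def B1_def B2_def)
qed

text \<open>At \<open>\<tau> = \<plusminus>1\<close> the evolution and constraint equations become algebraic; for \<open>p = l + 1\<close> they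
  identify the boundary values of the two extreme components.\<close>

lemma diagonal_endpoints:
  assumes l: "2 \<le> l" "\<bar>m\<bar> \<le> int l"
  shows "a 0 (l + 1) l m 1 = a 4 (l + 1) l m 1" "a 0 (l + 1) l m (-1) = a 4 (l + 1) l m (-1)"
proof -
  define n where "n = complex_of_nat l"
  define b where "b = beta l"
  define g where "g = gamma l"
  have bb: "b * b = (n - 1) * (n + 2)" and gg: "g * g = n * (n + 1)"
    using beta_gamma_squares[OF l(1)] by (simp_all add: b_def g_def n_def)
  have "real l - 1 \<noteq> 0" "real l \<noteq> 0" "real l + 1 \<noteq> 0" "real l + 2 \<noteq> 0" using l(1) by auto
  then have "complex_of_real (real l - 1) \<noteq> 0" "complex_of_real (real l) \<noteq> 0"
    "complex_of_real (real l + 1) \<noteq> 0" "complex_of_real (real l + 2) \<noteq> 0" by (simp_all only: of_real_eq_0_iff not_False_eq_True)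
  then have nz: "(n - 1) * (n * ((n + 1) * (n + 2))) \<noteq> 0" by (simp add: n_def)
  have M: "of_real (1 + \<tau>) * deriv_tau (a 0 (l + 1) l m) \<tau> + (2 - (n + 1)) * a 0 (l + 1) l m \<tau> + b * a 1 (l + 1) l m \<tau> = 0"
    "deriv_tau (a 1 (l + 1) l m) \<tau> + a 1 (l + 1) l m \<tau> + 1/2 * (g * a 2 (l + 1) l m \<tau>) - 1/2 * (b * a 0 (l + 1) l m \<tau>) = 0"
    "deriv_tau (a 2 (l + 1) l m) \<tau> + 1/2 * (g * a 3 (l + 1) l m \<tau>) - 1/2 * (g * a 1 (l + 1) l m \<tau>) = 0"
    "deriv_tau (a 3 (l + 1) l m) \<tau> - a 3 (l + 1) l m \<tau> + 1/2 * (b * a 4 (l + 1) l m \<tau>) - 1/2 * (g * a 2 (l + 1) l m \<tau>) = 0"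
    "of_real (1 - \<tau>) * deriv_tau (a 4 (l + 1) l m) \<tau> + ((n + 1) - 2) * a 4 (l + 1) l m \<tau> - b * a 3 (l + 1) l m \<tau> = 0"
    "of_real \<tau> * deriv_tau (a 1 (l + 1) l m) \<tau> - (n + 1) * a 1 (l + 1) l m \<tau> + 1/2 * (g * a 2 (l + 1) l m \<tau>) + 1/2 * (b * a 0 (l + 1) l m \<tau>) = 0"
    "of_real \<tau> * deriv_tau (a 2 (l + 1) l m) \<tau> - (n + 1) * a 2 (l + 1) l m \<tau> + 1/2 * (g * a 3 (l + 1) l m \<tau>) + 1/2 * (g * a 1 (l + 1) l m \<tau>) = 0"
    "of_real \<tau> * deriv_tau (a 3 (l + 1) l m) \<tau> - (n + 1) * a 3 (l + 1) l m \<tau> + 1/2 * (b * a 4 (l + 1) l m \<tau>) + 1/2 * (g * a 2 (l + 1) l m \<tau>) = 0"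
    if "\<tau> \<in> {-1..1}" for \<tau>
    using mode_system[OF l(1) le_add1 l(2) that, of 1]
    by (simp_all only: b_def g_def n_def of_nat_add of_nat_1)
  \<comment> \<open>Four ladder relations lead from one extreme component to the other. Their
    right-hand factors multiply to b^2 g^2 and their left-hand ones to (n - 1) n (n + 1) (n + 2),
    and these products agree.\<close>
  have chain: "x = y" if "(n + 2) * x1 = b * x" "(n + 1) * x2 = g * x1" "n * x3 = g * x2" "(n - 1) * y = b * x3"
    for x y x1 x2 x3
  proof -
    have "(n - 1) * (n * ((n + 1) * (n + 2))) * y = n * ((n + 1) * (n + 2)) * (b * x3)"
      using that(4) by algebra
    also have "\<dots> = (n + 1) * (n + 2) * b * (g * x2)" using that(3) by algebra
    also have "\<dots> = (n + 2) * b * g * (g * x1)" using that(2) by algebra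
    also have "\<dots> = (b * b) * (g * g) * x" using that(1) by algebra
    also have "\<dots> = (n - 1) * (n * ((n + 1) * (n + 2))) * x" unfolding bb gg by (simp only: mult_ac)
    finally show ?thesis using nz mult_left_cancel by metis
  qed
  show "a 0 (l + 1) l m 1 = a 4 (l + 1) l m 1"
  proof (rule chain[of "a 1 (l + 1) l m 1" _ "a 2 (l + 1) l m 1" "a 3 (l + 1) l m 1"])
    have one: "1 \<in> {- 1..1 :: real}" by simp
    note M1 = M[OF one, unfolded of_real_1]
    \<comment> \<open>At \<tau> = 1 the evolution and constraint equations contain the same
      derivative, which their difference removes; at \<tau> = -1 their sum does.\<close>
    show "(n + 2) * a 1 (l + 1) l m 1 = b * a 0 (l + 1) l m 1" using M1(2,6) by algebra
    show "(n + 1) * a 2 (l + 1) l m 1 = g * a 1 (l + 1) l m 1" using M1(3,7) by algebra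
    show "n * a 3 (l + 1) l m 1 = g * a 2 (l + 1) l m 1" using M1(4,8) by algebra
    show "(n - 1) * a 4 (l + 1) l m 1 = b * a 3 (l + 1) l m 1" using M1(5) by (simp add: algebra_simps)
  qed
  show "a 0 (l + 1) l m (-1) = a 4 (l + 1) l m (-1)"
  proof (rule chain[of "a 3 (l + 1) l m (-1)" _ "a 2 (l + 1) l m (-1)" "a 1 (l + 1) l m (-1)", symmetric])
    have one: "- 1 \<in> {- 1..1 :: real}" by simp
    note M1 = M[OF one, unfolded of_real_minus of_real_1]
    show "(n + 2) * a 3 (l + 1) l m (-1) = b * a 4 (l + 1) l m (-1)" using M1(4,8) by algebra
    show "(n + 1) * a 2 (l + 1) l m (-1) = g * a 3 (l + 1) l m (-1)" using M1(3,7) by algebra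
    show "n * a 1 (l + 1) l m (-1) = g * a 2 (l + 1) l m (-1)" using M1(2,6) by algebra
    show "(n - 1) * a 0 (l + 1) l m (-1) = b * a 1 (l + 1) l m (-1)" using M1(1) by (simp add: algebra_simps)
  qed
qed

text \<open>Both a_4 and the reflection of a_0 solve the diagonal equation, with two constants each.
  The two endpoint identities leave c and K, with a_0 = c + K - K \<open>Q1\<close>, and evaluation
  at \<tau> = 0 identifies c with C.\<close>

lemma diagonal_mode_4:
  assumes l: "2 \<le> l" "\<bar>m\<bar> \<le> int l"
  obtains K where "\<And>\<tau>. \<tau> \<in> {-1..1} \<Longrightarrow>
    a 4 (l + 1) l m \<tau> = C_constant a (l + 1) l m + K * of_real (Q1 (l + 1) l (- \<tau>))"
proof -
  define k where "k = l - 2"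
  have kl: "k + 2 = l" "k + 3 = l + 1" using l(1) by (simp_all add: k_def)
  have kr: "real k + 2 = real l" using kl(1) by linarith
  have lp: "l \<le> l + 1" by simp
  define A where "A i = (deriv_tau ^^ i) (a 4 (l + 1) l m)" for i
  obtain K where K: "\<And>\<tau>. \<tau> \<in> {-1..1} \<Longrightarrow> A 0 \<tau> = A 0 (-1) + K * of_real (Q1 (k + 3) (k + 2) (- \<tau>))"
  proof (rule diagonal_mode_solution[of A k])
    show "(A j has_vector_derivative A (Suc j) \<tau>) (at \<tau> within {-1..1})" if "\<tau> \<in> {-1..1}" for j \<tau>
      unfolding A_def by (rule coeff_derivs[OF _ l(1) lp l(2) that]) simp
    show "of_real (1 - \<tau>\<^sup>2) * A 2 \<tau> = of_real (4 - 2 * (real k + 2) * \<tau>) * A 1 \<tau>" if "\<tau> \<in> {-1..1}" for \<tau>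
      using mode_ode_4[OF l(1) lp l(2) that] unfolding A_def[symmetric] kr
      by (simp add: algebra_simps add_eq_0_iff)
  qed blast
  \<comment> \<open>Reflection turns the equation for \<open>a 0\<close> into that for
    \<open>a 4\<close>; the sign is the chain rule for the i-th derivative.\<close>
  define B where "B i \<tau> = (-1) ^ i * (deriv_tau ^^ i) (a 0 (l + 1) l m) (- \<tau>)" for i \<tau>
  obtain K' where K': "\<And>\<tau>. \<tau> \<in> {-1..1} \<Longrightarrow> B 0 \<tau> = B 0 (-1) + K' * of_real (Q1 (k + 3) (k + 2) (- \<tau>))"
  proof (rule diagonal_mode_solution[of B k])
    show "(B j has_vector_derivative B (Suc j) \<tau>) (at \<tau> within {-1..1})" if t: "\<tau> \<in> {-1..1}" for j \<tau>
    proof -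
      have mt: "- \<tau> \<in> {-1..1}" using t by auto
      have im: "uminus ` {-1..1} = {-1..1 :: real}" by simp
      have "(((deriv_tau ^^ j) (a 0 (l + 1) l m) \<circ> uminus) has_vector_derivative
          (-1) *\<^sub>R (deriv_tau ^^ Suc j) (a 0 (l + 1) l m) (- \<tau>)) (at \<tau> within {-1..1})"
      proof (rule vector_diff_chain_within)
        show "(uminus has_vector_derivative (- 1)) (at \<tau> within {- 1..1})"
          by (auto intro!: derivative_eq_intros)
        show "((deriv_tau ^^ j) (a 0 (l + 1) l m) has_vector_derivative (deriv_tau ^^ Suc j) (a 0 (l + 1) l m) (- \<tau>))
            (at (- \<tau>) within uminus ` {- 1..1})"
          unfolding im by (rule coeff_derivs[OF _ l(1) lp l(2) mt]) simp
      qed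
      from has_vector_derivative_mult_right[OF this, of "(-1) ^ j"]
      show ?thesis by (simp add: B_def[abs_def] o_def)
    qed
    show "of_real (1 - \<tau>\<^sup>2) * B 2 \<tau> = of_real (4 - 2 * (real k + 2) * \<tau>) * B 1 \<tau>" if "\<tau> \<in> {-1..1}" for \<tau>
    proof -
      have mt: "- \<tau> \<in> {-1..1}" using that by auto
      show ?thesis
        using mode_ode_0[OF l(1) lp l(2) mt] unfolding B_def kr
        by (simp add: algebra_simps add_eq_0_iff)
    qed
  qed blast
  note Q = Q1_diagonal_endpoints[of k]
  define c where "c = A 0 (-1)"
  have e1: "A 0 1 = c + K" using K[of 1] Q by (simp add: c_def)
  have e2: "B 0 1 = B 0 (-1) + K'" using K'[of 1] Q by simp
  \<comment> \<open>Reflection swaps the endpoints: \<open>B 0 1\<close> is a_0(-1) = a_4(-1), and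
    \<open>B 0 (-1)\<close> is a_0(1) = a_4(1).\<close>
  have "B 0 1 = A 0 (-1)" "B 0 (-1) = A 0 1"
    using diagonal_endpoints[OF l] by (simp_all add: A_def B_def)
  then have "K' = - K" "B 0 (-1) = c + K" using e1 e2 by (simp_all add: c_def eq_neg_iff_add_eq_0 add.commute)
  then have "a 0 (k + 3) (k + 2) m 0 = c + K - K * of_real (Q1 (k + 3) (k + 2) 0)"
    using K'[of 0, unfolded kl] \<open>K' = - K\<close> unfolding kl by (simp add: B_def)
  moreover have "a 4 (k + 3) (k + 2) m 0 = c + K * of_real (Q1 (k + 3) (k + 2) 0)"
    using K[of 0, unfolded kl] unfolding kl by (simp add: A_def c_def)
  ultimately have "C_constant a (k + 3) (k + 2) m = c" by (rule C_constant_diagonal)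
  then have "a 4 (l + 1) l m \<tau> = C_constant a (l + 1) l m + K * of_real (Q1 (l + 1) l (- \<tau>))"
    if "\<tau> \<in> {-1..1}" for \<tau>
    using K[OF that] unfolding kl by (simp add: A_def c_def)
  then show ?thesis by (rule that)
qed

text \<open>Joins the two mechanisms at \<tau> = 1: the explicit solution for p = l + 1, the
  differentiated Jacobi equation otherwise. The interval stays in \<tau> >= 0, away from -1 where (1
  + \<tau>)^-(p+2) blows up.\<close>

lemma scri_derivative:
  fixes D :: "nat \<Rightarrow> real \<Rightarrow> complex"
  assumes l: "2 \<le> l" "l \<le> p" "\<bar>m\<bar> \<le> int l" and t0: "0 \<le> t0" "t0 < 1"
    and der: "\<And>k \<tau>. \<tau> \<in> {t0..1} \<Longrightarrow> (D k has_vector_derivative D (Suc k) \<tau>) (at \<tau> within {t0..1})"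
    and D0: "\<And>\<tau>. \<tau> \<in> {t0..1} \<Longrightarrow> D 0 \<tau> = a 4 p l m \<tau> * of_real (1 / (1 + \<tau>) ^ (p + 2))"
  shows "D (l - 1) 1 = (if p = l + 1
    then C_constant a p l m * of_real ((-1) ^ (l - 1) * pochhammer (real l + 3) (l - 1) / 2 ^ (2 * l + 2)) else 0)"
proof (cases "p = l + 1")
  case True
  obtain K where K: "\<And>\<tau>. \<tau> \<in> {-1..1} \<Longrightarrow>
    a 4 (l + 1) l m \<tau> = C_constant a (l + 1) l m + K * of_real (Q1 (l + 1) l (- \<tau>))"
    using diagonal_mode_4[OF l(1,3)] by blast
  have "D 0 \<tau> = (C_constant a (l + 1) l m + K * of_real (Q1 (l + 1) l (- \<tau>))) * of_real (1 / (1 + \<tau>) ^ (l + 3))"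
    if "\<tau> \<in> {t0..1}" for \<tau>
    using D0[OF that] K[of \<tau>] that t0 by (simp add: True eval_nat_numeral)
  from deriv_at_scri_eq[OF t0 der this l(1)] show ?thesis using True by simp
next
  case False
  define A where "A i = (deriv_tau ^^ i) (a 4 p l m)" for i
  have sub: "\<tau> \<in> {-1..1}" if "\<tau> \<in> {t0..1}" for \<tau> using that t0 by auto
  have "D (l - 1) 1 = 0"
  proof (rule jacobi_ode_deriv_eq_0[where D = D and p = p])
    show "of_real (1 - \<tau>\<^sup>2) * D 2 \<tau> + of_real (2 * real p - 6 * \<tau>) * D 1 \<tau>
                + of_real ((real l - 2) * (real l + 3)) * D 0 \<tau> = 0" if t: "\<tau> \<in> {t0..1}" for \<tau>
    proof (rule mode_ode_to_jacobi_ode[where D = D and A = A and p = p])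
      show "(A k has_vector_derivative A (Suc k) \<tau>) (at \<tau> within {t0..1})" if "\<tau> \<in> {t0..1}" for k \<tau>
        unfolding A_def
        by (rule has_vector_derivative_within_subset[OF coeff_derivs[OF _ l sub[OF that]]]) (use t0 in auto)
      show "of_real (1 - \<tau>\<^sup>2) * A 2 \<tau> + of_real (2 * (real p - 1) * \<tau> - 4) * A 1 \<tau>
                + of_real ((real l + real p) * (real l - real p + 1)) * A 0 \<tau> = 0" if "\<tau> \<in> {t0..1}" for \<tau>
        unfolding A_def by (rule mode_ode_4[OF l sub[OF that]])
      show "D 0 \<tau> = A 0 \<tau> * of_real (1 / (1 + \<tau>) ^ (p + 2))" if "\<tau> \<in> {t0..1}" for \<tau>
        using D0[OF that] by (simp add: A_def)
    qed (fact t0 der t)+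
  qed (fact t0 der l(1) False)+
  then show ?thesis using False by simp
qed

end

section \<open>Expansions along outgoing rays\<close>

text \<open>Uniform convergence of a series and of its first k termwise \<tau>-derivatives. The
  derivatives are existential, so that the property can be established in one representation of the
  terms and used in another.\<close>

primrec termwise_smooth :: "nat \<Rightarrow> real set \<Rightarrow> 'a set \<Rightarrow> (nat \<Rightarrow> real \<Rightarrow> 'a \<Rightarrow> complex) \<Rightarrow> bool" where
  "termwise_smooth 0 S \<Omega> f \<longleftrightarrow> uniformly_convergent_on (S \<times> \<Omega>) (\<lambda>N (\<tau>, \<omega>). \<Sum>p\<le>N. f p \<tau> \<omega>)"
| "termwise_smooth (Suc k) S \<Omega> f \<longleftrightarrow> uniformly_convergent_on (S \<times> \<Omega>) (\<lambda>N (\<tau>, \<omega>). \<Sum>p\<le>N. f p \<tau> \<omega>) \<and>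
     (\<exists>f'. (\<forall>p. \<forall>\<tau>\<in>S. \<forall>\<omega>\<in>\<Omega>. ((\<lambda>t. f p t \<omega>) has_vector_derivative f' p \<tau> \<omega>) (at \<tau> within S)) \<and>
       termwise_smooth k S \<Omega> f')"

lemma uniformly_convergent_on_cong':
  assumes "\<And>N x. x \<in> X \<Longrightarrow> f N x = g N x" "uniformly_convergent_on X f"
  shows "uniformly_convergent_on X (g :: nat \<Rightarrow> 'a \<Rightarrow> complex)"
proof -
  obtain l where "uniform_limit X f l sequentially"
    using assms(2) by (auto simp: uniformly_convergent_on_def)
  then have "uniform_limit X g l sequentially"
    using assms(1) by (simp add: uniform_limit_iff)
  then show ?thesis by (auto simp: uniformly_convergent_on_def)
qed

lemma termwise_smooth_cong:
  assumes "\<And>p \<tau> \<omega>. \<tau> \<in> S \<Longrightarrow> \<omega> \<in> \<Omega> \<Longrightarrow> f p \<tau> \<omega> = g p \<tau> \<omega>" "termwise_smooth k S \<Omega> f"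
  shows "termwise_smooth k S \<Omega> g"
proof -
  have u: "uniformly_convergent_on (S \<times> \<Omega>) (\<lambda>N (\<tau>, \<omega>). \<Sum>p\<le>N. g p \<tau> \<omega>)"
    if "uniformly_convergent_on (S \<times> \<Omega>) (\<lambda>N (\<tau>, \<omega>). \<Sum>p\<le>N. f p \<tau> \<omega>)"
    by (rule uniformly_convergent_on_cong'[OF _ that]) (auto simp: assms(1))
  show ?thesis
  proof (cases k)
    case 0
    then show ?thesis using u assms(2) by simp
  next
    case (Suc j)
    obtain f' where f': "\<And>p \<tau> \<omega>. \<tau> \<in> S \<Longrightarrow> \<omega> \<in> \<Omega> \<Longrightarrow>
        ((\<lambda>t. f p t \<omega>) has_vector_derivative f' p \<tau> \<omega>) (at \<tau> within S)" "termwise_smooth j S \<Omega> f'"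
      using assms(2) Suc by auto
    have "((\<lambda>t. g p t \<omega>) has_vector_derivative f' p \<tau> \<omega>) (at \<tau> within S)"
      if "\<tau> \<in> S" "\<omega> \<in> \<Omega>" for p \<tau> \<omega>
      by (rule has_vector_derivative_cong_on[OF f'(1)[OF that] that(1)]) (simp add: assms(1) that)
    then show ?thesis using u assms(2) f'(2) Suc by auto
  qed
qed

lemma uniformly_convergent_on_add':
  fixes f g :: "nat \<Rightarrow> 'a \<Rightarrow> complex"
  assumes "uniformly_convergent_on X f" "uniformly_convergent_on X g"
  shows "uniformly_convergent_on X (\<lambda>N x. f N x + g N x)"
  using assms uniform_limit_add unfolding uniformly_convergent_on_def by blast

lemma termwise_smooth_add:
  "termwise_smooth k S \<Omega> f \<Longrightarrow> termwise_smooth k S \<Omega> g \<Longrightarrow> termwise_smooth k S \<Omega> (\<lambda>p \<tau> \<omega>. f p \<tau> \<omega> + g p \<tau> \<omega>)"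
proof (induction k arbitrary: f g)
  case 0
  then show ?case
    using uniformly_convergent_on_add'[of "S \<times> \<Omega>" "\<lambda>N (\<tau>, \<omega>). \<Sum>p\<le>N. f p \<tau> \<omega>" "\<lambda>N (\<tau>, \<omega>). \<Sum>p\<le>N. g p \<tau> \<omega>"]
    by (simp add: case_prod_unfold sum.distrib)
next
  case (Suc k)
  obtain f' where f': "\<And>p \<tau> \<omega>. \<tau> \<in> S \<Longrightarrow> \<omega> \<in> \<Omega> \<Longrightarrow>
      ((\<lambda>t. f p t \<omega>) has_vector_derivative f' p \<tau> \<omega>) (at \<tau> within S)" "termwise_smooth k S \<Omega> f'"
    using Suc.prems(1) by auto
  obtain g' where g': "\<And>p \<tau> \<omega>. \<tau> \<in> S \<Longrightarrow> \<omega> \<in> \<Omega> \<Longrightarrow>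
      ((\<lambda>t. g p t \<omega>) has_vector_derivative g' p \<tau> \<omega>) (at \<tau> within S)" "termwise_smooth k S \<Omega> g'"
    using Suc.prems(2) by auto
  have "uniformly_convergent_on (S \<times> \<Omega>) (\<lambda>N (\<tau>, \<omega>). \<Sum>p\<le>N. f p \<tau> \<omega> + g p \<tau> \<omega>)"
    using uniformly_convergent_on_add'[of "S \<times> \<Omega>" "\<lambda>N (\<tau>, \<omega>). \<Sum>p\<le>N. f p \<tau> \<omega>" "\<lambda>N (\<tau>, \<omega>). \<Sum>p\<le>N. g p \<tau> \<omega>"] Suc.prems
    by (simp add: case_prod_unfold sum.distrib)
  moreover have "((\<lambda>t. f p t \<omega> + g p t \<omega>) has_vector_derivative f' p \<tau> \<omega> + g' p \<tau> \<omega>) (at \<tau> within S)"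
    if "\<tau> \<in> S" "\<omega> \<in> \<Omega>" for p \<tau> \<omega>
    using f'(1)[OF that] g'(1)[OF that] by (rule has_vector_derivative_add)
  moreover have "termwise_smooth k S \<Omega> (\<lambda>p \<tau> \<omega>. f' p \<tau> \<omega> + g' p \<tau> \<omega>)"
    by (rule Suc.IH[OF f'(2) g'(2)])
  ultimately show ?case by (auto intro!: exI[of _ "\<lambda>p \<tau> \<omega>. f' p \<tau> \<omega> + g' p \<tau> \<omega>"])
qed

lemma termwise_smooth_convergent:
  "termwise_smooth k S \<Omega> f \<Longrightarrow> uniformly_convergent_on (S \<times> \<Omega>) (\<lambda>N (\<tau>, \<omega>). \<Sum>p\<le>N. f p \<tau> \<omega>)"
  by (cases k) auto

text \<open>Uniqueness of one-sided derivatives transfers convergence from the hidden witness to the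
  derivative at hand.\<close>

lemma termwise_smooth_deriv:
  assumes "t0 < t1" "termwise_smooth (Suc k) {t0..t1} \<Omega> f"
    and g: "\<And>p \<tau> \<omega>. \<tau> \<in> {t0..t1} \<Longrightarrow> \<omega> \<in> \<Omega> \<Longrightarrow>
        ((\<lambda>t. f p t \<omega>) has_vector_derivative g p \<tau> \<omega>) (at \<tau> within {t0..t1})"
  shows "termwise_smooth k {t0..t1} \<Omega> g"
proof -
  obtain f' where f': "\<And>p \<tau> \<omega>. \<tau> \<in> {t0..t1} \<Longrightarrow> \<omega> \<in> \<Omega> \<Longrightarrow>
        ((\<lambda>t. f p t \<omega>) has_vector_derivative f' p \<tau> \<omega>) (at \<tau> within {t0..t1})"
      "termwise_smooth k {t0..t1} \<Omega> f'"
    using assms(2) unfolding termwise_smooth.simps by blast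
  show ?thesis
    by (rule termwise_smooth_cong[OF _ f'(2)])
      (rule has_vector_derivative_unique_Icc[OF assms(1) _ f'(1) g])
qed

lemma leibniz_derivs:
  fixes F G :: "nat \<Rightarrow> real \<Rightarrow> complex"
  assumes "\<And>k. (F k has_vector_derivative F (Suc k) \<tau>) (at \<tau> within S)"
    and "\<And>k. (G k has_vector_derivative G (Suc k) \<tau>) (at \<tau> within S)"
  shows "((\<lambda>\<tau>. \<Sum>i\<le>k. of_nat (k choose i) * (F i \<tau> * G (k - i) \<tau>)) has_vector_derivative
     (\<Sum>i\<le>Suc k. of_nat (Suc k choose i) * (F i \<tau> * G (Suc k - i) \<tau>))) (at \<tau> within S)"
proof -
  have "((\<lambda>\<tau>. \<Sum>i\<le>k. of_nat (k choose i) * (F i \<tau> * G (k - i) \<tau>)) has_vector_derivative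
     (\<Sum>i\<le>k. of_nat (k choose i) * (F i \<tau> * G (Suc (k - i)) \<tau> + F (Suc i) \<tau> * G (k - i) \<tau>))) (at \<tau> within S)"
    by (intro has_vector_derivative_sum has_vector_derivative_mult_right has_vector_derivative_mult assms)
  moreover have "(\<Sum>i\<le>Suc k. of_nat (Suc k choose i) * (F i \<tau> * G (Suc k - i) \<tau>))
     = (\<Sum>i\<le>k. of_nat (k choose i) * (F i \<tau> * G (Suc (k - i)) \<tau> + F (Suc i) \<tau> * G (k - i) \<tau>))"
  proof -
    have 1: "(\<Sum>i\<le>k. of_nat (k choose i) * (F i \<tau> * G (Suc (k - i)) \<tau>))
        = (\<Sum>i\<le>Suc k. of_nat (k choose i) * (F i \<tau> * G (Suc k - i) \<tau>))"
    proof -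
      have "(\<Sum>i\<le>Suc k. of_nat (k choose i) * (F i \<tau> * G (Suc k - i) \<tau>))
          = (\<Sum>i\<le>k. of_nat (k choose i) * (F i \<tau> * G (Suc k - i) \<tau>))" by (simp add: binomial_eq_0)
      also have "\<dots> = (\<Sum>i\<le>k. of_nat (k choose i) * (F i \<tau> * G (Suc (k - i)) \<tau>))"
        by (intro sum.cong refl) (simp add: Suc_diff_le)
      finally show ?thesis by simp
    qed
    have "(\<Sum>i\<le>Suc k. of_nat (Suc k choose i) * (F i \<tau> * G (Suc k - i) \<tau>))
        = F 0 \<tau> * G (Suc k) \<tau> + (\<Sum>i\<le>k. of_nat (k choose Suc i) * (F (Suc i) \<tau> * G (k - i) \<tau>))
          + (\<Sum>i\<le>k. of_nat (k choose i) * (F (Suc i) \<tau> * G (k - i) \<tau>))"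
      unfolding sum.atMost_Suc_shift by (simp add: sum.distrib algebra_simps)
    also have "F 0 \<tau> * G (Suc k) \<tau> + (\<Sum>i\<le>k. of_nat (k choose Suc i) * (F (Suc i) \<tau> * G (k - i) \<tau>))
        = (\<Sum>i\<le>Suc k. of_nat (k choose i) * (F i \<tau> * G (Suc k - i) \<tau>))"
      unfolding sum.atMost_Suc_shift by simp
    finally show ?thesis unfolding 1[symmetric] by (simp add: sum.distrib distrib_left)
  qed
  ultimately show ?thesis by simp
qed

lemma inverse_power_derivs:
  fixes \<tau> :: real
  assumes "-1 < \<tau>"
  shows "((\<lambda>t. complex_of_real ((-1) ^ j * pochhammer (real q) j * (1 / (1 + t) ^ (q + j)))) has_vector_derivative
     of_real ((-1) ^ Suc j * pochhammer (real q) (Suc j) * (1 / (1 + \<tau>) ^ (q + Suc j)))) (at \<tau> within S)"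
proof -
  have "((\<lambda>t. complex_of_real ((-1) ^ j * pochhammer (real q) j) * complex_of_real (1 / (1 + t) ^ (q + j))) has_vector_derivative
     complex_of_real ((-1) ^ j * pochhammer (real q) j) * of_real (- real (q + j) / (1 + \<tau>) ^ (q + j + 1))) (at \<tau> within S)"
    by (intro has_vector_derivative_mult_right has_vector_derivative_inverse_power assms)
  moreover have "(-1) ^ j * pochhammer (real q) j * (- real (q + j) / (1 + \<tau>) ^ (q + j + 1))
      = (-1) ^ Suc j * pochhammer (real q) (Suc j) * (1 / (1 + \<tau>) ^ (q + Suc j))"
    by (simp add: pochhammer_Suc mult_ac del: minus_add_distrib)
  ultimately show ?thesis unfolding of_real_mult[symmetric] by (simp only:)
qed

text \<open>Induction on N: the derivative of the remainder of \<open>H k\<close> is the remainder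
  of \<open>H (Suc k)\<close> of one order less, and the mean value inequality on [\<tau>, t1]
  raises the order of the bound. Complex values rule out the Lagrange form.\<close>

lemma taylor_at_right_end:
  fixes H :: "nat \<Rightarrow> real \<Rightarrow> complex"
  assumes t0: "t0 < t1"
    and der: "\<And>k \<tau>. \<tau> \<in> {t0..t1} \<Longrightarrow> (H k has_vector_derivative H (Suc k) \<tau>) (at \<tau> within {t0..t1})"
  shows "\<exists>M. \<forall>\<tau>\<in>{t0..t1}. norm (H k \<tau> - (\<Sum>j<N. H (k + j) t1 * of_real ((\<tau> - t1) ^ j / fact j))) \<le> M * (t1 - \<tau>) ^ N"
proof (induction N arbitrary: k)
  case 0
  have "continuous_on {t0..t1} (H k)"
    by (rule continuous_on_vector_derivative[OF der])
  then have "bounded (H k ` {t0..t1})"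
    by (intro compact_imp_bounded compact_continuous_image) auto
  then show ?case by (auto simp: bounded_iff)
next
  case (Suc N)
  obtain M where M: "\<And>\<tau>. \<tau> \<in> {t0..t1} \<Longrightarrow>
      norm (H (Suc k) \<tau> - (\<Sum>j<N. H (Suc k + j) t1 * of_real ((\<tau> - t1) ^ j / fact j))) \<le> M * (t1 - \<tau>) ^ N"
    using Suc.IH[of "Suc k"] by blast
  define g where "g \<tau> = H k \<tau> - (\<Sum>j<Suc N. H (k + j) t1 * of_real ((\<tau> - t1) ^ j / fact j))" for \<tau>
  define g' where "g' \<tau> = H (Suc k) \<tau> - (\<Sum>j<N. H (Suc k + j) t1 * of_real ((\<tau> - t1) ^ j / fact j))" for \<tau>
  have dg: "(g has_vector_derivative g' \<tau>) (at \<tau> within {t0..t1})" if t: "\<tau> \<in> {t0..t1}" for \<tau>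
  proof -
    have dj: "((\<lambda>\<tau>. (\<tau> - t1) ^ Suc j / fact (Suc j)) has_real_derivative (\<tau> - t1) ^ j / fact j) (at \<tau> within {t0..t1})" for j
    proof -
      have "((\<lambda>\<tau>. (\<tau> - t1) ^ Suc j / fact (Suc j)) has_real_derivative
          (real (Suc j) * (\<tau> - t1) ^ j) / fact (Suc j)) (at \<tau> within {t0..t1})"
      proof (rule DERIV_cdivide)
        have "((\<lambda>\<tau>. \<tau> - t1) has_real_derivative 1) (at \<tau> within {t0..t1})"
          by (auto intro!: derivative_eq_intros)
        from DERIV_power[OF this, of "Suc j"]
        show "((\<lambda>\<tau>. (\<tau> - t1) ^ Suc j) has_real_derivative real (Suc j) * (\<tau> - t1) ^ j) (at \<tau> within {t0..t1})"
          by simp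
      qed
      moreover have "(real (Suc j) * (\<tau> - t1) ^ j) / fact (Suc j) = (\<tau> - t1) ^ j / fact j"
        unfolding fact_Suc by (simp del: of_nat_Suc)
      ultimately show ?thesis by simp
    qed
    have "((\<lambda>\<tau>. H k t1 + (\<Sum>j<N. H (Suc k + j) t1 * of_real ((\<tau> - t1) ^ Suc j / fact (Suc j)))) has_vector_derivative
        0 + (\<Sum>j<N. H (Suc k + j) t1 * of_real ((\<tau> - t1) ^ j / fact j))) (at \<tau> within {t0..t1})"
      by (intro has_vector_derivative_add has_vector_derivative_const has_vector_derivative_sum
          has_vector_derivative_mult_right) (rule has_vector_derivative_of_real[OF dj])
    from has_vector_derivative_diff[OF der[OF t] this]
    show ?thesis
      unfolding g_def[abs_def] g'_def sum.lessThan_Suc_shift by simp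
  qed
  have "norm (g \<tau>) \<le> M * (t1 - \<tau>) ^ Suc N" if t: "\<tau> \<in> {t0..t1}" for \<tau>
  proof -
    \<comment> \<open>The sign of M is read off at t0, where (t1 - t0)^N is positive; it makes M (t1
      - x)^N decreasing in x.\<close>
    have M0: "0 \<le> M"
    proof -
      have "t0 \<in> {t0..t1}" using t0 by simp
      from order.trans[OF norm_ge_zero M[OF this]] have "0 \<le> M * (t1 - t0) ^ N" .
      moreover have "0 < (t1 - t0) ^ N" using t0 by simp
      ultimately show ?thesis by (simp only: zero_le_mult_iff) linarith
    qed
    have "norm (g \<tau> - g t1) \<le> (M * (t1 - \<tau>) ^ N) * norm (\<tau> - t1)"
    proof (rule differentiable_bound[of "{\<tau>..t1}" g "\<lambda>x h. h *\<^sub>R g' x"])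
      show "(g has_derivative (\<lambda>h. h *\<^sub>R g' x)) (at x within {\<tau>..t1})" if "x \<in> {\<tau>..t1}" for x
        using has_vector_derivative_within_subset[OF dg[of x], of "{\<tau>..t1}"] that t
        by (simp add: has_vector_derivative_def)
      show "onorm (\<lambda>h. h *\<^sub>R g' x) \<le> M * (t1 - \<tau>) ^ N" if "x \<in> {\<tau>..t1}" for x
      proof (rule onorm_le)
        fix h :: real
        have "norm (g' x) \<le> M * (t1 - x) ^ N" using M[of x] that t by (simp add: g'_def)
        also have "\<dots> \<le> M * (t1 - \<tau>) ^ N" using that M0 by (intro mult_left_mono power_mono) auto
        finally show "norm (h *\<^sub>R g' x) \<le> M * (t1 - \<tau>) ^ N * norm h"
          by (metis abs_ge_zero mult.commute mult_left_mono norm_scaleR real_norm_def)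
      qed
    qed (use t in auto)
    moreover have "g t1 = 0" unfolding g_def sum.lessThan_Suc_shift by simp
    moreover have "norm (\<tau> - t1) = t1 - \<tau>" using t by simp
    ultimately show ?thesis by (simp add: mult_ac)
  qed
  then show ?case unfolding g_def by blast
qed

text \<open>At the first index N where the coefficients differ, a nonzero multiple of r^-(5+N) would
  be little-o of r^-(5+N). This gives the definite description in \<open>outgoing_coeff\<close> its
  meaning.\<close>

lemma outgoing_expansion_unique:
  assumes "outgoing_expansion \<Phi> u \<theta> \<phi> c" "outgoing_expansion \<Phi> u \<theta> \<phi> c'"
  shows "c = c'"
proof
  fix N
  show "c N = c' N"
  proof (induction N rule: less_induct)
    case (less N)
    define d where "d = c N - c' N"
    have "(\<lambda>r. (phi0_phys \<Phi> u r \<theta> \<phi> - (\<Sum>k\<le>N. c' k * of_real (1 / r ^ (5 + k)))) -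
        (phi0_phys \<Phi> u r \<theta> \<phi> - (\<Sum>k\<le>N. c k * of_real (1 / r ^ (5 + k)))))
          \<in> o[at_top](\<lambda>r. of_real (1 / r ^ (5 + N)))"
      by (rule sum_in_smallo(2)) (rule assms[unfolded outgoing_expansion_def, rule_format])+
    moreover have "(phi0_phys \<Phi> u r \<theta> \<phi> - (\<Sum>k\<le>N. c' k * of_real (1 / r ^ (5 + k)))) -
        (phi0_phys \<Phi> u r \<theta> \<phi> - (\<Sum>k\<le>N. c k * of_real (1 / r ^ (5 + k)))) = d * of_real (1 / r ^ (5 + N))" for r :: real
    proof -
      have "(\<Sum>k<N. c k * complex_of_real (1 / r ^ (5 + k))) = (\<Sum>k<N. c' k * of_real (1 / r ^ (5 + k)))"
        using less by (intro sum.cong) auto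
      then show ?thesis by (simp add: d_def lessThan_Suc_atMost[symmetric] diff_divide_distrib)
    qed
    ultimately have o: "(\<lambda>r. d * of_real (1 / r ^ (5 + N))) \<in> o[at_top](\<lambda>r. of_real (1 / r ^ (5 + N)))"
      by simp
    show ?case
    proof (rule ccontr)
      assume "c N \<noteq> c' N"
      then have d: "0 < norm d" by (simp add: d_def)
      have "\<forall>\<^sub>F r in at_top. norm (d * complex_of_real (1 / r ^ (5 + N))) \<le> norm d / 2 * norm (complex_of_real (1 / r ^ (5 + N)))"
        using landau_o.smallD[OF o, of "norm d / 2"] d by simp
      moreover have "\<forall>\<^sub>F r in at_top. (0 :: real) < r" by (rule eventually_gt_at_top)
      ultimately have "\<forall>\<^sub>F r :: real in at_top. False"
      proof eventually_elim
        case (elim r)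
        then have "norm d * (1 / r ^ (5 + N)) \<le> norm d / 2 * (1 / r ^ (5 + N))"
          by (simp only: norm_mult norm_of_real) simp
        then have "norm d \<le> norm d / 2" using elim(2) by (simp add: divide_right_mono pos_divide_le_eq mult_le_cancel_right)
        then show False using d by simp
      qed
      then show False by simp
    qed
  qed
qed

lemma uniformly_convergent_on_bounded_mult:
  fixes g :: "'a \<Rightarrow> complex"
  assumes "uniformly_convergent_on X f" "\<And>x. x \<in> X \<Longrightarrow> norm (g x) \<le> M"
  shows "uniformly_convergent_on X (\<lambda>N x. g x * f N x)"
proof -
  obtain l where l: "uniform_limit X f l sequentially"
    using assms(1) by (auto simp: uniformly_convergent_on_def)
  have "uniform_limit X (\<lambda>N x. g x * f N x) (\<lambda>x. g x * l x) sequentially"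
    unfolding uniform_limit_iff
  proof (intro allI impI)
    fix e :: real assume e: "0 < e"
    define d where "d = e / (\<bar>M\<bar> + 1)"
    have d: "0 < d" using e by (simp add: d_def)
    have "\<forall>\<^sub>F N in sequentially. \<forall>x\<in>X. dist (f N x) (l x) < d"
      using l d by (simp add: uniform_limit_iff)
    then show "\<forall>\<^sub>F N in sequentially. \<forall>x\<in>X. dist (g x * f N x) (g x * l x) < e"
    proof (rule eventually_mono, intro ballI)
      fix N x assume "\<forall>x\<in>X. dist (f N x) (l x) < d" and x: "x \<in> X"
      then have "dist (f N x) (l x) < d" by blast
      have "dist (g x * f N x) (g x * l x) = norm (g x) * dist (f N x) (l x)"
        by (simp add: dist_norm norm_mult right_diff_distrib[symmetric])
      also have "\<dots> \<le> \<bar>M\<bar> * dist (f N x) (l x)"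
        using assms(2)[OF x] by (intro mult_right_mono) auto
      also have "\<dots> \<le> \<bar>M\<bar> * d"
        using \<open>dist (f N x) (l x) < d\<close> by (intro mult_left_mono) auto
      also have "\<dots> < e" using e by (simp add: d_def field_simps)
      finally show "dist (g x * f N x) (g x * l x) < e" .
    qed
  qed
  then show ?thesis by (auto simp: uniformly_convergent_on_def)
qed

section \<open>The field series along an outgoing ray\<close>

context spin2_expansion
begin

text \<open>On a ray \<rho> = R / (1 + \<tau>) with R = -1/u. The parameters c, q, i, j are chosen
  so that \<tau>-derivatives remain finite sums within this family.\<close>

definition along_ray :: "real \<Rightarrow> real \<Rightarrow> nat \<Rightarrow> nat \<Rightarrow> nat \<Rightarrow> nat \<Rightarrow> real \<Rightarrow> real \<times> real \<Rightarrow> complex" where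
  "along_ray R c q i j p \<tau> \<omega> =
     of_real (c * (1 / (1 + \<tau>) ^ q)) * term_deriv Y a i j [] 4 p \<tau> (R / (1 + \<tau>)) (fst \<omega>) (snd \<omega>)"

text \<open>The three terms come from the prefactor, from the explicit \<tau>, and from \<rho> with
  derivative -R / (1 + \<tau>)^2.\<close>

lemma along_ray_deriv:
  assumes "0 \<le> t0" "\<tau> \<in> {t0..1}"
  shows "((\<lambda>t. along_ray R c q i j p t \<omega>) has_vector_derivative
     along_ray R (- c * real q) (q + 1) i j p \<tau> \<omega> + along_ray R c q (Suc i) j p \<tau> \<omega>
       + along_ray R (- c * R) (q + 2) i (Suc j) p \<tau> \<omega>) (at \<tau> within {t0..1})"
proof -
  have tau: "-1 < \<tau>" "\<tau> \<in> {-1..1}" "1 + \<tau> \<noteq> 0" using assms by auto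
  let ?S = "{t0..1}"
  let ?A = "\<lambda>i \<tau>. ang i [] 4 p \<tau> (fst \<omega>) (snd \<omega>)"
  let ?P = "\<lambda>j. (deriv ^^ j) (\<lambda>r. r ^ p) :: real \<Rightarrow> real"
  have 1: "((\<lambda>t. complex_of_real (c * (1 / (1 + t) ^ q))) has_vector_derivative
      of_real (c * (- real q / (1 + \<tau>) ^ (q + 1)))) (at \<tau> within ?S)"
    using has_vector_derivative_mult_right[OF has_vector_derivative_inverse_power[OF tau(1), of q ?S], of "of_real c"]
    by (simp only: of_real_mult)
  have 2: "(?A i has_vector_derivative ?A (Suc i) \<tau>) (at \<tau> within ?S)"
    by (rule has_vector_derivative_within_subset[OF ang_deriv[OF _ tau(2)]]) (use assms in auto)
  have "((\<lambda>t. R / (1 + t)) has_real_derivative (- R / (1 + \<tau>) ^ 2)) (at \<tau> within ?S)"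
    using tau(3) by (auto intro!: derivative_eq_intros simp: power2_eq_square)
  from DERIV_chain2[OF higher_deriv_power_has_deriv this]
  have 3: "((\<lambda>t. complex_of_real (?P j (R / (1 + t)))) has_vector_derivative
      of_real (?P (Suc j) (R / (1 + \<tau>)) * (- R / (1 + \<tau>) ^ 2))) (at \<tau> within ?S)"
    by (rule has_vector_derivative_of_real)
  let ?g = "complex_of_real (c * (1 / (1 + \<tau>) ^ q))"
  let ?B = "\<lambda>j. complex_of_real (?P j (R / (1 + \<tau>)))"
  have "((\<lambda>t. of_real (c * (1 / (1 + t) ^ q)) * (?A i t * of_real (?P j (R / (1 + t))))) has_vector_derivative
      ?g * (?A i \<tau> * of_real (?P (Suc j) (R / (1 + \<tau>)) * (- R / (1 + \<tau>) ^ 2)) + ?A (Suc i) \<tau> * ?B j)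
      + of_real (c * (- real q / (1 + \<tau>) ^ (q + 1))) * (?A i \<tau> * ?B j)) (at \<tau> within ?S)"
    by (rule has_vector_derivative_mult[OF 1 has_vector_derivative_mult[OF 2 3]])
  moreover have "of_real (c * (- real q / (1 + \<tau>) ^ (q + 1))) = complex_of_real (- c * real q * (1 / (1 + \<tau>) ^ (q + 1)))"
    by simp
  moreover have "?g * (?A i \<tau> * of_real (?P (Suc j) (R / (1 + \<tau>)) * (- R / (1 + \<tau>) ^ 2)))
      = of_real (- c * R * (1 / (1 + \<tau>) ^ (q + 2))) * (?A i \<tau> * ?B (Suc j))"
  proof -
    have e: "c * (1 / (1 + \<tau>) ^ q) * (- R / (1 + \<tau>) ^ 2) = - c * R * (1 / (1 + \<tau>) ^ (q + 2))"
      by (simp add: power_add power2_eq_square)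
    show ?thesis unfolding e[symmetric] of_real_mult by (simp only: mult_ac)
  qed
  ultimately show ?thesis
    unfolding along_ray_def term_deriv_eq by (simp only: distrib_left add_ac)
qed

text \<open>Each ray derivative is a sum of three members of the family, so convergence of all the
  (i, j) series settles every order. Backwards from \<tau> = 1 the radius R / (1 + \<tau>) grows;
  the condition on t0 keeps it at most r, below \<open>\<rho>0\<close>, and \<tau> >= 0 bounds the
  prefactor by |c|.\<close>

lemma along_ray_termwise_smooth:
  assumes R: "0 < R" and t0: "0 \<le> t0" "t0 < 1" and r: "R / (1 + t0) \<le> r" "r < \<rho>0"
  shows "termwise_smooth k {t0..1} chart (along_ray R c q i j)"
proof -
  let ?X = "{t0..1} \<times> chart"
  have r0: "0 \<le> r" using r(1) R t0 by (meson add_nonneg_nonneg divide_nonneg_nonneg less_imp_le order_trans zero_le_one)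
  have conv: "uniformly_convergent_on ?X (\<lambda>N (\<tau>, \<omega>). \<Sum>p\<le>N. along_ray R c q i j p \<tau> \<omega>)" for c q i j
  proof -
    have mem: "(fst x, R / (1 + fst x), fst (snd x), snd (snd x)) \<in> expansion_domain r" if "x \<in> ?X" for x
    proof -
      have x: "t0 \<le> fst x" "fst x \<le> 1" "snd x \<in> chart" using that by auto
      have "R / (1 + fst x) \<le> R / (1 + t0)" using x t0 R by (intro divide_left_mono mult_pos_pos) auto
      moreover have "0 \<le> R / (1 + fst x)" using x t0 R by simp
      ultimately show ?thesis using x t0 r by (simp add: expansion_domain_def)
    qed
    have "uniform_limit ?X (\<lambda>N x. \<Sum>p\<le>N. term_deriv Y a i j [] 4 p (fst x) (R / (1 + fst x)) (fst (snd x)) (snd (snd x)))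
        (\<lambda>x. tsum i j [] 4 (fst x) (R / (1 + fst x)) (fst (snd x)) (snd (snd x))) sequentially"
      by (rule tsum_slice[of 4 r ?X fst "\<lambda>x. R / (1 + fst x)" "\<lambda>x. fst (snd x)" "\<lambda>x. snd (snd x)"])
        (use r0 r mem in auto)
    then have "uniformly_convergent_on ?X
      (\<lambda>N x. \<Sum>p\<le>N. term_deriv Y a i j [] 4 p (fst x) (R / (1 + fst x)) (fst (snd x)) (snd (snd x)))"
      by (auto simp: uniformly_convergent_on_def)
    then have "uniformly_convergent_on ?X
      (\<lambda>N x. of_real (c * (1 / (1 + fst x) ^ q)) *
        (\<Sum>p\<le>N. term_deriv Y a i j [] 4 p (fst x) (R / (1 + fst x)) (fst (snd x)) (snd (snd x))))"
    proof (rule uniformly_convergent_on_bounded_mult[where M = "\<bar>c\<bar>"])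
      fix x assume "x \<in> ?X"
      then have "1 \<le> 1 + fst x" using t0 by auto
      then have "1 \<le> (1 + fst x) ^ q" by (rule one_le_power)
      then have "0 \<le> 1 / (1 + fst x) ^ q" "1 / (1 + fst x) ^ q \<le> 1" by (simp_all add: divide_le_eq)
      then show "norm (complex_of_real (c * (1 / (1 + fst x) ^ q))) \<le> \<bar>c\<bar>"
        unfolding norm_of_real abs_mult by (intro mult_left_le) auto
    qed
    then show ?thesis by (simp add: along_ray_def case_prod_unfold sum_distrib_left)
  qed
  show ?thesis
  proof (induction k arbitrary: c q i j)
    case 0
    show ?case using conv by simp
  next
    case (Suc k)
    let ?g = "\<lambda>p \<tau> \<omega>. along_ray R (- c * real q) (q + 1) i j p \<tau> \<omega> + along_ray R c q (Suc i) j p \<tau> \<omega>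
       + along_ray R (- c * R) (q + 2) i (Suc j) p \<tau> \<omega>"
    have "termwise_smooth k {t0..1} chart ?g"
      by (rule termwise_smooth_add[OF termwise_smooth_add]) (rule Suc.IH)+
    moreover have "\<forall>p. \<forall>\<tau>\<in>{t0..1}. \<forall>\<omega>\<in>chart.
        ((\<lambda>t. along_ray R c q i j p t \<omega>) has_vector_derivative ?g p \<tau> \<omega>) (at \<tau> within {t0..1})"
      by (intro allI ballI) (rule along_ray_deriv[OF t0(1)])
    ultimately show ?case
      unfolding termwise_smooth.simps using conv[of c q i j] by (intro conjI exI[of _ ?g])
  qed
qed

text \<open>The derivatives in \<open>\<tau>\<close> of \<open>a\<^sub>4(\<tau>) (1 + \<tau>)\<^sup>-\<^sup>(\<^sup>p\<^sup>+\<^sup>2\<^sup>)\<close>, by the Leibniz rule.\<close>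

definition scaled_coeff :: "nat \<Rightarrow> nat \<Rightarrow> int \<Rightarrow> nat \<Rightarrow> real \<Rightarrow> complex" where
  "scaled_coeff p l m k \<tau> = (\<Sum>i\<le>k. of_nat (k choose i) * ((deriv_tau ^^ i) (a 4 p l m) \<tau> *
     of_real ((-1) ^ (k - i) * pochhammer (real (p + 2)) (k - i) * (1 / (1 + \<tau>) ^ (p + 2 + (k - i))))))"

lemma scaled_coeff_deriv:
  assumes "2 \<le> l" "l \<le> p" "\<bar>m\<bar> \<le> int l" "0 \<le> t0" "\<tau> \<in> {t0..1}"
  shows "(scaled_coeff p l m k has_vector_derivative scaled_coeff p l m (Suc k) \<tau>) (at \<tau> within {t0..1})"
  unfolding scaled_coeff_def[abs_def]
proof (rule leibniz_derivs)
  show "((deriv_tau ^^ i) (a 4 p l m) has_vector_derivative (deriv_tau ^^ Suc i) (a 4 p l m) \<tau>) (at \<tau> within {t0..1})" for i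
    by (rule has_vector_derivative_within_subset[OF coeff_derivs[OF _ assms(1-3)]]) (use assms in auto)
  show "((\<lambda>\<tau>. complex_of_real ((-1) ^ j * pochhammer (real (p + 2)) j * (1 / (1 + \<tau>) ^ (p + 2 + j)))) has_vector_derivative
      of_real ((-1) ^ Suc j * pochhammer (real (p + 2)) (Suc j) * (1 / (1 + \<tau>) ^ (p + 2 + Suc j)))) (at \<tau> within {t0..1})" for j
    using assms by (intro inverse_power_derivs) auto
qed

text \<open>Order p of 16 u^2 / (1 + \<tau>)^2 times phi_4 on the ray, differentiated k times. The
  powers of 1 + \<tau> from the prefactor and from \<rho>^p are gathered in
  \<open>scaled_coeff\<close>; the lower limit 2 is \<open>min_ell 4\<close>.\<close>

definition ray_term :: "real \<Rightarrow> nat \<Rightarrow> nat \<Rightarrow> real \<Rightarrow> real \<times> real \<Rightarrow> complex" where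
  "ray_term u k p \<tau> \<omega> = (\<Sum>l = 2..p. \<Sum>m = - int l..int l.
      of_real (16 * u\<^sup>2 * (- 1 / u) ^ p / fact p) * scaled_coeff p l m k \<tau> * Y (-2) l m (fst \<omega>) (snd \<omega>))"

lemma ray_term_deriv:
  assumes "0 \<le> t0" "\<tau> \<in> {t0..1}"
  shows "((\<lambda>t. ray_term u k p t \<omega>) has_vector_derivative ray_term u (Suc k) p \<tau> \<omega>) (at \<tau> within {t0..1})"
  unfolding ray_term_def
  by (intro has_vector_derivative_sum has_vector_derivative_mult_left has_vector_derivative_mult_right
      scaled_coeff_deriv assms) auto

lemma ray_term_0: "ray_term u 0 p \<tau> \<omega> = along_ray (- 1 / u) (16 * u\<^sup>2) 2 0 0 p \<tau> \<omega>"
proof -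
  have me: "min_ell 4 = 2" by (simp add: min_ell_def)
  have "along_ray (- 1 / u) (16 * u\<^sup>2) 2 0 0 p \<tau> \<omega> = (\<Sum>l = 2..p. \<Sum>m = - int l..int l.
      of_real (16 * u\<^sup>2 * (1 / (1 + \<tau>) ^ 2)) * (1 / fact p * a 4 p l m \<tau> * Y (-2) l m (fst \<omega>) (snd \<omega>) * of_real ((- 1 / u / (1 + \<tau>)) ^ p)))"
    by (simp add: along_ray_def term_deriv_def me sum_distrib_left)
  also have "\<dots> = ray_term u 0 p \<tau> \<omega>"
    unfolding ray_term_def
  proof (intro sum.cong refl)
    fix l m
    have e: "16 * u\<^sup>2 * (1 / (1 + \<tau>) ^ 2) * (- 1 / u / (1 + \<tau>)) ^ p = 16 * u\<^sup>2 * (- 1 / u) ^ p * (1 / (1 + \<tau>) ^ (p + 2))"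
      unfolding power_divide[of "- 1 / u" "1 + \<tau>"] by (simp add: power_add power2_eq_square)
    have "of_real (16 * u\<^sup>2 * (1 / (1 + \<tau>) ^ 2)) * (1 / fact p * a 4 p l m \<tau> * Y (-2) l m (fst \<omega>) (snd \<omega>) * of_real ((- 1 / u / (1 + \<tau>)) ^ p))
       = of_real (16 * u\<^sup>2 * (1 / (1 + \<tau>) ^ 2) * (- 1 / u / (1 + \<tau>)) ^ p) * (1 / fact p * a 4 p l m \<tau> * Y (-2) l m (fst \<omega>) (snd \<omega>))"
      unfolding of_real_mult by (simp only: mult_ac)
    also have "\<dots> = of_real (16 * u\<^sup>2 * (- 1 / u) ^ p / fact p) * scaled_coeff p l m 0 \<tau> * Y (-2) l m (fst \<omega>) (snd \<omega>)"
      unfolding e by (simp add: scaled_coeff_def mult_ac)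
    finally show "of_real (16 * u\<^sup>2 * (1 / (1 + \<tau>) ^ 2)) * (1 / fact p * a 4 p l m \<tau> * Y (-2) l m (fst \<omega>) (snd \<omega>) * of_real ((- 1 / u / (1 + \<tau>)) ^ p))
       = of_real (16 * u\<^sup>2 * (- 1 / u) ^ p / fact p) * scaled_coeff p l m 0 \<tau> * Y (-2) l m (fst \<omega>) (snd \<omega>)" .
  qed
  finally show ?thesis ..
qed

definition ray_sum :: "real \<Rightarrow> nat \<Rightarrow> real \<Rightarrow> real \<times> real \<Rightarrow> complex" where
  "ray_sum u k \<tau> \<omega> = lim (\<lambda>N. \<Sum>p\<le>N. ray_term u k p \<tau> \<omega>)"

section \<open>Rays with u < 0, followed from \<tau> = t0 to \<tau> = 1 inside the domain of the
  expansion\<close>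

context
  fixes u t0 r :: real
  assumes u: "u < 0" and t0: "0 \<le> t0" "t0 < 1" and r: "- 1 / u / (1 + t0) \<le> r" "r < \<rho>0"
begin

lemma ray_sum_uniform:
  "uniform_limit ({t0..1} \<times> chart) (\<lambda>N (\<tau>, \<omega>). \<Sum>p\<le>N. ray_term u k p \<tau> \<omega>) (\<lambda>(\<tau>, \<omega>). ray_sum u k \<tau> \<omega>) sequentially"
proof -
  have "termwise_smooth j {t0..1} chart (ray_term u k)" for j
  \<comment> \<open>The order j is general because passing from k to k + 1 uses up one order of
    smoothness.\<close>
  proof (induction k arbitrary: j)
    case 0
    show ?case
      by (rule termwise_smooth_cong[OF ray_term_0[symmetric]]) (rule along_ray_termwise_smooth[OF _ t0 r], use u in simp)
  next
    case (Suc k)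
    show ?case by (rule termwise_smooth_deriv[OF t0(2) Suc.IH ray_term_deriv[OF t0(1)]])
  qed
  from termwise_smooth_convergent[OF this[of 0]] show ?thesis
    unfolding uniformly_convergent_uniform_limit_iff by (simp add: case_prod_unfold ray_sum_def)
qed

lemma ray_sum_slice:
  assumes "\<And>x. x \<in> X \<Longrightarrow> f x \<in> {t0..1} \<and> g x \<in> chart"
  shows "uniform_limit X (\<lambda>N x. \<Sum>p\<le>N. ray_term u k p (f x) (g x)) (\<lambda>x. ray_sum u k (f x) (g x)) sequentially"
  using uniform_limit_slice[OF ray_sum_uniform, of X "\<lambda>x. (f x, g x)"] assms by (simp add: mem_Times_iff)

lemma ray_sum_tendsto:
  assumes "\<tau> \<in> {t0..1}" "\<omega> \<in> chart"
  shows "(\<lambda>N. \<Sum>p\<le>N. ray_term u k p \<tau> \<omega>) \<longlonglongrightarrow> ray_sum u k \<tau> \<omega>"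
proof -
  have "uniform_limit {()} (\<lambda>N x. \<Sum>p\<le>N. ray_term u k p \<tau> \<omega>) (\<lambda>x. ray_sum u k \<tau> \<omega>) sequentially"
    by (rule ray_sum_slice) (use assms in auto)
  from tendsto_uniform_limitI[OF this, of "()"] show ?thesis by simp
qed

lemma ray_sum_deriv:
  assumes "\<tau> \<in> {t0..1}" "\<omega> \<in> chart"
  shows "((\<lambda>t. ray_sum u k t \<omega>) has_vector_derivative ray_sum u (Suc k) \<tau> \<omega>) (at \<tau> within {t0..1})"
proof (rule has_vector_derivative_sequence[of _
      "\<lambda>N t. \<Sum>p\<le>N. ray_term u k p t \<omega>" "\<lambda>N t. \<Sum>p\<le>N. ray_term u (Suc k) p t \<omega>"])
  show "((\<lambda>t. \<Sum>p\<le>N. ray_term u k p t \<omega>) has_vector_derivative (\<Sum>p\<le>N. ray_term u (Suc k) p x \<omega>)) (at x within {t0..1})"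
    if "x \<in> {t0..1}" for N x
    by (intro has_vector_derivative_sum ray_term_deriv t0 that)
  show "(\<lambda>N. \<Sum>p\<le>N. ray_term u k p x \<omega>) \<longlonglongrightarrow> ray_sum u k x \<omega>" if "x \<in> {t0..1}" for x
    by (rule ray_sum_tendsto[OF that assms(2)])
  show "uniform_limit {t0..1} (\<lambda>N t. \<Sum>p\<le>N. ray_term u (Suc k) p t \<omega>) (\<lambda>t. ray_sum u (Suc k) t \<omega>) sequentially"
    by (rule ray_sum_slice[of _ "\<lambda>t. t" "\<lambda>_. \<omega>"]) (use assms in auto)
qed (use assms in auto)

lemma ray_sum_0:
  assumes "\<tau> \<in> {t0..1}" "(\<theta>, \<phi>) \<in> chart"
  shows "ray_sum u 0 \<tau> (\<theta>, \<phi>) = of_real (16 * u\<^sup>2 * (1 / (1 + \<tau>) ^ 2)) * \<Phi> 4 \<tau> (- 1 / u / (1 + \<tau>)) \<theta> \<phi>"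
proof -
  have pos: "0 \<le> - 1 / u" using u by (simp add: divide_nonpos_neg)
  have "- 1 / u / (1 + \<tau>) \<le> - 1 / u / (1 + t0)"
    by (rule divide_left_mono[OF _ pos]) (use assms t0 in auto)
  moreover have "0 \<le> - 1 / u / (1 + \<tau>)"
    by (rule divide_nonneg_nonneg[OF pos]) (use assms t0 in auto)
  ultimately have dom: "in_domain \<tau> (- 1 / u / (1 + \<tau>)) \<theta> \<phi>" using assms t0 r by simp
  have "(\<lambda>N. of_real (16 * u\<^sup>2 * (1 / (1 + \<tau>) ^ 2)) * (\<Sum>p\<le>N. term_deriv Y a 0 0 [] 4 p \<tau> (- 1 / u / (1 + \<tau>)) \<theta> \<phi>))
      \<longlonglongrightarrow> of_real (16 * u\<^sup>2 * (1 / (1 + \<tau>) ^ 2)) * \<Phi> 4 \<tau> (- 1 / u / (1 + \<tau>)) \<theta> \<phi>"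
    unfolding field_eq_tsum[OF order.refl dom] by (intro tendsto_mult tendsto_const tsum_tendsto dom) simp
  moreover have "of_real (16 * u\<^sup>2 * (1 / (1 + \<tau>) ^ 2)) * (\<Sum>p\<le>N. term_deriv Y a 0 0 [] 4 p \<tau> (- 1 / u / (1 + \<tau>)) \<theta> \<phi>)
      = (\<Sum>p\<le>N. ray_term u 0 p \<tau> (\<theta>, \<phi>))" for N
    unfolding ray_term_0 along_ray_def by (simp add: sum_distrib_left)
  ultimately show ?thesis using ray_sum_tendsto[OF assms, of 0] LIMSEQ_unique by simp
qed

lemma phi0_phys_ray:
  assumes "(\<theta>, \<phi>) \<in> chart" "0 < x" "1 + u / x \<in> {t0..1}"
  shows "phi0_phys \<Phi> u x \<theta> \<phi> = of_real (1 / x ^ 5) * ray_sum u 0 (1 + u / x) (\<theta>, \<phi>)"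
proof -
  define s where "s = 1 + (1 + u / x)"
  have s: "s > 0" using assms(3) t0 by (simp add: s_def)
  have tau: "tau_of (u + x) x = 1 + u / x" using assms(2) by (simp add: tau_of_def field_simps)
  have "x\<^sup>2 - (u + x)\<^sup>2 = - u * s * x"
    using assms(2) by (simp add: s_def field_simps power2_eq_square)
  note d = this
  \<comment> \<open>As s = 1 + \<tau> = 2 + u/x, this puts the ray in the form \<rho> = R / (1 +
    \<tau>) with R = -1/u.\<close>
  have rho: "rho_of (u + x) x = - 1 / u / s"
    unfolding rho_of_def d using assms(2) u s by (simp add: field_simps)
  have "16 / ((- 1 / u / s)\<^sup>2 * s ^ 4) = 16 * u\<^sup>2 * (1 / s ^ 2)"
    using u s by (simp add: field_simps eval_nat_numeral)
  then show ?thesis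
    unfolding phi0_phys_def phi0'_def tau rho ray_sum_0[OF assms(3,1)] s_def[symmetric] by simp
qed

text \<open>Taylor expansion at \<tau> = 1 with \<tau> - 1 = u / x. The polynomial has degree N
  while the remainder has order N + 1, which yields the little-o.\<close>

lemma outgoing_expansion_ray:
  assumes ch: "(\<theta>, \<phi>) \<in> chart"
  shows "outgoing_expansion \<Phi> u \<theta> \<phi> (\<lambda>k. ray_sum u k 1 (\<theta>, \<phi>) * of_real (u ^ k / fact k))"
  unfolding outgoing_expansion_def
proof (intro allI landau_o.smallI)
  fix N and c :: real assume c: "c > 0"
  let ?H = "\<lambda>k \<tau>. ray_sum u k \<tau> (\<theta>, \<phi>)"
  obtain M where M: "\<And>\<tau>. \<tau> \<in> {t0..1} \<Longrightarrow>
      norm (?H 0 \<tau> - (\<Sum>j<Suc N. ?H (0 + j) 1 * of_real ((\<tau> - 1) ^ j / fact j))) \<le> M * (1 - \<tau>) ^ Suc N"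
    using taylor_at_right_end[of t0 1 ?H 0 "Suc N"] t0 ray_sum_deriv[OF _ ch] by blast
  \<comment> \<open>With this constant the Taylor remainder is at most B / x^(N+1). Of the
    thresholds below, the second puts 1 + u/x into [t0, 1] and the third makes B / x at most
    c.\<close>
  define B where "B = \<bar>M\<bar> * (- u) ^ Suc N"
  have "\<forall>\<^sub>F x :: real in at_top. x > 0" "\<forall>\<^sub>F x in at_top. x \<ge> - u / (1 - t0)" "\<forall>\<^sub>F x in at_top. x \<ge> B / c"
    by (rule eventually_gt_at_top eventually_ge_at_top)+
  then show "\<forall>\<^sub>F x in at_top. norm (phi0_phys \<Phi> u x \<theta> \<phi> -
      (\<Sum>k\<le>N. ?H k 1 * of_real (u ^ k / fact k) * of_real (1 / x ^ (5 + k))))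
      \<le> c * norm (complex_of_real (1 / x ^ (5 + N)))"
  proof eventually_elim
    case (elim x)
    let ?\<tau> = "1 + u / x"
    have "- u \<le> x * (1 - t0)" using elim(2) t0 by (subst (asm) pos_divide_le_eq) auto
    then have "- u / x \<le> 1 - t0" using elim(1) by (subst pos_divide_le_eq) (auto simp: mult.commute)
    then have tau: "?\<tau> \<in> {t0..1}" using elim(1) u by (simp add: divide_nonpos_pos)
    have "(\<Sum>k\<le>N. ?H k 1 * of_real (u ^ k / fact k) * of_real (1 / x ^ (5 + k)))
        = of_real (1 / x ^ 5) * (\<Sum>j<Suc N. ?H (0 + j) 1 * of_real ((?\<tau> - 1) ^ j / fact j))"
      unfolding sum_distrib_left lessThan_Suc_atMost
      by (intro sum.cong refl) (simp add: power_add power_divide)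
    then have "phi0_phys \<Phi> u x \<theta> \<phi> - (\<Sum>k\<le>N. ?H k 1 * of_real (u ^ k / fact k) * of_real (1 / x ^ (5 + k)))
        = of_real (1 / x ^ 5) * (?H 0 ?\<tau> - (\<Sum>j<Suc N. ?H (0 + j) 1 * of_real ((?\<tau> - 1) ^ j / fact j)))"
      unfolding phi0_phys_ray[OF ch elim(1) tau] by (simp only: right_diff_distrib)
    then have "norm (phi0_phys \<Phi> u x \<theta> \<phi> - (\<Sum>k\<le>N. ?H k 1 * of_real (u ^ k / fact k) * of_real (1 / x ^ (5 + k))))
        = 1 / x ^ 5 * norm (?H 0 ?\<tau> - (\<Sum>j<Suc N. ?H (0 + j) 1 * of_real ((?\<tau> - 1) ^ j / fact j)))"
      using elim(1) by (simp only: norm_mult norm_of_real) simp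
    also have "\<dots> \<le> 1 / x ^ 5 * (\<bar>M\<bar> * (1 - ?\<tau>) ^ Suc N)"
    proof (rule mult_left_mono)
      have "M * (1 - ?\<tau>) ^ Suc N \<le> \<bar>M\<bar> * (1 - ?\<tau>) ^ Suc N"
        using tau by (intro mult_right_mono zero_le_power) auto
      then show "norm (?H 0 ?\<tau> - (\<Sum>j<Suc N. ?H (0 + j) 1 * of_real ((?\<tau> - 1) ^ j / fact j))) \<le> \<bar>M\<bar> * (1 - ?\<tau>) ^ Suc N"
        using M[OF tau] by linarith
    qed (use elim(1) in simp)
    also have "\<bar>M\<bar> * (1 - ?\<tau>) ^ Suc N = B / x ^ Suc N"
    proof -
      have "1 - ?\<tau> = - u / x" by simp
      then show ?thesis unfolding B_def by (simp only: power_divide times_divide_eq_right)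
    qed
    also have "1 / x ^ 5 * (B / x ^ Suc N) = B / x * (1 / x ^ (5 + N))"
      using elim(1) by (simp add: power_add)
    also have "\<dots> \<le> c * (1 / x ^ (5 + N))"
    proof (rule mult_right_mono)
      show "B / x \<le> c" using elim(1,3) c by (simp add: divide_le_eq mult.commute)
    qed (use elim(1) in simp)
    also have "\<dots> = c * norm (complex_of_real (1 / x ^ (5 + N)))"
      using elim(1) by (simp only: norm_of_real) simp
    finally show ?case .
  qed
qed

lemma outgoing_coeff_ray:
  assumes "(\<theta>, \<phi>) \<in> chart"
  shows "outgoing_coeff \<Phi> k u \<theta> \<phi> = ray_sum u k 1 (\<theta>, \<phi>) * of_real (u ^ k / fact k)"
proof -
  have "(THE c. outgoing_expansion \<Phi> u \<theta> \<phi> c) = (\<lambda>k. ray_sum u k 1 (\<theta>, \<phi>) * of_real (u ^ k / fact k))"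
    using outgoing_expansion_ray[OF assms] by (intro the_equality outgoing_expansion_unique)
  then show ?thesis by (simp add: outgoing_coeff_def)
qed

lemma ray_term_projection:
  assumes l: "2 \<le> l" "\<bar>m\<bar> \<le> int l"
  shows "projectable (-2) l m (\<lambda>\<theta> \<phi>. ray_term u k p \<tau> (\<theta>, \<phi>))"
    and "proj (-2) l m (\<lambda>\<theta> \<phi>. ray_term u k p \<tau> (\<theta>, \<phi>))
      = (if l \<le> p then of_real (16 * u\<^sup>2 * (- 1 / u) ^ p / fact p) * scaled_coeff p l m k \<tau> else 0)"
proof -
  define c where "c l m = (if l \<le> p then of_real (16 * u\<^sup>2 * (- 1 / u) ^ p / fact p) * scaled_coeff p l m k \<tau> else 0)" for l m
  \<comment> \<open>The upper limit p + l, with zero coefficients beyond p, includes the index l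
    even when l exceeds p.\<close>
  have f: "ray_term u k p \<tau> (\<theta>, \<phi>) = (\<Sum>l'=2..p + l. \<Sum>m'=- int l'..int l'. c l' m' * Y (-2) l' m' \<theta> \<phi>)" for \<theta> \<phi>
  proof -
    have "(\<Sum>l'=2..p + l. \<Sum>m'=- int l'..int l'. c l' m' * Y (-2) l' m' \<theta> \<phi>)
        = (\<Sum>l'=2..p. \<Sum>m'=- int l'..int l'. c l' m' * Y (-2) l' m' \<theta> \<phi>)"
      by (rule sum.mono_neutral_right) (auto simp: c_def)
    then show ?thesis by (simp add: ray_term_def c_def)
  qed
  have *: "\<bar>- 2\<bar> \<le> int l" "l \<le> p + l" using l by auto
  have c0: "c l' m' = 0" if "2 \<le> l'" "int l' < \<bar>- 2\<bar>" for l' m' using that by simp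
  note P = proj_harmonic_sum[OF *(1) l(2,1) *(2) c0 f]
  show "projectable (-2) l m (\<lambda>\<theta> \<phi>. ray_term u k p \<tau> (\<theta>, \<phi>))" by (rule P(1))
  show "proj (-2) l m (\<lambda>\<theta> \<phi>. ray_term u k p \<tau> (\<theta>, \<phi>))
      = (if l \<le> p then of_real (16 * u\<^sup>2 * (- 1 / u) ^ p / fact p) * scaled_coeff p l m k \<tau> else 0)"
    using P(2) by (simp add: c_def)
qed

lemma ray_term_continuous: "continuous_on chart (\<lambda>(\<theta>, \<phi>). ray_term u k p \<tau> (\<theta>, \<phi>))"
proof -
  have "continuous_on chart (\<lambda>x. Y (-2) l m (fst x) (snd x))" if "l \<in> {2..p}" "m \<in> {- int l..int l}" for l m
    using harmonic_continuous[OF harm, of "-2" l m] that by (auto simp: case_prod_unfold)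
  then show ?thesis
    unfolding ray_term_def case_prod_unfold fst_conv snd_conv
    by (intro continuous_on_sum continuous_on_mult continuous_on_const)
qed

text \<open>Integration against the harmonic commutes with the uniform limit, and as only p = l + 1
  contributes, the projected partial sums are constant from N = l + 1 on.\<close>

lemma proj_ray_sum:
  assumes l: "2 \<le> l" "\<bar>m\<bar> \<le> int l"
  shows "proj (-2) l m (\<lambda>\<theta> \<phi>. ray_sum u (l - 1) 1 (\<theta>, \<phi>)) =
    of_real (16 * u\<^sup>2 * (- 1 / u) ^ (l + 1) / fact (l + 1)) *
      (C_constant a (l + 1) l m * of_real ((-1) ^ (l - 1) * pochhammer (real l + 3) (l - 1) / 2 ^ (2 * l + 2)))"
    (is "_ = ?V")
proof -
  have abs2: "\<bar>- 2\<bar> \<le> int l" using l by simp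
  let ?g = "\<lambda>\<theta> \<phi>. cnj (Y (-2) l m \<theta> \<phi>)"
  let ?F = "\<lambda>N \<theta> \<phi>. \<Sum>p\<le>N. ray_term u (l - 1) p 1 (\<theta>, \<phi>)"
  have one: "1 \<in> {t0..1}" using t0 by simp
  have split: "?g \<theta> \<phi> * ?F N \<theta> \<phi> = (\<Sum>p\<le>N. ?g \<theta> \<phi> * ray_term u (l - 1) p 1 (\<theta>, \<phi>))" for N \<theta> \<phi>
    by (simp add: sum_distrib_left)
  note S = sphere_integral_sum[of "{..N}" "\<lambda>p \<theta> \<phi>. ?g \<theta> \<phi> * ray_term u (l - 1) p 1 (\<theta>, \<phi>)" for N,
      OF finite_atMost ray_term_projection(1)[OF l, unfolded projectable_def]]
  have "(\<lambda>N. sphere_integral (\<lambda>\<theta> \<phi>. ?g \<theta> \<phi> * ?F N \<theta> \<phi>)) \<longlonglongrightarrow>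
      sphere_integral (\<lambda>\<theta> \<phi>. ?g \<theta> \<phi> * ray_sum u (l - 1) 1 (\<theta>, \<phi>))"
  proof (rule sphere_integral_uniform_limit)
    show "continuous_on chart (\<lambda>(\<theta>, \<phi>). ?g \<theta> \<phi>)"
      using harmonic_continuous[OF harm abs2 l(2)] by (auto simp: case_prod_unfold intro!: continuous_intros)
    show "sphere_integrable ?g" by (rule harmonic_cnj_integrable[OF harm abs2 l(2)])
    show "continuous_on chart (\<lambda>(\<theta>, \<phi>). ?F N \<theta> \<phi>)" for N
      using ray_term_continuous by (auto simp: case_prod_unfold intro!: continuous_on_sum)
    show "sphere_integrable (\<lambda>\<theta> \<phi>. ?g \<theta> \<phi> * ?F N \<theta> \<phi>)" for N
      unfolding split using S by blast
    show "uniform_limit chart (\<lambda>N (\<theta>, \<phi>). ?F N \<theta> \<phi>) (\<lambda>(\<theta>, \<phi>). ray_sum u (l - 1) 1 (\<theta>, \<phi>)) sequentially"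
      using ray_sum_slice[of chart "\<lambda>_. 1" "\<lambda>x. x" "l - 1"] one by (simp add: case_prod_unfold)
  qed
  moreover have "sphere_integral (\<lambda>\<theta> \<phi>. ?g \<theta> \<phi> * ?F N \<theta> \<phi>) = ?V" if N: "l + 1 \<le> N" for N
  proof -
    have term_eq: "proj (-2) l m (\<lambda>\<theta> \<phi>. ray_term u (l - 1) p 1 (\<theta>, \<phi>)) = (if p = l + 1 then ?V else 0)" for p
    proof (cases "l \<le> p")
      case True
      have "scaled_coeff p l m (l - 1) 1 = (if p = l + 1
        then C_constant a p l m * of_real ((-1) ^ (l - 1) * pochhammer (real l + 3) (l - 1) / 2 ^ (2 * l + 2)) else 0)"
        by (rule scri_derivative[where D = "scaled_coeff p l m", OF l(1) True l(2) t0])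
          (use scaled_coeff_deriv[OF l(1) True l(2) t0(1)] in \<open>auto simp: scaled_coeff_def\<close>)
      then show ?thesis unfolding ray_term_projection(2)[OF l] using True by simp
    next
      case False
      then show ?thesis unfolding ray_term_projection(2)[OF l] by simp
    qed
    have "sphere_integral (\<lambda>\<theta> \<phi>. ?g \<theta> \<phi> * ?F N \<theta> \<phi>)
        = (\<Sum>p\<le>N. proj (-2) l m (\<lambda>\<theta> \<phi>. ray_term u (l - 1) p 1 (\<theta>, \<phi>)))"
      unfolding split using S by (simp add: proj_def)
    also have "\<dots> = ?V" unfolding term_eq using N by simp
    finally show ?thesis .
  qed
  then have "\<forall>\<^sub>F N in sequentially. sphere_integral (\<lambda>\<theta> \<phi>. ?g \<theta> \<phi> * ?F N \<theta> \<phi>) = ?V"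
    unfolding eventually_sequentially by blast
  then have "(\<lambda>N. sphere_integral (\<lambda>\<theta> \<phi>. ?g \<theta> \<phi> * ?F N \<theta> \<phi>)) \<longlonglongrightarrow> ?V"
    by (rule tendsto_eventually)
  ultimately show ?thesis unfolding proj_def by (rule LIMSEQ_unique)
qed

end

text \<open>With l = n + 1 and p = n + 2: 16 is the constant in \<open>phi0'\<close>, 1/n! comes
  from the Taylor coefficient, 1/(n+2)! from the expansion in \<rho>, and the rising factorial over
  2^(2n+4) from the n-th derivative of (1 + \<tau>)^-(n+4) at 1. The powers of u combine to (-1)^n,
  which cancels the sign of that derivative.\<close>

lemma NP_constant_eq:
  assumes n: "1 \<le> n" and m: "\<bar>m\<bar> \<le> int n + 1" and rs: "0 < \<rho>s" "\<rho>s < \<rho>0"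
  shows "NP_constant Y \<Phi> \<rho>s (n - 1) m =
    of_real (16 * pochhammer (real n + 4) n / (fact n * fact (n + 2) * 2 ^ (2 * n + 4))) * C_constant a (n + 2) (n + 1) m"
proof -
  define u where "u = - 1 / (2 * \<rho>s)"
  have u: "u < 0" using rs by (simp add: u_def divide_neg_pos)
  have ru: "- 1 / u = 2 * \<rho>s" using rs by (simp add: u_def)
  \<comment> \<open>Any r strictly between \<open>\<rho>s\<close> and \<open>\<rho>0\<close> would
    do. Then t0 is taken so large that the radius 2 \<open>\<rho>s\<close> / (1 + t0) is at most r;
    it stays below 1 because r exceeds \<open>\<rho>s\<close>.\<close>
  define r where "r = (\<rho>s + \<rho>0) / 2"
  have r: "\<rho>s < r" "r < \<rho>0" using rs by (simp_all add: r_def)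
  define t0 where "t0 = max 0 (2 * \<rho>s / r - 1)"
  have t0: "0 \<le> t0" "t0 < 1" using r rs by (auto simp: t0_def divide_less_eq)
  have "2 * \<rho>s / r \<le> 1 + t0" by (simp add: t0_def)
  then have r': "- 1 / u / (1 + t0) \<le> r" unfolding ru using r rs t0 by (simp add: divide_le_eq mult.commute)
  note hyps = u t0 r' r(2)
  have l: "2 \<le> n + 1" "\<bar>m\<bar> \<le> int (n + 1)" using n m by auto
  have idx: "n - 1 + 2 = n + 1" "n - 1 + 1 = n" "n + 1 - 1 = n" "n + 1 + 1 = n + 2" using n by auto
  have "NP_constant Y \<Phi> \<rho>s (n - 1) m
      = sphere_integral (\<lambda>\<theta> \<phi>. cnj (Y (-2) (n + 1) m \<theta> \<phi>) * outgoing_coeff \<Phi> n u \<theta> \<phi>)"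
    unfolding NP_constant_def idx u_def ..
  also have "\<dots> = proj (-2) (n + 1) m (\<lambda>\<theta> \<phi>. of_real (u ^ n / fact n) * ray_sum u n 1 (\<theta>, \<phi>))"
    unfolding proj_def
    by (rule sphere_integral_cong) (simp add: outgoing_coeff_ray[OF hyps])
  also have "\<dots> = of_real (u ^ n / fact n) * proj (-2) (n + 1) m (\<lambda>\<theta> \<phi>. ray_sum u n 1 (\<theta>, \<phi>))"
    by (rule proj_cmult(2))
  also have "\<dots> = of_real (u ^ n / fact n * (16 * u\<^sup>2 * (- 1 / u) ^ (n + 2) / fact (n + 2)) *
      ((-1) ^ n * pochhammer (real (n + 1) + 3) n / 2 ^ (2 * (n + 1) + 2))) * C_constant a (n + 2) (n + 1) m"
    using proj_ray_sum[OF hyps l] unfolding idx by (simp only: of_real_mult mult_ac)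
  also have "u ^ n / fact n * (16 * u\<^sup>2 * (- 1 / u) ^ (n + 2) / fact (n + 2)) *
      ((-1) ^ n * pochhammer (real (n + 1) + 3) n / 2 ^ (2 * (n + 1) + 2))
      = 16 * pochhammer (real n + 4) n / (fact n * fact (n + 2) * 2 ^ (2 * n + 4))"
  proof -
    have "u ^ n * (u\<^sup>2 * (- 1 / u) ^ (n + 2)) * (-1) ^ n = (u * (- 1 / u)) ^ (n + 2) * (-1) ^ n"
      by (simp only: power_mult_distrib power_add mult_ac)
    also have "\<dots> = 1" using u by (simp add: power_add[symmetric] power_mult_distrib[symmetric])
    finally have e: "u ^ n * (u\<^sup>2 * (- 1 / u) ^ (n + 2)) * (-1) ^ n = 1" .
    have "u ^ n / fact n * (16 * u\<^sup>2 * (- 1 / u) ^ (n + 2) / fact (n + 2)) *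
      ((-1) ^ n * pochhammer (real (n + 1) + 3) n / 2 ^ (2 * (n + 1) + 2))
      = (u ^ n * (u\<^sup>2 * (- 1 / u) ^ (n + 2)) * (-1) ^ n) *
        (16 * pochhammer (real (n + 1) + 3) n / (fact n * fact (n + 2) * 2 ^ (2 * (n + 1) + 2)))"
      by (simp only: times_divide_eq_left times_divide_eq_right divide_divide_eq_left mult_ac)
    also have "\<dots> = 16 * pochhammer (real n + 4) n / (fact n * fact (n + 2) * 2 ^ (2 * n + 4))"
    proof -
      have "real (n + 1) + 3 = real n + 4" "2 * (n + 1) + 2 = 2 * n + 4" by simp_all
      then show ?thesis unfolding e by (simp only: mult_1_left)
    qed
    finally show ?thesis .
  qed
  finally show ?thesis .
qed

end

text \<open>The factor is quantified before the harmonics, the field and the cut, which expresses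
  that it depends on n alone; having the identity for every \<open>\<rho>s\<close> includes
  independence of the cut.\<close>

theorem proposition9:
  shows "\<exists>Qplus :: nat \<Rightarrow> real.
    \<forall>Y \<Phi> a \<rho>0.
      spin_weighted_harmonics Y \<and>
      spin2_field_regular \<Phi> \<and>
      spin2_equations \<Phi> \<and>
      0 < \<rho>0 \<and>
      has_expansion Y \<rho>0 a \<Phi> \<and>
      regularity_condition a \<longrightarrow>
      (\<forall>n\<ge>1. \<forall>m. \<bar>m\<bar> \<le> int n + 1 \<longrightarrow>
        (\<forall>\<rho>s. 0 < \<rho>s \<and> \<rho>s < \<rho>0 \<longrightarrow>
          NP_constant Y \<Phi> \<rho>s (n - 1) m = of_real (Qplus n) * C_constant a (n + 2) (n + 1) m))"
proof (intro exI allI impI, elim conjE)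
  fix Y \<Phi> a \<rho>0 n m \<rho>s
  assume "spin_weighted_harmonics Y" "spin2_equations \<Phi>" "0 < (\<rho>0 :: real)" "has_expansion Y \<rho>0 a \<Phi>"
    and n: "1 \<le> (n :: nat)" "\<bar>m\<bar> \<le> int n + 1" "0 < (\<rho>s :: real)" "\<rho>s < \<rho>0"
  then interpret spin2_expansion Y \<Phi> a \<rho>0 by unfold_locales
  show "NP_constant Y \<Phi> \<rho>s (n - 1) m =
    of_real ((\<lambda>n. 16 * pochhammer (real n + 4) n / (fact n * fact (n + 2) * 2 ^ (2 * n + 4))) n) *
      C_constant a (n + 2) (n + 1) m"
    using NP_constant_eq[OF n] by simp
qed

end
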